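(* There is a probability density function $g:[0,\infty)\to[0,\infty)$ such that, for almost every twice-marked torus $\omega\in\mathcal{H}(0,0)$ with respect to an $SL_2(\mathbb{R})$-invariant probability measure on $\mathcal{H}(0,0)$ that is in the same measure class as Lebesgue measure, and for every interval $I\subset[0,\infty)$, $$\lim_{N\to\infty}\frac{|\mathcal{G}^N_V(\Lambda^d_\omega)\cap I|}{N}=\int_I g(x)\,dx .$$
   Context: A twice-marked torus is a unit-area flat torus $\mathbb{R}^2/h\mathbb{Z}^2$, $h\in SL_2(\mathbb{R})$, with two distinct marked points, the first at the origin and the second at $v+h\mathbb{Z}^2$. It is identified with the affine lattice $h\mathbb{Z}^2+v$, so the space of twice-marked tori is $\mathcal{H}(0,0)=AX_2=(SL_2(\mathbb{R})\ltimes\mathbb{R}^2)/(SL_2(\mathbb{Z})\ltimes\mathbb{Z}^2)$, on which $SL_2(\mathbb{R})$ acts by $A\cdot(h\mathbb{Z}^2+v)=Ah\mathbb{Z}^2+Av$. For $\omega\in\mathcal{H}(0,0)$ corresponding to $(h,v)$, $\Lambda^d_\omega$ is the set of holonomy vectors of trajectories between distinct marked points (from the first to the second), i.e. the affine lattice $\Lambda^d_\omega=h\mathbb{Z}^2+v$. Let $V=\{(x,y)\in\mathbb{R}^2:0<x\le1,\ y>0\}$ and let $0<s_1<s_2<\cdots$ be the slopes $y/x$ of the vectors $(x,y)\in\Lambda^d_\omega\cap V$ in increasing order; put $s_0=0$. Then $\mathcal{G}^N_V(\Lambda^d_\omega)=\{s_i-s_{i-1}:i=1,\dots,N\}$, counted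 with multiplicity. *)

theory Defs
  imports "HOL-Probability.Probability" "HOL-Library.Multiset"
begin

definition SL2 :: "(real^2^2) set"
  where "SL2 = {h. det h = 1}"

definition int_lattice :: "(real^2) set"
  where "int_lattice = {z. \<forall>i. z $ i \<in> \<int>}"

definition affine_lattice :: "real^2^2 \<Rightarrow> real^2 \<Rightarrow> (real^2) set"
  where "affine_lattice h v = (\<lambda>z. h *v z + v) ` int_lattice"

text \<open>
  The torus with marked points 0 and v is identified with the affine lattice of
  vectors from the first to the second marked point.  The stabiliser of the integer
  lattice in the affine group is the integral affine group, so the affine lattices are
  exactly the points of the homogeneous space.  The degenerate points, where v lies in
  the lattice itself, are kept; they form a Lebesgue-null set.
\<close>

definition AX2 :: "(real^2) set set"
  where "AX2 = {affine_lattice h v |h v. h \<in> SL2}"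

definition SL2_act :: "real^2^2 \<Rightarrow> (real^2) set \<Rightarrow> (real^2) set"
  where "SL2_act A \<omega> = (\<lambda>p. A *v p) ` \<omega>"

text \<open>
  The quotient Borel structure: a set is measurable iff its preimage in the affine group
  is Borel.  As the group is divided by a discrete subgroup, these are the Borel sets of
  the quotient topology.
\<close>

definition borel_AX2 :: "(real^2) set measure"
  where "borel_AX2 = sigma AX2
    {S. S \<subseteq> AX2 \<and> {(h, v). h \<in> SL2 \<and> affine_lattice h v \<in> S} \<in> sets borel}"

text \<open>
  The Lebesgue measure class on the locus of area one comes from Lebesgue measure in
  period coordinates: the columns of M are the holonomies of a basis of absolute
  homology and w is the holonomy from the first to the second marked point.  A set of
  unit-area surfaces is null iff the cone over it is.
\<close>

definition period_cone :: "(real^2) set set \<Rightarrow> ((real^2^2) \<times> (real^2)) set"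
  where "period_cone S =
    {(M, w). 0 < det M \<and> (\<lambda>p. p /\<^sub>R sqrt (det M)) ` affine_lattice M w \<in> S}"

definition in_Lebesgue_class :: "(real^2) set measure \<Rightarrow> bool"
  where "in_Lebesgue_class \<mu> \<longleftrightarrow>
    (\<forall>S \<in> sets \<mu>. S \<in> null_sets \<mu> \<longleftrightarrow> period_cone S \<in> null_sets lborel)"

definition SL2_invariant :: "(real^2) set measure \<Rightarrow> bool"
  where "SL2_invariant \<mu> \<longleftrightarrow> (\<forall>A \<in> SL2. distr \<mu> borel_AX2 (SL2_act A) = \<mu>)"

definition invariant_Lebesgue_class_prob :: "(real^2) set measure \<Rightarrow> bool"
  where "invariant_Lebesgue_class_prob \<mu> \<longleftrightarrow>
    sets \<mu> = sets borel_AX2 \<and> prob_space \<mu> \<and> SL2_invariant \<mu> \<and> in_Lebesgue_class \<mu>"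

definition strip :: "(real^2) set"
  where "strip = {p. 0 < p $ 1 \<and> p $ 1 \<le> 1 \<and> 0 < p $ 2}"

definition slopes :: "(real^2) set \<Rightarrow> real set"
  where "slopes \<Lambda> = (\<lambda>p. p $ 2 / p $ 1) ` (\<Lambda> \<inter> strip)"

text \<open>
  For an affine lattice only finitely many slopes lie below any bound, so the least
  element in the recursion below exists whenever there is a larger slope at all.  Almost every affine
  lattice has infinitely many slopes; on the remaining ones the values are unspecified
  from some index on.
\<close>

primrec slope_seq :: "(real^2) set \<Rightarrow> nat \<Rightarrow> real"
  where
    "slope_seq \<Lambda> 0 = 0"
  | "slope_seq \<Lambda> (Suc n) = (LEAST s. s \<in> slopes \<Lambda> \<and> slope_seq \<Lambda> n < s)"

definition slope_gaps :: "(real^2) set \<Rightarrow> nat \<Rightarrow> real multiset"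
  where "slope_gaps \<Lambda> N =
    image_mset (\<lambda>i. slope_seq \<Lambda> i - slope_seq \<Lambda> (i - 1)) (mset_set {1..N})"

definition prob_density_nonneg :: "(real \<Rightarrow> real) \<Rightarrow> bool"
  where "prob_density_nonneg g \<longleftrightarrow>
    (\<forall>x\<ge>0. 0 \<le> g x) \<and> set_integrable lborel {0..} g \<and> (LINT x:{0..}|lborel. g x) = 1"

end

theory Submission imports Defs
begin

text \<open>Write a vector of the affine lattice as a point of the plane and let the shears
\<open>(x, y) \<mapsto> (x, y - t * x)\<close> act. They preserve the vertical strip \<open>0 < x \<le> 1\<close> and lower
every slope by \<open>t\<close>. Slope gaps are therefore visited along an orbit of a horocycle flow,
and their statistics are ergodic averages: counting the pairs of consecutive slopes
\<open>r < s\<close> with \<open>s\<close> in \<open>(0, n]\<close> and \<open>s - r\<close> in \<open>D\<close> is the same as summing, along the first \<open>n\<close>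
steps of the time-one shear, the number \<open>cnt D\<close> of such pairs with \<open>s\<close> in \<open>(0, 1]\<close>. The
pointwise ergodic theorem (\<open>birkhoff\<close>) gives limits for \<open>D\<close> a half-line and for the whole
line; their quotient is the asymptotic proportion of gaps in \<open>D\<close> (\<open>hits_limit\<close>).

The argument has four ingredients.

An invariant measure. A pair (matrix, vector) is an element of the affine monoid
\<open>aff\<close>; the lattice depends only on its class modulo right multiplication by the integral
group \<open>Gam\<close>. Integrating against a weight whose sum over every orbit below area one is one defines a
measure on the quotient which does not depend on the weight (\<open>unfold_weights\<close>), hence is
invariant under every invertible transformation that commutes with \<open>Gam\<close> and preserves
Lebesgue measure and the determinant. Classical reduction theory provides such a weight of finite total mass
(\<open>siegel_meets\<close>, \<open>siegel_finite\<close>, \<open>siegel_volume\<close>). The null sets of any measure in the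
Lebesgue class are those of this one, so almost-everywhere statements transfer from it.

Ergodicity. The time-one shear is ergodic by the Mautner phenomenon. For integer \<open>k\<close> the
product \<open>u(2k) n(1/2k) u(-k)\<close> of lower and upper unipotents equals \<open>a n(1/k)\<close> with \<open>a\<close>
the diagonal matrix of entries 1/2 and 2, so letting \<open>k\<close> grow shows that a set
invariant under \<open>u(1)\<close> is invariant under \<open>a\<close>; conjugation by powers of \<open>a\<close> contracts both
unipotent groups and the translations of the marked point to the identity, so the set
is invariant under them too (\<open>mautner\<close>). Together they act transitively, which leaves
only null and conull sets (\<open>ergodic_dichotomy\<close>). The continuity that drives these limits
is continuity of translation in the space of integrable functions (\<open>L1_continuity\<close>).

Integrability. The number of lattice points in a triangle has finite mean: integrate first over
the marked point, where unfolding the lattice translations yields the area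
(\<open>siegel_count_bound\<close>).

A density. For two fixed lattice points, the difference of slopes is a nonconstant
affine function of the second coordinate of the marked point, so a Lebesgue-null set of
gaps has mean count zero (\<open>gapm_absolutely_continuous\<close>). The Radon-Nikodym derivative of
the mean count, divided by its total mass, is the density. Half-lines with
rational endpoints are enough for almost-sure convergence, and absence of atoms extends
it to all intervals (\<open>interval_limit\<close>).\<close>

section \<open>Transformations preserving Lebesgue measure\<close>

text \<open>These rules let measurability on the Borel sets of a product be derived without
passing to the product \<open>\<sigma>\<close>-algebra.\<close>

lemma borel_measurable_fst_borel [measurable (raw)]:
  fixes f :: "'c \<Rightarrow> 'a::second_countable_topology \<times> 'b::second_countable_topology"
  shows "f \<in> borel_measurable M \<Longrightarrow> (\<lambda>x. fst (f x)) \<in> borel_measurable M"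
  unfolding borel_prod[symmetric] by (rule measurable_compose[OF _ measurable_fst])

lemma borel_measurable_snd_borel [measurable (raw)]:
  fixes f :: "'c \<Rightarrow> 'a::second_countable_topology \<times> 'b::second_countable_topology"
  shows "f \<in> borel_measurable M \<Longrightarrow> (\<lambda>x. snd (f x)) \<in> borel_measurable M"
  unfolding borel_prod[symmetric] by (rule measurable_compose[OF _ measurable_snd])

declare borel_measurable_Pair [measurable (raw)]

definition preserving :: "('a::euclidean_space \<Rightarrow> 'a) \<Rightarrow> bool"
  where "preserving f \<longleftrightarrow> f \<in> borel_measurable borel \<and> distr lborel borel f = lborel"

lemma preserving_nn_integral:
  assumes "preserving f" and [measurable]: "u \<in> borel_measurable borel"
  shows "(\<integral>\<^sup>+x. u (f x) \<partial>lborel) = (\<integral>\<^sup>+x. u x \<partial>lborel)"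
proof -
  have [measurable]: "f \<in> borel_measurable borel" using assms by (simp add: preserving_def)
  have "(\<integral>\<^sup>+x. u x \<partial>lborel) = (\<integral>\<^sup>+x. u x \<partial>(distr lborel borel f))"
    using assms by (simp add: preserving_def)
  also have "\<dots> = (\<integral>\<^sup>+x. u (f x) \<partial>lborel)"
    by (subst nn_integral_distr) auto
  finally show ?thesis by simp
qed

lemma preservingI:
  assumes [measurable]: "f \<in> borel_measurable borel"
    and "\<And>u :: _ \<Rightarrow> ennreal. u \<in> borel_measurable borel \<Longrightarrow> (\<integral>\<^sup>+x. u (f x) \<partial>lborel) = (\<integral>\<^sup>+x. u x \<partial>lborel)"
  shows "preserving f"
  unfolding preserving_def
proof (intro conjI measure_eqI)
  fix A assume A: "A \<in> sets (distr lborel borel f)"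
  then have [measurable]: "A \<in> sets borel" by simp
  have "emeasure (distr lborel borel f) A = (\<integral>\<^sup>+x. indicator A x \<partial>(distr lborel borel f))"
    using A by (simp only: nn_integral_indicator)
  also have "\<dots> = (\<integral>\<^sup>+x. indicator A (f x) \<partial>lborel)"
    by (subst nn_integral_distr) auto
  also have "\<dots> = emeasure lborel A"
    by (subst assms(2)) auto
  finally show "emeasure (distr lborel borel f) A = emeasure lborel A" .
qed auto

lemma preserving_AE:
  assumes "preserving f" "AE x in lborel. P x"
  shows "AE x in lborel. P (f x)"
proof -
  have "f \<in> measurable lborel borel" using assms by (simp add: preserving_def)
  moreover have "distr lborel borel f = lborel" using assms(1) by (simp add: preserving_def)
  then have "AE x in distr lborel borel f. P x" using assms(2) by (simp only:)
  ultimately show ?thesis by (rule AE_distrD)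
qed

lemma preserving_id: "preserving (\<lambda>x. x)"
  by (rule preservingI) auto

lemma preserving_comp:
  assumes "preserving f" "preserving g" shows "preserving (\<lambda>x. f (g x))"
proof -
  have [measurable]: "f \<in> borel_measurable borel" "g \<in> borel_measurable borel"
    using assms by (auto simp: preserving_def)
  show ?thesis
  proof (rule preservingI)
    fix u :: "'a \<Rightarrow> ennreal" assume [measurable]: "u \<in> borel_measurable borel"
    show "(\<integral>\<^sup>+x. u (f (g x)) \<partial>lborel) = (\<integral>\<^sup>+x. u x \<partial>lborel)"
      using preserving_nn_integral[OF assms(2), of "\<lambda>x. u (f x)"] preserving_nn_integral[OF assms(1), of u] by simp
  qed simp
qed

lemma preserving_translation: "preserving (\<lambda>x. x + c)"
proof -
  have "(\<lambda>x. x + c) = (+) c" by (auto simp: add.commute)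
  then show ?thesis by (simp only: preserving_def lborel_distr_plus) simp
qed

lemma nn_integral_lborel_pair:
  fixes u :: "'a::euclidean_space \<times> 'b::euclidean_space \<Rightarrow> ennreal"
  assumes "u \<in> borel_measurable borel"
  shows "(\<integral>\<^sup>+z. u z \<partial>lborel) = (\<integral>\<^sup>+x. \<integral>\<^sup>+y. u (x, y) \<partial>lborel \<partial>lborel)"
  using assms lborel.nn_integral_fst[of u "lborel :: 'a measure"] by (simp add: lborel_prod)

text \<open>On each fibre the map is a translation, so Tonelli's theorem reduces the claim to translation
invariance of Lebesgue measure.\<close>

lemma preserving_skew:
  fixes f :: "'a::euclidean_space \<Rightarrow> 'a" and h :: "'a \<Rightarrow> 'b::euclidean_space"
  assumes f: "preserving f" and [measurable]: "h \<in> borel_measurable borel"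
  shows "preserving (\<lambda>z. (f (fst z), snd z + h (fst z)))"
proof -
  have [measurable]: "f \<in> borel_measurable borel" using f by (simp add: preserving_def)
  show ?thesis
  proof (rule preservingI)
    fix u :: "'a \<times> 'b \<Rightarrow> ennreal" assume [measurable]: "u \<in> borel_measurable borel"
    have "(\<integral>\<^sup>+z. u (f (fst z), snd z + h (fst z)) \<partial>lborel)
      = (\<integral>\<^sup>+x. \<integral>\<^sup>+y. u (f x, y + h x) \<partial>lborel \<partial>lborel)"
      by (subst nn_integral_lborel_pair) auto
    also have "\<dots> = (\<integral>\<^sup>+x. \<integral>\<^sup>+y. u (f x, y) \<partial>lborel \<partial>lborel)"
      by (intro nn_integral_cong preserving_nn_integral[OF preserving_translation]) 
        auto
    also have "\<dots> = (\<integral>\<^sup>+x. \<integral>\<^sup>+y. u (x, y) \<partial>lborel \<partial>lborel)"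
      using preserving_nn_integral[OF f, of "\<lambda>x. \<integral>\<^sup>+y. u (x, y) \<partial>lborel"]
      by simp
    also have "\<dots> = (\<integral>\<^sup>+z. u z \<partial>lborel)"
      by (subst nn_integral_lborel_pair) auto
    finally show "(\<integral>\<^sup>+z. u (f (fst z), snd z + h (fst z)) \<partial>lborel) = (\<integral>\<^sup>+z. u z \<partial>lborel)" .
  qed auto
qed

lemma preserving_map_prod:
  fixes f :: "'a::euclidean_space \<Rightarrow> 'a" and g :: "'b::euclidean_space \<Rightarrow> 'b"
  assumes f: "preserving f" and g: "preserving g"
  shows "preserving (map_prod f g)"
proof -
  have [measurable]: "f \<in> borel_measurable borel" "g \<in> borel_measurable borel"
    using f g by (auto simp: preserving_def)
  show ?thesis
  proof (rule preservingI)
    fix u :: "'a \<times> 'b \<Rightarrow> ennreal" assume [measurable]: "u \<in> borel_measurable borel"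
    have "(\<integral>\<^sup>+z. u (map_prod f g z) \<partial>lborel) = (\<integral>\<^sup>+x. \<integral>\<^sup>+y. u (f x, g y) \<partial>lborel \<partial>lborel)"
      by (subst nn_integral_lborel_pair) (auto simp: map_prod_def)
    also have "\<dots> = (\<integral>\<^sup>+x. \<integral>\<^sup>+y. u (f x, y) \<partial>lborel \<partial>lborel)"
      by (intro nn_integral_cong preserving_nn_integral[OF g]) auto
    also have "\<dots> = (\<integral>\<^sup>+x. \<integral>\<^sup>+y. u (x, y) \<partial>lborel \<partial>lborel)"
      using preserving_nn_integral[OF f, of "\<lambda>x. \<integral>\<^sup>+y. u (x, y) \<partial>lborel"]
      by simp
    also have "\<dots> = (\<integral>\<^sup>+z. u z \<partial>lborel)"
      by (subst nn_integral_lborel_pair) auto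
    finally show "(\<integral>\<^sup>+z. u (map_prod f g z) \<partial>lborel) = (\<integral>\<^sup>+z. u z \<partial>lborel)" .
  qed (auto simp: map_prod_def)
qed

lemma nn_integral_lborel_swap:
  fixes u :: "'a::euclidean_space \<times> 'b::euclidean_space \<Rightarrow> ennreal"
  assumes [measurable]: "u \<in> borel_measurable borel"
  shows "(\<integral>\<^sup>+z. u (snd z, fst z) \<partial>lborel) = (\<integral>\<^sup>+z. u z \<partial>lborel)"
proof -
  have "(\<integral>\<^sup>+z. u (snd z, fst z) \<partial>lborel) = (\<integral>\<^sup>+y. \<integral>\<^sup>+x. u (x, y) \<partial>lborel \<partial>lborel)"
    by (subst nn_integral_lborel_pair) auto
  also have "\<dots> = (\<integral>\<^sup>+x. \<integral>\<^sup>+y. u (x, y) \<partial>lborel \<partial>lborel)"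
    by (rule lborel_pair.Fubini') (auto simp: lborel_prod)
  also have "\<dots> = (\<integral>\<^sup>+z. u z \<partial>lborel)"
    by (subst nn_integral_lborel_pair) auto
  finally show ?thesis .
qed

lemma preserving_swap: "preserving (\<lambda>z::'a::euclidean_space \<times> 'a. (snd z, fst z))"
  by (rule preservingI) (auto simp: nn_integral_lborel_swap)

lemma preserving_lower_shear: "preserving (\<lambda>z::'a::euclidean_space \<times> 'a. (fst z, snd z + s *\<^sub>R fst z))"
  using preserving_skew[OF preserving_id, of "\<lambda>x. s *\<^sub>R x"] by simp

lemma preserving_upper_shear: "preserving (\<lambda>z::'a::euclidean_space \<times> 'a. (fst z + s *\<^sub>R snd z, snd z))"
  using preserving_comp[OF preserving_swap preserving_comp[OF preserving_lower_shear[of s] preserving_swap]] by simp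

text \<open>A unimodular 2 by 2 matrix is a product of shears, and the factor space is arbitrary: with
pairs of rows the lemma describes left multiplication, with pairs of reals it describes right multiplication on one row.\<close>

lemma preserving_unimodular:
  fixes a b c d :: real
  assumes "a * d - b * c = 1"
  shows "preserving (\<lambda>z::'a::euclidean_space \<times> 'a. (a *\<^sub>R fst z + b *\<^sub>R snd z, c *\<^sub>R fst z + d *\<^sub>R snd z))"
proof -
  have *: "preserving (\<lambda>z::'a::euclidean_space \<times> 'a. (a *\<^sub>R fst z + b *\<^sub>R snd z, c *\<^sub>R fst z + d *\<^sub>R snd z))"
    if det: "a * d - b * c = 1" and b: "b \<noteq> 0" for a b c d :: real
  proof -
    define y where "y = (a - 1) / b"
    define x where "x = (d - 1) / b"
    have c: "c = x * (1 + b * y) + y"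
      using b det by (simp add: x_def y_def field_simps)
    have ad: "a = 1 + b * y" "d = 1 + x * b" using b by (auto simp: x_def y_def)
    show ?thesis
      using preserving_comp[OF preserving_lower_shear[where 'a='a and s=x] preserving_comp[OF preserving_upper_shear[of b] preserving_lower_shear[of y]]]
      unfolding c ad by (rule back_subst[where P=preserving]) (simp add: fun_eq_iff algebra_simps)
  qed
  show ?thesis
  proof (cases "b = 0")
    case False then show ?thesis using * assms by blast
  next
    case True
    then have "a \<noteq> 0" using assms by auto
    then have "preserving (\<lambda>z::'a \<times> 'a. (a *\<^sub>R fst z + a *\<^sub>R snd z, c *\<^sub>R fst z + (c + d) *\<^sub>R snd z))"
      using * [of a "c + d" a c] True assms by (auto simp: algebra_simps)
    from preserving_comp[OF this preserving_upper_shear[of "-1"]] show ?thesis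
      by (rule back_subst[where P=preserving]) (use True in \<open>simp add: fun_eq_iff algebra_simps\<close>)
  qed
qed

section \<open>The affine group\<close>

text \<open>The element \<open>(((a, b), p), ((c, d), q))\<close> is the affine map with matrix rows \<open>(a, b)\<close>,
\<open>(c, d)\<close> and translation vector \<open>(p, q)\<close>. Keeping matrix and vector in one Euclidean space, row by row,
makes left and right multiplication linear and lets Lebesgue measure be split along rows.\<close>

type_synonym aff = "((real \<times> real) \<times> real) \<times> ((real \<times> real) \<times> real)"

fun amul :: "aff \<Rightarrow> aff \<Rightarrow> aff" (infixl "\<odot>" 70)
  where "(((a, b), p), ((c, d), q)) \<odot> (((a', b'), p'), ((c', d'), q')) =
    (((a * a' + b * c', a * b' + b * d'), a * p' + b * q' + p),
     ((c * a' + d * c', c * b' + d * d'), c * p' + d * q' + q))"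

fun adet :: "aff \<Rightarrow> real" where "adet (((a, b), p), ((c, d), q)) = a * d - b * c"

definition aone :: aff where "aone = (((1, 0), 0), ((0, 1), 0))"

fun ainv :: "aff \<Rightarrow> aff"
  where "ainv (((a, b), p), ((c, d), q)) = (let e = a * d - b * c in
    (((d / e, - b / e), (b * q - d * p) / e), ((- c / e, a / e), (c * p - a * q) / e)))"

lemma amul_conv: "x \<odot> y = (((fst (fst (fst x)) * fst (fst (fst y)) + snd (fst (fst x)) * fst (fst (snd y)),
   fst (fst (fst x)) * snd (fst (fst y)) + snd (fst (fst x)) * snd (fst (snd y))),
   fst (fst (fst x)) * snd (fst y) + snd (fst (fst x)) * snd (snd y) + snd (fst x)),
   ((fst (fst (snd x)) * fst (fst (fst y)) + snd (fst (snd x)) * fst (fst (snd y)),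
   fst (fst (snd x)) * snd (fst (fst y)) + snd (fst (snd x)) * snd (fst (snd y))),
   fst (fst (snd x)) * snd (fst y) + snd (fst (snd x)) * snd (snd y) + snd (snd x)))"
  by (cases "(x, y)" rule: amul.cases) simp

lemma adet_conv: "adet x = fst (fst (fst x)) * snd (fst (snd x)) - snd (fst (fst x)) * fst (fst (snd x))"
  by (cases x rule: adet.cases) simp

lemma amul_assoc: "(x \<odot> y) \<odot> z = x \<odot> (y \<odot> z)"
  by (simp add: amul_conv algebra_simps)

lemma adet_mult: "adet (x \<odot> y) = adet x * adet y"
  by (simp add: amul_conv adet_conv algebra_simps)

lemma amul_one [simp]: "x \<odot> aone = x" "aone \<odot> x = x"
  by (simp_all add: amul_conv aone_def)

lemma adet_aone [simp]: "adet aone = 1"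
  by (simp add: aone_def)

lemma amul_ainv:
  assumes "adet x \<noteq> 0" shows "x \<odot> ainv x = aone" "ainv x \<odot> x = aone"
proof -
  obtain a b p c d q where x: "x = (((a, b), p), ((c, d), q))" by (cases x rule: adet.cases)
  define e where "e = a * d - b * c"
  have e: "e \<noteq> 0" using assms by (simp add: x e_def)
  have i: "ainv x = (((d / e, - b / e), (b * q - d * p) / e), ((- c / e, a / e), (c * p - a * q) / e))"
    by (simp add: x e_def Let_def)
  have 1: "a * (b * q - d * p) + b * (c * p - a * q) + e * p = 0"
    "c * (b * q - d * p) + d * (c * p - a * q) + e * q = 0"
    by (simp_all add: e_def algebra_simps)
  show "x \<odot> ainv x = aone" using e 1
    unfolding i by (simp add: x aone_def field_simps) (simp add: e_def algebra_simps)
  show "ainv x \<odot> x = aone" using e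
    unfolding i by (simp add: x aone_def field_simps) (simp add: e_def algebra_simps)
qed

lemmas amul_ainv_right = amul_ainv(1) and amul_ainv_left = amul_ainv(2)

lemma adet_ainv: "adet (ainv x) = 1 / adet x"
proof (cases "adet x = 0")
  case False
  then have "adet (ainv x) * adet x = 1"
    by (simp add: adet_mult[symmetric] amul_ainv_left)
  with False show ?thesis by (simp add: field_simps)
next
  case True then show ?thesis by (cases x rule: adet.cases) (auto simp: Let_def)
qed

lemma borel_measurable_amul [measurable]:
  "f \<in> borel_measurable M \<Longrightarrow> g \<in> borel_measurable M \<Longrightarrow> (\<lambda>x. f x \<odot> g x) \<in> borel_measurable M"
  by (rule borel_measurable_continuous_Pair, assumption, assumption)
    (unfold amul_conv, intro continuous_intros)

lemma borel_measurable_adet [measurable]: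
  "f \<in> borel_measurable M \<Longrightarrow> (\<lambda>x. adet (f x)) \<in> borel_measurable M"
  by (rule measurable_compose[OF _ borel_measurable_continuous_onI], assumption)
    (unfold adet_conv, intro continuous_intros)

lemma preserving_amul_left:
  assumes "adet g = 1" shows "preserving (\<lambda>x. g \<odot> x)"
proof -
  obtain a b p c d q where g: "g = (((a, b), p), ((c, d), q))" by (cases g rule: adet.cases)
  then have "a * d - b * c = 1" using assms by simp
  from preserving_comp[OF preserving_translation[of "((0, p), (0, q))"] preserving_unimodular[OF this]]
  have "preserving (\<lambda>x::aff. (a *\<^sub>R fst x + b *\<^sub>R snd x, c *\<^sub>R fst x + d *\<^sub>R snd x) + ((0, p), (0, q)))" .
  also have "(\<lambda>x::aff. (a *\<^sub>R fst x + b *\<^sub>R snd x, c *\<^sub>R fst x + d *\<^sub>R snd x) + ((0, p), (0, q))) = (\<lambda>x. g \<odot> x)"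
    by (auto simp: fun_eq_iff g)
  finally show ?thesis .
qed

lemma preserving_amul_right:
  assumes "adet g = 1" shows "preserving (\<lambda>x. x \<odot> g)"
proof -
  obtain a b p c d q where g: "g = (((a, b), p), ((c, d), q))" by (cases g rule: adet.cases)
  then have "a * d - c * b = 1" using assms by (simp add: mult.commute)
  from preserving_skew[OF preserving_unimodular[OF this], of "\<lambda>z. fst z * p + snd z * q"]
  have *: "preserving (\<lambda>x::(real\<times>real)\<times>real. (((a *\<^sub>R fst (fst x) + c *\<^sub>R snd (fst x), b *\<^sub>R fst (fst x) + d *\<^sub>R snd (fst x)),
     snd x + (fst (fst x) * p + snd (fst x) * q))))"
    by simp
  from preserving_map_prod[OF * *] show ?thesis
    by (rule back_subst[where P=preserving]) (auto simp: fun_eq_iff g)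
qed

text \<open>Elements of \<open>aff\<close> are handled through their coordinates; quantifiers over them are not to be split into six
real variables.\<close>

declare split_paired_All [simp del] split_paired_Ex [simp del]

definition ca :: "aff \<Rightarrow> real" where "ca x = fst (fst (fst x))"
definition cb :: "aff \<Rightarrow> real" where "cb x = snd (fst (fst x))"
definition cp :: "aff \<Rightarrow> real" where "cp x = snd (fst x)"
definition cc :: "aff \<Rightarrow> real" where "cc x = fst (fst (snd x))"
definition cd :: "aff \<Rightarrow> real" where "cd x = snd (fst (snd x))"
definition cq :: "aff \<Rightarrow> real" where "cq x = snd (snd x)"

lemmas coord_defs = ca_def cb_def cp_def cc_def cd_def cq_def

lemma coord_simps [simp]:
  "ca (((a, b), p), ((c, d), q)) = a" "cb (((a, b), p), ((c, d), q)) = b"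
  "cp (((a, b), p), ((c, d), q)) = p" "cc (((a, b), p), ((c, d), q)) = c"
  "cd (((a, b), p), ((c, d), q)) = d" "cq (((a, b), p), ((c, d), q)) = q"
  by (simp_all add: coord_defs)

lemma coord_mult [simp]:
  "ca (x \<odot> y) = ca x * ca y + cb x * cc y" "cb (x \<odot> y) = ca x * cb y + cb x * cd y"
  "cc (x \<odot> y) = cc x * ca y + cd x * cc y" "cd (x \<odot> y) = cc x * cb y + cd x * cd y"
  "cp (x \<odot> y) = ca x * cp y + cb x * cq y + cp x" "cq (x \<odot> y) = cc x * cp y + cd x * cq y + cq x"
  by (simp_all add: coord_defs amul_conv)

lemma coord_one [simp]: "ca aone = 1" "cb aone = 0" "cc aone = 0" "cd aone = 1" "cp aone = 0" "cq aone = 0"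
  by (simp_all add: aone_def)

lemma aff_eq_iff: "x = y \<longleftrightarrow> ca x = ca y \<and> cb x = cb y \<and> cp x = cp y \<and> cc x = cc y \<and> cd x = cd y \<and> cq x = cq y"
  by (auto simp: coord_defs prod_eq_iff)

lemma adet_coords: "adet x = ca x * cd x - cb x * cc x"
  by (simp add: coord_defs adet_conv)

lemma borel_measurable_coords [measurable]:
  "ca \<in> borel_measurable borel" "cb \<in> borel_measurable borel" "cp \<in> borel_measurable borel"
  "cc \<in> borel_measurable borel" "cd \<in> borel_measurable borel" "cq \<in> borel_measurable borel"
  by (auto intro!: borel_measurable_continuous_onI continuous_intros simp: coord_defs)

lemma coord_ainv:
  assumes "adet x = 1"
  shows "ca (ainv x) = cd x" "cb (ainv x) = - cb x" "cc (ainv x) = - cc x" "cd (ainv x) = ca x"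
    "cp (ainv x) = cb x * cq x - cd x * cp x" "cq (ainv x) = cc x * cp x - ca x * cq x"
  using assms by (cases x rule: adet.cases, simp)+

text \<open>The integral affine group. Elements \<open>x\<close> and \<open>x \<odot> g\<close> with \<open>g\<close> in this group describe the same affine
lattice in two bases and with two choices of origin.\<close>

definition Gam :: "aff set"
  where "Gam = {g. adet g = 1 \<and> ca g \<in> \<int> \<and> cb g \<in> \<int> \<and> cc g \<in> \<int> \<and> cd g \<in> \<int> \<and> cp g \<in> \<int> \<and> cq g \<in> \<int>}"

lemma Gam_det: "g \<in> Gam \<Longrightarrow> adet g = 1"
  by (simp add: Gam_def)

lemma Gam_mult: "g \<in> Gam \<Longrightarrow> h \<in> Gam \<Longrightarrow> g \<odot> h \<in> Gam"
  by (auto simp: Gam_def adet_mult)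

lemma Gam_one: "aone \<in> Gam"
  by (simp add: Gam_def)

lemma Gam_inv: "g \<in> Gam \<Longrightarrow> ainv g \<in> Gam"
  by (auto simp: Gam_def adet_ainv coord_ainv)

lemma Gam_cancel [simp]:
  assumes "g \<in> Gam"
  shows "x \<odot> g \<odot> ainv g = x" "x \<odot> ainv g \<odot> g = x"
  using Gam_det[OF assms] by (simp_all add: amul_assoc amul_ainv_right amul_ainv_left)

lemma countable_Gam: "countable Gam"
proof -
  have "Gam \<subseteq> (\<lambda>(a, b, p, c, d, q). (((real_of_int a, real_of_int b), real_of_int p), ((real_of_int c, real_of_int d), real_of_int q))) ` UNIV"
  proof
    fix g assume "g \<in> Gam"
    then obtain a b p c d q where "ca g = of_int a" "cb g = of_int b" "cp g = of_int p"
      "cc g = of_int c" "cd g = of_int d" "cq g = of_int q"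
      unfolding Gam_def by (auto elim!: Ints_cases)
    then show "g \<in> (\<lambda>(a, b, p, c, d, q). (((real_of_int a, real_of_int b), real_of_int p), ((real_of_int c, real_of_int d), real_of_int q))) ` UNIV"
      by (intro image_eqI[of _ _ "(a, b, p, c, d, q)"]) (auto simp: aff_eq_iff)
  qed
  then show ?thesis
    by (rule countable_subset) simp
qed

lemma bij_betw_Gam_mult: "h \<in> Gam \<Longrightarrow> bij_betw (\<lambda>g. h \<odot> g) Gam Gam"
  by (rule bij_betw_byWitness[where f'="\<lambda>g. ainv h \<odot> g"])
     (auto simp: Gam_mult Gam_inv amul_assoc[symmetric] amul_ainv_left amul_ainv_right Gam_det)

lemma ainv_ainv: "adet x = 1 \<Longrightarrow> ainv (ainv x) = x"
  by (simp add: aff_eq_iff coord_ainv adet_ainv) (simp add: adet_coords algebra_simps, metis distrib_left mult.assoc mult.commute mult.right_neutral right_diff_distrib)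

lemma bij_betw_Gam_inv: "bij_betw ainv Gam Gam"
  by (rule bij_betw_byWitness[where f'=ainv]) (simp_all add: Gam_inv ainv_ainv Gam_det image_subset_iff)

text \<open>The part of the period cone below area one. It has finite volume modulo \<open>Gam\<close>, whereas the
locus of area one is null; a set of unit-area lattices is measured through the part of its cone in this set.\<close>

definition Yset :: "aff set" where "Yset = {x. 0 < adet x \<and> adet x \<le> 1}"

lemma Yset_measurable [measurable]: "Yset \<in> sets borel"
  unfolding Yset_def by measurable

lemma Yset_Gam: "g \<in> Gam \<Longrightarrow> x \<odot> g \<in> Yset \<longleftrightarrow> x \<in> Yset"
  by (simp add: Yset_def adet_mult Gam_det)

section \<open>Integration over the quotient\<close>

lemma nn_integral_count_commute:
  fixes u :: "'i \<Rightarrow> 'a \<Rightarrow> ennreal"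
  assumes I: "countable I" and M: "sigma_finite_measure M" and u: "\<And>i. i \<in> I \<Longrightarrow> u i \<in> borel_measurable M"
  shows "(\<integral>\<^sup>+x. \<integral>\<^sup>+i. u i x \<partial>count_space I \<partial>M) = (\<integral>\<^sup>+i. \<integral>\<^sup>+x. u i x \<partial>M \<partial>count_space I)"
proof -
  interpret I: sigma_finite_measure "count_space I" by (rule sigma_finite_measure_count_space_countable[OF I])
  interpret M: sigma_finite_measure M by fact
  interpret pair_sigma_finite "count_space I" M ..
  have "(\<lambda>z. u (fst z) (snd z)) \<in> borel_measurable (count_space I \<Otimes>\<^sub>M M)"
    using u by (intro measurable_pair_measure_countable1[OF I]) auto
  from Fubini'[of u] this show ?thesis by (simp add: case_prod_beta')
qed

lemma borel_measurable_nn_integral_count: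
  fixes u :: "'i \<Rightarrow> 'a \<Rightarrow> ennreal"
  assumes I: "countable I" and u: "\<And>i. i \<in> I \<Longrightarrow> u i \<in> borel_measurable M"
  shows "(\<lambda>x. \<integral>\<^sup>+i. u i x \<partial>count_space I) \<in> borel_measurable M"
proof -
  interpret I: sigma_finite_measure "count_space I" by (rule sigma_finite_measure_count_space_countable[OF I])
  have "(\<lambda>z. u (snd z) (fst z)) \<in> borel_measurable (M \<Otimes>\<^sub>M count_space I)"
    using measurable_compose[OF measurable_pair_swap' measurable_pair_measure_countable1[OF I, of "\<lambda>z. u (fst z) (snd z)" M]] u
    by (simp add: case_prod_beta')
  from I.borel_measurable_nn_integral[of "\<lambda>x i. u i x"] this show ?thesis by (simp add: case_prod_beta')
qed

text \<open>A weight is a smeared-out fundamental domain for \<open>Gam\<close>, which avoids choosing one point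
from every orbit.\<close>

definition weight :: "(aff \<Rightarrow> ennreal) \<Rightarrow> bool"
  where "weight \<Psi> \<longleftrightarrow> \<Psi> \<in> borel_measurable borel \<and>
    (\<forall>x. (\<integral>\<^sup>+g. \<Psi> (x \<odot> g) \<partial>count_space Gam) = indicator Yset x)"

lemma weight_measurable: "weight \<Psi> \<Longrightarrow> \<Psi> \<in> borel_measurable borel"
  by (simp add: weight_def)

lemma weight_sum: "weight \<Psi> \<Longrightarrow> (\<integral>\<^sup>+g. \<Psi> (x \<odot> g) \<partial>count_space Gam) = indicator Yset x"
  by (simp add: weight_def)

lemma weight_outside:
  assumes "weight \<Psi>" "x \<notin> Yset" shows "\<Psi> x = 0"
proof -
  have "(\<integral>\<^sup>+g. \<Psi> (x \<odot> g) \<partial>count_space Gam) = 0"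
    using assms by (simp add: weight_def)
  then have "\<forall>g\<in>Gam. \<Psi> (x \<odot> g) = 0"
    by (subst (asm) nn_integral_0_iff_AE) (auto simp: AE_count_space)
  from bspec[OF this Gam_one] show ?thesis by simp
qed

definition Ginv :: "(aff \<Rightarrow> 'b) \<Rightarrow> bool"
  where "Ginv f \<longleftrightarrow> (\<forall>x. \<forall>g\<in>Gam. f (x \<odot> g) = f x)"

lemma preserving_Gam: "g \<in> Gam \<Longrightarrow> preserving (\<lambda>x. x \<odot> g)"
  by (rule preserving_amul_right[OF Gam_det])

text \<open>Insert the sum over \<open>Gam\<close> of the second weight, exchange sum and integral, and move the group
element from one weight to the other; the orbit sum of the first weight then appears and
disappears.\<close>

lemma unfold_weights:
  fixes f :: "aff \<Rightarrow> ennreal"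
  assumes \<Psi>: "weight \<Psi>" and \<Phi>: "weight \<Phi>" and f [measurable]: "f \<in> borel_measurable borel" and inv: "Ginv f"
  shows "(\<integral>\<^sup>+x. \<Psi> x * f x \<partial>lborel) = (\<integral>\<^sup>+x. \<Phi> x * f x \<partial>lborel)"
proof -
  have [measurable]: "\<Psi> \<in> borel_measurable borel" "\<Phi> \<in> borel_measurable borel"
    using \<Psi> \<Phi> by (auto simp: weight_measurable)
  have sub: "\<Psi> x * f x = (\<integral>\<^sup>+g. \<Psi> x * f x * \<Phi> (x \<odot> g) \<partial>count_space Gam)"
    if \<Psi>: "weight \<Psi>" and \<Phi>: "weight \<Phi>" for \<Psi> \<Phi> x
    using weight_sum[OF \<Phi>, of x] weight_outside[OF \<Psi>, of x]
    by (subst nn_integral_cmult) (auto split: split_indicator)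
  have "(\<integral>\<^sup>+x. \<Psi> x * f x \<partial>lborel) = (\<integral>\<^sup>+x. \<integral>\<^sup>+g. \<Psi> x * f x * \<Phi> (x \<odot> g) \<partial>count_space Gam \<partial>lborel)"
    using sub[OF \<Psi> \<Phi>] by (intro nn_integral_cong) 
  also have "\<dots> = (\<integral>\<^sup>+g. \<integral>\<^sup>+x. \<Psi> x * f x * \<Phi> (x \<odot> g) \<partial>lborel \<partial>count_space Gam)"
    by (intro nn_integral_count_commute countable_Gam) (auto intro: lborel.sigma_finite_measure_axioms)
  also have "\<dots> = (\<integral>\<^sup>+g. \<integral>\<^sup>+x. \<Phi> x * f x * \<Psi> (x \<odot> ainv g) \<partial>lborel \<partial>count_space Gam)"
  proof (rule nn_integral_cong)
    fix g assume "g \<in> space (count_space Gam)"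
    then have g: "g \<in> Gam" by simp
    have "(\<integral>\<^sup>+x. \<Psi> x * f x * \<Phi> (x \<odot> g) \<partial>lborel)
      = (\<integral>\<^sup>+x. \<Psi> (x \<odot> ainv g) * f (x \<odot> ainv g) * \<Phi> (x \<odot> ainv g \<odot> g) \<partial>lborel)"
      by (rule preserving_nn_integral[OF preserving_Gam[OF Gam_inv[OF g]], symmetric]) measurable
    also have "\<dots> = (\<integral>\<^sup>+x. \<Phi> x * f x * \<Psi> (x \<odot> ainv g) \<partial>lborel)"
      using inv Gam_inv[OF g] by (intro nn_integral_cong) (simp add: Ginv_def g mult_ac)
    finally show "(\<integral>\<^sup>+x. \<Psi> x * f x * \<Phi> (x \<odot> g) \<partial>lborel)
      = (\<integral>\<^sup>+x. \<Phi> x * f x * \<Psi> (x \<odot> ainv g) \<partial>lborel)" .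
  qed
  also have "\<dots> = (\<integral>\<^sup>+g. \<integral>\<^sup>+x. \<Phi> x * f x * \<Psi> (x \<odot> g) \<partial>lborel \<partial>count_space Gam)"
    by (rule nn_integral_bij_count_space[OF bij_betw_Gam_inv])
  also have "\<dots> = (\<integral>\<^sup>+x. \<integral>\<^sup>+g. \<Phi> x * f x * \<Psi> (x \<odot> g) \<partial>count_space Gam \<partial>lborel)"
    by (intro nn_integral_count_commute[symmetric] countable_Gam) (auto intro: lborel.sigma_finite_measure_axioms)
  also have "\<dots> = (\<integral>\<^sup>+x. \<Phi> x * f x \<partial>lborel)"
    using sub[OF \<Phi> \<Psi>] by (intro nn_integral_cong) simp
  finally show ?thesis .
qed

text \<open>These are the transformations that descend to the quotient by \<open>Gam\<close> and preserve covolume.\<close>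

definition good_map :: "(aff \<Rightarrow> aff) \<Rightarrow> bool"
  where "good_map T \<longleftrightarrow> preserving T \<and> (\<forall>x. \<forall>g\<in>Gam. T (x \<odot> g) = T x \<odot> g) \<and> (\<forall>x. adet (T x) = adet x)"

lemma good_map_preserving: "good_map T \<Longrightarrow> preserving T"
  by (simp add: good_map_def)

lemma good_map_measurable: "good_map T \<Longrightarrow> T \<in> borel_measurable borel"
  by (simp add: good_map_def preserving_def)

lemma good_map_Gam: "good_map T \<Longrightarrow> g \<in> Gam \<Longrightarrow> T (x \<odot> g) = T x \<odot> g"
  by (simp add: good_map_def)

lemma good_map_det: "good_map T \<Longrightarrow> adet (T x) = adet x"
  by (simp add: good_map_def)

lemma good_map_id: "good_map (\<lambda>x. x)"
  by (simp add: good_map_def preserving_id)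

lemma good_map_comp: "good_map T \<Longrightarrow> good_map S \<Longrightarrow> good_map (\<lambda>x. T (S x))"
  by (simp add: good_map_def preserving_comp)

lemma good_map_funpow: "good_map T \<Longrightarrow> good_map (T ^^ n)"
proof (induction n)
  case 0 show ?case using good_map_id by (simp add: id_def)
next
  case (Suc n) then show ?case using good_map_comp[of T "T ^^ n"] by (simp add: o_def)
qed

lemma good_map_left: "adet h = 1 \<Longrightarrow> good_map (\<lambda>x. h \<odot> x)"
  by (simp add: good_map_def preserving_amul_left amul_assoc adet_mult)

lemma weight_good_map:
  assumes "weight \<Psi>" "good_map T" shows "weight (\<lambda>x. \<Psi> (T x))"
proof -
  have [measurable]: "\<Psi> \<in> borel_measurable borel" "T \<in> borel_measurable borel"
    using assms by (auto simp: weight_measurable good_map_measurable)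
  have "(\<integral>\<^sup>+g. \<Psi> (T (x \<odot> g)) \<partial>count_space Gam) = indicator Yset x" for x
  proof -
    have "(\<integral>\<^sup>+g. \<Psi> (T (x \<odot> g)) \<partial>count_space Gam) = (\<integral>\<^sup>+g. \<Psi> (T x \<odot> g) \<partial>count_space Gam)"
      by (intro nn_integral_cong) (simp add: good_map_Gam[OF assms(2)])
    also have "\<dots> = indicator Yset x"
      using assms by (simp add: weight_sum indicator_def Yset_def good_map_det)
    finally show ?thesis .
  qed
  then show ?thesis by (simp add: weight_def)
qed

text \<open>A good map turns a weight into another weight, so its effect on the integral of an invariant
function is absorbed by \<open>unfold_weights\<close>.\<close>

lemma weight_integral_good_map:
  fixes f :: "aff \<Rightarrow> ennreal"
  assumes \<Psi>: "weight \<Psi>" and f [measurable]: "f \<in> borel_measurable borel" and inv: "Ginv f"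
    and T: "good_map T" and T': "good_map T'" and inverse: "\<And>x. T' (T x) = x"
  shows "(\<integral>\<^sup>+x. \<Psi> x * f (T x) \<partial>lborel) = (\<integral>\<^sup>+x. \<Psi> x * f x \<partial>lborel)"
proof -
  have [measurable]: "\<Psi> \<in> borel_measurable borel" "T' \<in> borel_measurable borel"
    using \<Psi> T' by (auto simp: weight_measurable good_map_measurable)
  have "(\<integral>\<^sup>+x. \<Psi> x * f (T x) \<partial>lborel) = (\<integral>\<^sup>+x. \<Psi> (T' (T x)) * f (T x) \<partial>lborel)"
    by (simp add: inverse)
  also have "\<dots> = (\<integral>\<^sup>+x. \<Psi> (T' x) * f x \<partial>lborel)"
    by (rule preserving_nn_integral[OF good_map_preserving[OF T], of "\<lambda>x. \<Psi> (T' x) * f x"]) measurable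
  also have "\<dots> = (\<integral>\<^sup>+x. \<Psi> x * f x \<partial>lborel)"
    by (rule unfold_weights[OF weight_good_map[OF \<Psi> T'] \<Psi> f inv])
  finally show ?thesis .
qed

text \<open>If an invariant set vanishes against the weight, it vanishes against all translates of the weight
by \<open>Gam\<close>, and these have sum one on \<open>Yset\<close>.\<close>

lemma weight_null_iff:
  assumes \<Psi>: "weight \<Psi>" and B [measurable]: "B \<in> sets borel" and inv: "\<And>x g. g \<in> Gam \<Longrightarrow> x \<odot> g \<in> B \<longleftrightarrow> x \<in> B"
  shows "(\<integral>\<^sup>+x. \<Psi> x * indicator B x \<partial>lborel) = 0 \<longleftrightarrow> emeasure lborel (B \<inter> Yset) = 0"
proof -
  have [measurable]: "\<Psi> \<in> borel_measurable borel"
    using \<Psi> by (auto simp: weight_measurable)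
  have "(\<integral>\<^sup>+x. \<Psi> x * indicator B x \<partial>lborel) = 0 \<longleftrightarrow> (AE x in lborel. \<Psi> x * indicator B x = 0)"
    by (subst nn_integral_0_iff_AE) auto
  also have "\<dots> \<longleftrightarrow> (AE x in lborel. x \<notin> B \<inter> Yset)"
  proof
    assume "AE x in lborel. \<Psi> x * indicator B x = 0"
    then have "AE x in lborel. \<Psi> (x \<odot> g) * indicator B (x \<odot> g) = 0" if "g \<in> Gam" for g
      by (rule preserving_AE[OF preserving_Gam[OF that]])
    then have "AE x in lborel. \<forall>g\<in>Gam. \<Psi> (x \<odot> g) * indicator B (x \<odot> g) = 0"
      by (subst AE_ball_countable[OF countable_Gam]) auto
    then show "AE x in lborel. x \<notin> B \<inter> Yset"
    proof (rule AE_mp, intro AE_I2 impI notI)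
      fix x assume *: "\<forall>g\<in>Gam. \<Psi> (x \<odot> g) * indicator B (x \<odot> g) = 0" and x: "x \<in> B \<inter> Yset"
      have "(\<integral>\<^sup>+g. \<Psi> (x \<odot> g) \<partial>count_space Gam) = (\<integral>\<^sup>+g. 0 \<partial>count_space Gam)"
        using * x inv by (intro nn_integral_cong) (auto split: split_indicator_asm)
      then show False using weight_sum[OF \<Psi>, of x] x by simp
    qed
  next
    assume "AE x in lborel. x \<notin> B \<inter> Yset"
    then show "AE x in lborel. \<Psi> x * indicator B x = 0"
      by eventually_elim (use weight_outside[OF \<Psi>] in \<open>auto split: split_indicator\<close>)
  qed
  also have "\<dots> \<longleftrightarrow> emeasure lborel (B \<inter> Yset) = 0"
    by (subst AE_iff_measurable[OF _ refl]) (simp_all add: Int_def)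
  finally show ?thesis .
qed

section \<open>Reduction theory\<close>

text \<open>Cramer's rule bounds the integer coordinates of a point in terms of the point.\<close>

lemma finite_lattice_points:
  assumes x: "adet x \<noteq> 0"
  shows "finite {(m :: int, n :: int). \<bar>ca x * m + cb x * n + cp x\<bar> \<le> B \<and> \<bar>cc x * m + cd x * n + cq x\<bar> \<le> B}"
proof -
  define e where "e = adet x"
  have e: "e \<noteq> 0" using x by (simp add: e_def)
  define K where "K = (\<bar>cd x\<bar> + \<bar>cb x\<bar> + \<bar>ca x\<bar> + \<bar>cc x\<bar>) * (B + \<bar>cp x\<bar> + \<bar>cq x\<bar>) / \<bar>e\<bar>"
  have "{(m :: int, n :: int). \<bar>ca x * m + cb x * n + cp x\<bar> \<le> B \<and> \<bar>cc x * m + cd x * n + cq x\<bar> \<le> B}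
    \<subseteq> {-\<lceil>K\<rceil>..\<lceil>K\<rceil>} \<times> {-\<lceil>K\<rceil>..\<lceil>K\<rceil>}"
  proof
    fix z :: "int \<times> int"
    assume "z \<in> {(m :: int, n :: int). \<bar>ca x * m + cb x * n + cp x\<bar> \<le> B \<and> \<bar>cc x * m + cd x * n + cq x\<bar> \<le> B}"
    then obtain m n :: int where z: "z = (m, n)"
      and mn: "\<bar>ca x * m + cb x * n + cp x\<bar> \<le> B" "\<bar>cc x * m + cd x * n + cq x\<bar> \<le> B" by auto
    define X where "X = ca x * m + cb x * n"
    define Z where "Z = cc x * m + cd x * n"
    have XZ: "\<bar>X\<bar> \<le> B + \<bar>cp x\<bar> + \<bar>cq x\<bar>" "\<bar>Z\<bar> \<le> B + \<bar>cp x\<bar> + \<bar>cq x\<bar>"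
      using mn unfolding X_def Z_def by linarith+
    have bnd: "\<bar>u * X + v * Z\<bar> \<le> (\<bar>u\<bar> + \<bar>v\<bar>) * (B + \<bar>cp x\<bar> + \<bar>cq x\<bar>)" for u v
    proof -
      have "\<bar>u * X + v * Z\<bar> \<le> \<bar>u\<bar> * \<bar>X\<bar> + \<bar>v\<bar> * \<bar>Z\<bar>"
        by (metis abs_mult abs_triangle_ineq)
      also have "\<dots> \<le> \<bar>u\<bar> * (B + \<bar>cp x\<bar> + \<bar>cq x\<bar>) + \<bar>v\<bar> * (B + \<bar>cp x\<bar> + \<bar>cq x\<bar>)"
        by (intro add_mono mult_left_mono XZ) auto
      finally show ?thesis by (simp add: algebra_simps)
    qed
    have B0: "0 \<le> B + \<bar>cp x\<bar> + \<bar>cq x\<bar>" using XZ by linarith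
    have "e * m = cd x * X + (- cb x) * Z" "e * n = (- cc x) * X + ca x * Z"
      by (simp_all add: X_def Z_def e_def adet_coords algebra_simps)
    then have "\<bar>e * m\<bar> \<le> (\<bar>cd x\<bar> + \<bar>cb x\<bar>) * (B + \<bar>cp x\<bar> + \<bar>cq x\<bar>)"
      "\<bar>e * n\<bar> \<le> (\<bar>cc x\<bar> + \<bar>ca x\<bar>) * (B + \<bar>cp x\<bar> + \<bar>cq x\<bar>)"
      using bnd[of "cd x" "- cb x"] bnd[of "- cc x" "ca x"] by simp_all
    moreover have "(\<bar>cd x\<bar> + \<bar>cb x\<bar>) * (B + \<bar>cp x\<bar> + \<bar>cq x\<bar>) \<le> K * \<bar>e\<bar>"
      "(\<bar>cc x\<bar> + \<bar>ca x\<bar>) * (B + \<bar>cp x\<bar> + \<bar>cq x\<bar>) \<le> K * \<bar>e\<bar>"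
      using e B0 by (auto simp: K_def intro!: mult_right_mono)
    ultimately have "\<bar>e\<bar> * \<bar>real_of_int m\<bar> \<le> \<bar>e\<bar> * K" "\<bar>e\<bar> * \<bar>real_of_int n\<bar> \<le> \<bar>e\<bar> * K"
      by (simp_all add: abs_mult mult.commute)
    then have "\<bar>real_of_int m\<bar> \<le> K" "\<bar>real_of_int n\<bar> \<le> K"
      using e by simp_all
    then have "\<bar>m\<bar> \<le> \<lceil>K\<rceil>" "\<bar>n\<bar> \<le> \<lceil>K\<rceil>" by linarith+
    then show "z \<in> {-\<lceil>K\<rceil>..\<lceil>K\<rceil>} \<times> {-\<lceil>K\<rceil>..\<lceil>K\<rceil>}"
      by (auto simp: abs_le_iff z)
  qed
  then show ?thesis by (rule finite_subset) simp
qed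

text \<open>The first column is short, the second is reduced modulo the first by its upper entry, and the
marked point lies in the parallelogram spanned by the columns. Reducing by the upper entry rather
than by the inner product makes the volume elementary. If the upper entry of the first
column vanishes, the lower entry takes over; that case is null, but with it every orbit is met.\<close>

definition siegel :: "aff set"
  where "siegel = {x. x \<in> Yset \<and> \<bar>ca x\<bar> \<le> 2 \<and> \<bar>cc x\<bar> \<le> 2 \<and>
    (if ca x \<noteq> 0 then 0 \<le> cb x \<and> cb x < \<bar>ca x\<bar> else 0 \<le> cd x \<and> cd x < \<bar>cc x\<bar>) \<and>
    0 \<le> cd x * cp x - cb x * cq x \<and> cd x * cp x - cb x * cq x < adet x \<and>
    0 \<le> ca x * cq x - cc x * cp x \<and> ca x * cq x - cc x * cp x < adet x}"

lemma siegel_measurable [measurable]: "siegel \<in> sets borel"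
  unfolding siegel_def by measurable

lemma shift_into_interval:
  fixes a b :: real assumes "a \<noteq> 0" shows "\<exists>k :: int. 0 \<le> a * k + b \<and> a * k + b < \<bar>a\<bar>"
proof (cases "a > 0")
  case True
  have "a * of_int (- \<lfloor>b / a\<rfloor>) + b = a * frac (b / a)"
    using True by (simp add: frac_def algebra_simps)
  moreover have "0 \<le> a * frac (b / a)" "a * frac (b / a) < a"
    using True frac_lt_1[of "b/a"] by (simp_all add: frac_ge_0)
  ultimately show ?thesis using True by (intro exI[of _ "- \<lfloor>b / a\<rfloor>"]) auto
next
  case False
  then have a: "a < 0" using assms by simp
  have "a * of_int \<lfloor>b / (-a)\<rfloor> + b = (-a) * frac (b / (-a))"
    using a by (simp add: frac_def algebra_simps)
  moreover have "0 \<le> (-a) * frac (b / (-a))" "(-a) * frac (b / (-a)) < - a"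
    using a frac_lt_1[of "b/(-a)"] mult_strict_left_mono[of "frac (b/(-a))" 1 "-a"]
    by (simp_all add: frac_ge_0 mult_nonneg_nonneg mult_nonpos_nonneg)
  ultimately show ?thesis using a by (intro exI[of _ "\<lfloor>b / (-a)\<rfloor>"]) auto
qed

definition gshear :: "int \<Rightarrow> aff" where "gshear k = (((1, k), 0), ((0, 1), 0))"
definition gtrans :: "int \<Rightarrow> int \<Rightarrow> aff" where "gtrans m n = (((1, 0), m), ((0, 1), n))"
definition gflip :: aff where "gflip = (((0, -1), 0), ((1, 0), 0))"

lemma Gam_generators: "gshear k \<in> Gam" "gtrans m n \<in> Gam" "gflip \<in> Gam"
  by (simp_all add: Gam_def gshear_def gtrans_def gflip_def)

text \<open>Take the first column of least norm in the orbit and reduce the second one by the inner product.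
As the columns can be exchanged, the second is at least as long as the first, and Lagrange's
identity for the determinant bounds the norm.\<close>

lemma short_basis:
  assumes x: "x \<in> Yset"
  shows "\<exists>g\<in>Gam. (ca (x \<odot> g))\<^sup>2 + (cc (x \<odot> g))\<^sup>2 \<le> 2"
proof -
  define N where "N g = (ca (x \<odot> g))\<^sup>2 + (cc (x \<odot> g))\<^sup>2" for g
  define Cols where "Cols = {g\<in>Gam. N g \<le> N aone}"
  define L where "L z = (ca x * fst z + cb x * snd z)\<^sup>2 + (cc x * fst z + cd x * snd z)\<^sup>2" for z :: "real \<times> real"
  have NL: "N g = L (ca g, cc g)" for g by (simp add: N_def L_def)
  let ?col = "\<lambda>g. (ca g, cc g)"
  have "?col ` Cols \<subseteq> (\<lambda>(m, n). (real_of_int m, real_of_int n)) `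
    {(m :: int, n :: int). \<bar>ca x * m + cb x * n + 0\<bar> \<le> sqrt (N aone) \<and> \<bar>cc x * m + cd x * n + 0\<bar> \<le> sqrt (N aone)}"
  proof
    fix z assume "z \<in> ?col ` Cols"
    then obtain g where g: "g \<in> Gam" "N g \<le> N aone" "z = (ca g, cc g)" by (auto simp: Cols_def)
    then obtain m n where mn: "ca g = of_int m" "cc g = of_int n"
      unfolding Gam_def by (auto elim!: Ints_cases)
    have "\<bar>ca x * m + cb x * n\<bar> \<le> sqrt (N aone)" "\<bar>cc x * m + cd x * n\<bar> \<le> sqrt (N aone)"
    proof -
      have "(ca x * m + cb x * n)\<^sup>2 + (cc x * m + cd x * n)\<^sup>2 \<le> N aone"
        using g(2) unfolding NL[of g] L_def fst_conv snd_conv mn .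
      then have "(ca x * m + cb x * n)\<^sup>2 \<le> N aone" "(cc x * m + cd x * n)\<^sup>2 \<le> N aone"
        using zero_le_power2[of "ca x * m + cb x * n"] zero_le_power2[of "cc x * m + cd x * n"] by linarith+
      then show "\<bar>ca x * m + cb x * n\<bar> \<le> sqrt (N aone)" "\<bar>cc x * m + cd x * n\<bar> \<le> sqrt (N aone)"
        using real_sqrt_le_mono by fastforce+
    qed
    then show "z \<in> (\<lambda>(m, n). (real_of_int m, real_of_int n)) `
      {(m :: int, n :: int). \<bar>ca x * m + cb x * n + 0\<bar> \<le> sqrt (N aone) \<and> \<bar>cc x * m + cd x * n + 0\<bar> \<le> sqrt (N aone)}"
      using g mn by (intro image_eqI[of _ _ "(m, n)"]) auto
  qed
  moreover have "finite \<dots>"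
    using finite_lattice_points[of "(((ca x, cb x), 0), ((cc x, cd x), 0))" "sqrt (N aone)"] x
    by (intro finite_imageI) (simp add: Yset_def adet_coords)
  ultimately have fin: "finite (?col ` Cols)" by (rule finite_subset)
  have ne: "?col ` Cols \<noteq> {}" using Gam_one by (auto simp: Cols_def)
  define z where "z = arg_min_on L (?col ` Cols)"
  have z: "z \<in> ?col ` Cols" "\<And>z'. z' \<in> ?col ` Cols \<Longrightarrow> L z \<le> L z'"
    using arg_min_if_finite[OF fin ne, of L] unfolding z_def[symmetric] by (simp, meson not_le)
  then obtain g where g: "g \<in> Gam" "N g \<le> N aone" "z = ?col g" by (auto simp: Cols_def)
  have min: "N g \<le> N h" if "h \<in> Gam" for h
  proof (cases "N h \<le> N aone")
    case True
    then have "?col h \<in> ?col ` Cols" using that by (auto simp: Cols_def)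
    from z(2)[OF this] show ?thesis using g by (simp add: NL)
  qed (use g in simp)
  define y where "y = x \<odot> g"
  have y: "0 < adet y" "adet y \<le> 1" using x g by (simp_all add: y_def Yset_def adet_mult Gam_det)
  define a b c d where "a = ca y" and "b = cb y" and "c = cc y" and "d = cd y"
  define n where "n = a\<^sup>2 + c\<^sup>2"
  have N: "N g = n" by (simp add: N_def y_def n_def a_def c_def)
  have npos: "n > 0"
  proof -
    have "a \<noteq> 0 \<or> c \<noteq> 0" using y by (auto simp: adet_coords a_def c_def)
    then show ?thesis by (simp add: n_def sum_power2_gt_zero_iff)
  qed
  \<comment> \<open>Adding \<open>k\<close> times the first column to the second makes their inner product at most half its squared norm.\<close>
  define k where "k = - round ((a * b + c * d) / n)"
  define b' d' where "b' = a * k + b" and "d' = c * k + d"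
  have ip: "\<bar>a * b' + c * d'\<bar> \<le> n / 2"
  proof -
    have "a * b' + c * d' = n * k + (a * b + c * d)"
      by (simp add: b'_def d'_def n_def power2_eq_square algebra_simps)
    also have "\<dots> = n * ((a * b + c * d) / n - round ((a * b + c * d) / n))"
      using npos by (simp add: k_def right_diff_distrib)
    finally have "a * b' + c * d' = n * ((a * b + c * d) / n - round ((a * b + c * d) / n))" .
    then have "\<bar>a * b' + c * d'\<bar> = n * \<bar>(a * b + c * d) / n - round ((a * b + c * d) / n)\<bar>"
      using npos by (simp add: abs_mult)
    also have "\<dots> \<le> n * (1/2)"
      using npos of_int_round_abs_le[of "(a * b + c * d) / n"]
      by (intro mult_left_mono) (auto simp: abs_minus_commute)
    finally show ?thesis by simp
  qed
  have "n \<le> N (g \<odot> (gshear k \<odot> gflip))"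
    unfolding N[symmetric] by (intro min Gam_mult Gam_generators g)
  also have "N (g \<odot> (gshear k \<odot> gflip)) = b'\<^sup>2 + d'\<^sup>2"
  proof -
    have "x \<odot> (g \<odot> (gshear k \<odot> gflip)) = y \<odot> gshear k \<odot> gflip"
      by (simp add: y_def amul_assoc)
    then show ?thesis
      unfolding N_def
      by (simp only: coord_mult) (simp add: gshear_def gflip_def b'_def d'_def a_def b_def c_def d_def)
  qed
  finally have nb: "n \<le> b'\<^sup>2 + d'\<^sup>2" .
  have det: "a * d' - b' * c = adet y"
    by (simp add: adet_coords a_def b_def c_def d_def b'_def d'_def algebra_simps)
  have "n * n \<le> n * (b'\<^sup>2 + d'\<^sup>2)" using nb npos by simp
  also have "\<dots> = (a * d' - b' * c)\<^sup>2 + (a * b' + c * d')\<^sup>2"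
    by (simp add: n_def power2_eq_square algebra_simps)
  also have "\<dots> \<le> 1 + (n / 2)\<^sup>2"
  proof (rule add_mono)
    show "(a * d' - b' * c)\<^sup>2 \<le> 1" using det y by (simp add: power_le_one)
    show "(a * b' + c * d')\<^sup>2 \<le> (n / 2)\<^sup>2" using ip npos by (simp add: abs_le_square_iff[symmetric])
  qed
  finally have "n\<^sup>2 \<le> 4 / 3" by (simp add: power2_eq_square)
  then have "n\<^sup>2 \<le> 2\<^sup>2" by simp
  then have "n \<le> 2" by (rule power2_le_imp_le) simp
  then show ?thesis using g(1) N by (auto simp: N_def)
qed

lemma siegel_meets:
  assumes x: "x \<in> Yset" shows "\<exists>g\<in>Gam. x \<odot> g \<in> siegel"
proof -
  obtain g where g: "g \<in> Gam" and le: "(ca (x \<odot> g))\<^sup>2 + (cc (x \<odot> g))\<^sup>2 \<le> 2"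
    using short_basis[OF x] by blast
  define y where "y = x \<odot> g"
  have y: "y \<in> Yset" using x g by (simp add: y_def Yset_Gam)
  have "(ca y)\<^sup>2 + (cc y)\<^sup>2 \<le> 2" using le by (simp only: y_def)
  then have "(ca y)\<^sup>2 \<le> 4" "(cc y)\<^sup>2 \<le> 4"
    using zero_le_power2[of "ca y"] zero_le_power2[of "cc y"] by linarith+
  then have a2: "\<bar>ca y\<bar> \<le> 2" "\<bar>cc y\<bar> \<le> 2"
    using abs_le_square_iff[of "ca y" 2] abs_le_square_iff[of "cc y" 2] by simp_all
  have "\<exists>k :: int. if ca y \<noteq> 0 then 0 \<le> ca y * k + cb y \<and> ca y * k + cb y < \<bar>ca y\<bar>
    else 0 \<le> cc y * k + cd y \<and> cc y * k + cd y < \<bar>cc y\<bar>"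
  proof (cases "ca y = 0")
    case True
    then have "cc y \<noteq> 0" using y by (auto simp: Yset_def adet_coords)
    from shift_into_interval[OF this] True show ?thesis by simp
  qed (use shift_into_interval in simp)
  then obtain k :: int where k: "if ca y \<noteq> 0 then 0 \<le> ca y * k + cb y \<and> ca y * k + cb y < \<bar>ca y\<bar>
    else 0 \<le> cc y * k + cd y \<and> cc y * k + cd y < \<bar>cc y\<bar>" by blast
  define z where "z = y \<odot> gshear k"
  have z: "z \<in> Yset" using y by (simp add: z_def Yset_Gam Gam_generators)
  then have zdet: "adet z > 0" by (simp add: Yset_def)
  obtain m :: int where m: "0 \<le> adet z * m + (cd z * cp z - cb z * cq z)" "adet z * m + (cd z * cp z - cb z * cq z) < adet z"
    using shift_into_interval[of "adet z" "cd z * cp z - cb z * cq z"] zdet by auto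
  obtain n :: int where n: "0 \<le> adet z * n + (ca z * cq z - cc z * cp z)" "adet z * n + (ca z * cq z - cc z * cp z) < adet z"
    using shift_into_interval[of "adet z" "ca z * cq z - cc z * cp z"] zdet by auto
  define w where "w = z \<odot> gtrans m n"
  have w: "w \<in> Yset" using z by (simp add: w_def Yset_Gam Gam_generators)
  have wc: "ca w = ca y" "cc w = cc y" "cb w = ca y * k + cb y" "cd w = cc y * k + cd y"
    by (simp_all add: w_def z_def gshear_def gtrans_def)
  have "cd w * cp w - cb w * cq w = adet z * m + (cd z * cp z - cb z * cq z)"
    "ca w * cq w - cc w * cp w = adet z * n + (ca z * cq z - cc z * cp z)"
    by (simp_all add: w_def gtrans_def adet_coords algebra_simps)
  moreover have "adet w = adet z" by (simp add: w_def adet_mult gtrans_def)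
  ultimately have "w \<in> siegel"
    using w a2 k m n unfolding siegel_def mem_Collect_eq wc by simp
  moreover have "w = x \<odot> (g \<odot> (gshear k \<odot> gtrans m n))"
    by (simp add: w_def z_def y_def amul_assoc)
  ultimately show ?thesis using g by (auto intro!: Gam_mult Gam_generators)
qed

lemma abs_int_mult_less: 
  fixes a :: real and k :: int assumes "\<bar>a * k\<bar> < \<bar>a\<bar>" shows "k = 0"
proof -
  have "\<bar>a\<bar> > 0" using assms by linarith
  have "\<bar>a\<bar> * \<bar>real_of_int k\<bar> < \<bar>a\<bar> * 1" using assms by (simp add: abs_mult)
  then have "\<bar>real_of_int k\<bar> < 1" using \<open>\<bar>a\<bar> > 0\<close> by (simp only: mult_less_cancel_left_pos)
  then show ?thesis by linarith
qed

text \<open>The second column and the marked point are confined to half-open intervals one period long,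
which no nonzero integer shift respects.\<close>

lemma siegel_unique:
  assumes y: "y \<in> siegel" and h: "h \<in> Gam" and yh: "y \<odot> h \<in> siegel" and col: "ca h = 1" "cc h = 0"
  shows "h = aone"
proof -
  obtain k m n :: int where kmn: "cb h = k" "cp h = m" "cq h = n"
    using h unfolding Gam_def by (auto elim!: Ints_cases)
  have "cd h = 1" using Gam_det[OF h] col by (simp add: adet_coords)
  note hc = col kmn this
  have ydet: "adet y > 0" using y by (simp add: siegel_def Yset_def)
  have k0: "k = 0"
  proof (cases "ca y = 0")
    case False
    then have "\<bar>ca y * k\<bar> < \<bar>ca y\<bar>"
      using y yh unfolding siegel_def mem_Collect_eq coord_mult hc by auto
    then show ?thesis by (rule abs_int_mult_less)
  next
    case True
    then have "\<bar>cc y * k\<bar> < \<bar>cc y\<bar>"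
      using y yh unfolding siegel_def mem_Collect_eq coord_mult hc by auto
    then show ?thesis by (rule abs_int_mult_less)
  qed
  have e: "adet (y \<odot> h) = adet y" by (simp add: adet_mult Gam_det[OF h])
  have 1: "cd (y \<odot> h) * cp (y \<odot> h) - cb (y \<odot> h) * cq (y \<odot> h) = adet y * m + (cd y * cp y - cb y * cq y)"
    "ca (y \<odot> h) * cq (y \<odot> h) - cc (y \<odot> h) * cp (y \<odot> h) = adet y * n + (ca y * cq y - cc y * cp y)"
    unfolding coord_mult hc k0 adet_coords by (simp_all add: algebra_simps)
  have "\<bar>adet y * m\<bar> < \<bar>adet y\<bar>" "\<bar>adet y * n\<bar> < \<bar>adet y\<bar>"
    using y yh ydet unfolding siegel_def mem_Collect_eq e 1 by auto
  then have "m = 0" "n = 0" by (auto dest: abs_int_mult_less)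
  then show ?thesis using hc k0 by (simp add: aff_eq_iff)
qed

lemma siegel_finite:
  assumes x: "adet x > 0" shows "finite {g\<in>Gam. x \<odot> g \<in> siegel}"
proof -
  let ?col = "\<lambda>g. (ca g, cc g)" and ?S = "{g\<in>Gam. x \<odot> g \<in> siegel}"
  have "?col ` ?S \<subseteq> (\<lambda>(m, n). (real_of_int m, real_of_int n)) `
    {(m :: int, n :: int). \<bar>ca x * m + cb x * n + 0\<bar> \<le> 2 \<and> \<bar>cc x * m + cd x * n + 0\<bar> \<le> 2}"
  proof
    fix z assume "z \<in> ?col ` ?S"
    then obtain g where g: "g \<in> Gam" "x \<odot> g \<in> siegel" "z = (ca g, cc g)" by auto
    then obtain m n where mn: "ca g = of_int m" "cc g = of_int n"
      unfolding Gam_def by (auto elim!: Ints_cases)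
    have "\<bar>ca x * m + cb x * n\<bar> \<le> 2" "\<bar>cc x * m + cd x * n\<bar> \<le> 2"
      using g(2) by (simp_all add: siegel_def mn)
    then show "z \<in> (\<lambda>(m, n). (real_of_int m, real_of_int n)) `
      {(m :: int, n :: int). \<bar>ca x * m + cb x * n + 0\<bar> \<le> 2 \<and> \<bar>cc x * m + cd x * n + 0\<bar> \<le> 2}"
      using g mn by (intro image_eqI[of _ _ "(m, n)"]) auto
  qed
  moreover have "finite \<dots>"
    using finite_lattice_points[of "(((ca x, cb x), 0), ((cc x, cd x), 0))" 2] x
    by (intro finite_imageI) (simp add: adet_coords)
  ultimately have fin: "finite (?col ` ?S)" by (rule finite_subset)
  moreover have "inj_on ?col ?S"
  proof (rule inj_onI)
    fix g g' assume gg: "g \<in> ?S" "g' \<in> ?S" "?col g = ?col g'"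
    then have G: "g \<in> Gam" "g' \<in> Gam" and c: "ca g = ca g'" "cc g = cc g'" by simp_all
    define h where "h = ainv g \<odot> g'"
    have h: "h \<in> Gam" using G by (simp add: h_def Gam_mult Gam_inv)
    have gh: "g' = g \<odot> h"
      using Gam_det[OF G(1)] by (simp add: h_def amul_assoc[symmetric] amul_ainv_right)
    have "ca h = 1" "cc h = 0"
      using Gam_det[OF G(1)] c unfolding h_def coord_mult coord_ainv[OF Gam_det[OF G(1)]]
      by (simp_all add: adet_coords algebra_simps)
    then have "h = aone"
      using gg by (intro siegel_unique[of "x \<odot> g"]) (simp_all add: h gh amul_assoc)
    then show "g = g'" using gh by simp
  qed
  ultimately show ?thesis by (rule finite_imageD)
qed

section \<open>Finite volume\<close>

text \<open>The preimage of a box is a box with the same side lengths in a different order.\<close>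

lemma lborel_distr_basis_bij:
  fixes f :: "'a::euclidean_space \<Rightarrow> 'b::euclidean_space"
  assumes lin: "linear f" and bij: "bij_betw f Basis Basis" and inner: "\<And>x y. f x \<bullet> f y = x \<bullet> y"
  shows "distr lborel borel f = lborel"
proof (rule lborel_eqI[symmetric])
  have [measurable]: "f \<in> borel_measurable borel"
    by (intro borel_measurable_continuous_onI linear_continuous_on linear_conv_bounded_linear[THEN iffD1] lin)
  show "sets (distr lborel borel f) = sets borel" by simp
  fix l u :: 'b
  assume lu: "\<And>b. b \<in> Basis \<Longrightarrow> l \<bullet> b \<le> u \<bullet> b"
  define pull where "pull v = (\<Sum>b\<in>Basis. (v \<bullet> f b) *\<^sub>R b)" for v :: 'b
  have pull: "pull v \<bullet> b = v \<bullet> f b" if "b \<in> Basis" for v b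
    using that by (simp add: pull_def inner_sum_left inner_Basis if_distrib cong: if_cong)
  have im: "f ` Basis = Basis" using bij by (simp add: bij_betw_def)
  have "f -` box l u = box (pull l) (pull u)"
  proof -
    have "x \<in> box (pull l) (pull u) \<longleftrightarrow> f x \<in> box l u" for x
    proof -
      have "f x \<in> box l u \<longleftrightarrow> (\<forall>b\<in>f ` Basis. l \<bullet> b < f x \<bullet> b \<and> f x \<bullet> b < u \<bullet> b)"
        by (simp add: mem_box im)
      also have "\<dots> \<longleftrightarrow> (\<forall>b\<in>Basis. l \<bullet> f b < x \<bullet> b \<and> x \<bullet> b < u \<bullet> f b)"
        by (simp add: inner)
      finally show ?thesis by (simp add: mem_box pull)
    qed
    then show ?thesis by auto
  qed
  then have "emeasure (distr lborel borel f) (box l u) = emeasure lborel (box (pull l) (pull u))"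
    by (subst emeasure_distr) auto
  also have "\<dots> = (\<Prod>b\<in>Basis. (pull u - pull l) \<bullet> b)"
    using lu im by (intro emeasure_lborel_box) (auto simp: pull)
  also have "(\<Prod>b\<in>Basis. (pull u - pull l) \<bullet> b) = (\<Prod>b\<in>Basis. (u - l) \<bullet> f b)"
    by (intro prod.cong) (auto simp: pull inner_diff_left)
  also have "\<dots> = (\<Prod>b\<in>Basis. (u - l) \<bullet> b)"
    by (rule prod.reindex_bij_betw[OF bij])
  finally show "emeasure (distr lborel borel f) (box l u) = ennreal (\<Prod>b\<in>Basis. (u - l) \<bullet> b)" .
qed

text \<open>The same six coordinates in the order first column, second column, marked point, which is the
order in which the Siegel set is integrated.\<close>

definition ofcols :: "((real \<times> real) \<times> (real \<times> real)) \<times> (real \<times> real) \<Rightarrow> aff"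
  where "ofcols z = (((fst (fst (fst z)), fst (snd (fst z))), fst (snd z)),
                    ((snd (fst (fst z)), snd (snd (fst z))), snd (snd z)))"

lemma linear_ofcols: "linear ofcols"
  by (rule linearI) (simp_all add: ofcols_def)

lemma ofcols_measurable [measurable]: "ofcols \<in> borel_measurable borel"
  by (intro borel_measurable_continuous_onI linear_continuous_on linear_conv_bounded_linear[THEN iffD1] linear_ofcols)

lemma coord_ofcols [simp]:
  "ca (ofcols (((a, c), (b, d)), (p, q))) = a" "cb (ofcols (((a, c), (b, d)), (p, q))) = b"
  "cc (ofcols (((a, c), (b, d)), (p, q))) = c" "cd (ofcols (((a, c), (b, d)), (p, q))) = d"
  "cp (ofcols (((a, c), (b, d)), (p, q))) = p" "cq (ofcols (((a, c), (b, d)), (p, q))) = q"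
  by (simp_all add: ofcols_def)

lemma lborel_ofcols: "distr lborel borel ofcols = lborel"
proof (rule lborel_distr_basis_bij[OF linear_ofcols])
  show "ofcols x \<bullet> ofcols y = x \<bullet> y" for x y by (simp add: ofcols_def inner_prod_def)
  show "bij_betw ofcols Basis Basis"
  proof (rule bij_betw_imageI)
    show "inj_on ofcols Basis" by (rule inj_onI) (auto simp: ofcols_def prod_eq_iff)
    show "ofcols ` Basis = Basis"
      by (simp add: Basis_prod_def image_Un image_image ofcols_def zero_prod_def)  auto
  qed
qed

lemma aff_integral_columns:
  fixes u :: "aff \<Rightarrow> ennreal"
  assumes [measurable]: "u \<in> borel_measurable borel"
  shows "(\<integral>\<^sup>+x. u x \<partial>lborel) = (\<integral>\<^sup>+e. \<integral>\<^sup>+f. \<integral>\<^sup>+w. u (ofcols ((e, f), w)) \<partial>lborel \<partial>lborel \<partial>lborel)"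
proof -
  have "(\<integral>\<^sup>+x. u x \<partial>lborel) = (\<integral>\<^sup>+x. u x \<partial>distr lborel borel ofcols)"
    by (simp add: lborel_ofcols)
  also have "\<dots> = (\<integral>\<^sup>+z. u (ofcols z) \<partial>lborel)"
    by (subst nn_integral_distr) auto
  also have "\<dots> = (\<integral>\<^sup>+ef. \<integral>\<^sup>+w. u (ofcols (ef, w)) \<partial>lborel \<partial>lborel)"
    by (subst nn_integral_lborel_pair) auto
  also have "\<dots> = (\<integral>\<^sup>+e. \<integral>\<^sup>+f. \<integral>\<^sup>+w. u (ofcols ((e, f), w)) \<partial>lborel \<partial>lborel \<partial>lborel)"
    by (subst nn_integral_lborel_pair) auto
  finally show ?thesis .
qed

definition siegel_cols :: "aff set"
  where "siegel_cols = {x. x \<in> Yset \<and> \<bar>ca x\<bar> \<le> 2 \<and> \<bar>cc x\<bar> \<le> 2 \<and> ca x \<noteq> 0 \<and> 0 \<le> cb x \<and> cb x < \<bar>ca x\<bar>}"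

text \<open>By Cramer's rule, the marked point has both coordinates in \<open>[0, 1)\<close> with respect to the columns.\<close>

definition fund_parallelogram :: "aff set"
  where "fund_parallelogram = {x. 0 \<le> cd x * cp x - cb x * cq x \<and> cd x * cp x - cb x * cq x < adet x \<and>
    0 \<le> ca x * cq x - cc x * cp x \<and> ca x * cq x - cc x * cp x < adet x}"

lemma siegel_cols_measurable [measurable]: "siegel_cols \<in> sets borel" unfolding siegel_cols_def by measurable
lemma fund_parallelogram_measurable [measurable]: "fund_parallelogram \<in> sets borel" unfolding fund_parallelogram_def by measurable

lemma sheared_strip_measure:
  fixes a k :: real assumes a: "a \<noteq> 0"
  shows "emeasure lborel {d. 0 < a * d - k \<and> a * d - k \<le> 1} \<le> ennreal (1 / \<bar>a\<bar>)"
proof -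
  have "{d. 0 < a * d - k \<and> a * d - k \<le> 1} \<subseteq> {min (k/a) ((1+k)/a)..max (k/a) ((1+k)/a)}"
    using a by (cases "a > 0") (auto simp: field_simps min_def max_def)
  then have "emeasure lborel {d. 0 < a * d - k \<and> a * d - k \<le> 1} \<le> emeasure lborel {min (k/a) ((1+k)/a)..max (k/a) ((1+k)/a)}"
    by (rule emeasure_mono) simp
  also have "\<dots> = ennreal (max (k/a) ((1+k)/a) - min (k/a) ((1+k)/a))"
    by (rule emeasure_lborel_Icc) simp
  also have "max (k/a) ((1+k)/a) - min (k/a) ((1+k)/a) = 1 / \<bar>a\<bar>"
    using a by (cases "a > 0") (auto simp: field_simps min_def max_def)
  finally show ?thesis .
qed

text \<open>For a fixed first column with upper entry \<open>a\<close> the admissible second columns form a sheared rectangle of width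
\<open>\<bar>a\<bar>\<close> and height \<open>1 / \<bar>a\<bar>\<close>, hence of area one; the first column ranges over a square of area 16.\<close>

lemma siegel_bound:
  fixes h :: "aff \<Rightarrow> ennreal"
  assumes [measurable]: "h \<in> borel_measurable borel"
    and h: "\<And>e f. 0 < fst e * snd f - fst f * snd e \<Longrightarrow> fst e * snd f - fst f * snd e \<le> 1 \<Longrightarrow>
      (\<integral>\<^sup>+w. h (ofcols ((e, f), w)) \<partial>lborel) \<le> 1"
  shows "(\<integral>\<^sup>+x. indicator siegel_cols x * h x \<partial>lborel) \<le> 16"
proof -
  define S where "S e f \<longleftrightarrow> 0 < fst e * snd f - fst f * snd e \<and> fst e * snd f - fst f * snd e \<le> 1 \<and>
    \<bar>fst e\<bar> \<le> 2 \<and> \<bar>snd e\<bar> \<le> 2 \<and> fst e \<noteq> 0 \<and> 0 \<le> fst f \<and> fst f < \<bar>fst e\<bar>" for e f :: "real \<times> real"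
  have ind: "indicator siegel_cols (ofcols ((e, f), w)) = (if S e f then 1 else (0::ennreal))" for e f w
    by (cases e, cases f, cases w) (auto simp: siegel_cols_def S_def Yset_def adet_coords indicator_def)
  have inner: "(\<integral>\<^sup>+f. (if S e f then 1 else (0::ennreal)) \<partial>lborel) \<le> (indicator ({-2..2::real} \<times> {-2..2::real}) e)" for e
  proof (cases "\<bar>fst e\<bar> \<le> 2 \<and> \<bar>snd e\<bar> \<le> 2 \<and> fst e \<noteq> 0")
    case False
    then have "(if S e f then 1 else (0::ennreal)) = 0" for f by (auto simp: S_def)
    then show ?thesis by simp
  next
    case True
    obtain a c where e: "e = (a, c)" by (cases e)
    have a: "a \<noteq> 0" using True e by simp
    have "(\<integral>\<^sup>+f. (if S e f then 1 else (0::ennreal)) \<partial>lborel)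
      = (\<integral>\<^sup>+b. \<integral>\<^sup>+d. (if S e (b, d) then 1 else (0::ennreal)) \<partial>lborel \<partial>lborel)"
      unfolding S_def by (subst nn_integral_lborel_pair) auto
    also have "\<dots> \<le> (\<integral>\<^sup>+b. ennreal (1 / \<bar>a\<bar>) * indicator {0..\<bar>a\<bar>} b \<partial>lborel)"
    proof (rule nn_integral_mono)
      fix b :: real
      have "(\<integral>\<^sup>+d. (if S e (b, d) then 1 else (0::ennreal)) \<partial>lborel)
         \<le> (\<integral>\<^sup>+d. indicator {0..\<bar>a\<bar>} b * indicator {d. 0 < a * d - b * c \<and> a * d - b * c \<le> 1} d \<partial>lborel)"
        by (intro nn_integral_mono) (auto simp: S_def e indicator_def)
      also have "\<dots> = indicator {0..\<bar>a\<bar>} b * emeasure lborel {d. 0 < a * d - b * c \<and> a * d - b * c \<le> 1}"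
        by (subst nn_integral_cmult) auto
      also have "\<dots> \<le> indicator {0..\<bar>a\<bar>} b * ennreal (1 / \<bar>a\<bar>)"
        by (intro mult_left_mono sheared_strip_measure a) auto
      finally show "(\<integral>\<^sup>+d. (if S e (b, d) then 1 else (0::ennreal)) \<partial>lborel) \<le> ennreal (1 / \<bar>a\<bar>) * indicator {0..\<bar>a\<bar>} b"
        by (simp add: mult.commute)
    qed
    also have "\<dots> = 1"
      using a by (subst nn_integral_cmult_indicator) (auto simp: ennreal_mult[symmetric])
    also have "(1::ennreal) = indicator ({-2..2::real} \<times> {-2..2::real}) e"
      using True by (auto simp: e indicator_def abs_le_iff)
    finally show ?thesis .
  qed
  have "(\<integral>\<^sup>+x. indicator siegel_cols x * h x \<partial>lborel)
    = (\<integral>\<^sup>+e. \<integral>\<^sup>+f. \<integral>\<^sup>+w. indicator siegel_cols (ofcols ((e, f), w)) * h (ofcols ((e, f), w)) \<partial>lborel \<partial>lborel \<partial>lborel)"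
    by (rule aff_integral_columns) measurable
  also have "\<dots> \<le> (\<integral>\<^sup>+e. \<integral>\<^sup>+f. (if S e f then 1 else 0) \<partial>lborel \<partial>lborel)"
  proof (intro nn_integral_mono)
    fix e f :: "real \<times> real"
    show "(\<integral>\<^sup>+w. indicator siegel_cols (ofcols ((e, f), w)) * h (ofcols ((e, f), w)) \<partial>lborel) \<le> (if S e f then 1 else 0)"
      unfolding ind using h[of e f] by (auto simp: S_def)
  qed
  also have "\<dots> \<le> (\<integral>\<^sup>+e. indicator ({-2..2::real} \<times> {-2..2::real}) e \<partial>lborel)"
    by (intro nn_integral_mono inner)
  also have "\<dots> = emeasure lborel ({-2..2::real} \<times> {-2..2::real})"
    by (subst nn_integral_indicator) (auto simp: borel_prod[symmetric])
  also have "\<dots> = 16"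
    by (subst lborel_prod[symmetric], subst lborel.emeasure_pair_measure_Times)
       (auto simp: ennreal_mult[symmetric] simp flip: ennreal_numeral)
  finally show ?thesis .
qed

lemma fund_parallelogram_area:
  assumes det: "0 < fst e * snd f - fst f * snd e"
  shows "(\<integral>\<^sup>+w. indicator fund_parallelogram (ofcols ((e, f), w)) \<partial>lborel) = ennreal (fst e * snd f - fst f * snd e)"
proof -
  obtain a c b d where ef: "e = (a, c)" "f = (b, d)" by (cases e, cases f)
  define s where "s = sqrt (a * d - b * c)"
  have s: "s > 0" and ss: "s * s = a * d - b * c" using det by (simp_all add: s_def ef)
  have "(d / s) * (a / s) - (- b / s) * (- c / s) = 1"
    using s ss by (simp add: field_simps)
  from preserving_nn_integral[OF preserving_unimodular[where 'a=real, OF this], of "indicator ({0..<s} \<times> {0..<s})"]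
  have "(\<integral>\<^sup>+w. indicator ({0..<s} \<times> {0..<s}) (d / s * fst w + - b / s * snd w, - c / s * fst w + a / s * snd w) \<partial>lborel)
    = emeasure lborel ({0..<s} \<times> {0..<s})"
    by (simp add: borel_prod[symmetric])
  also have "\<dots> = ennreal (s * s)"
    using s by (subst lborel_prod[symmetric], subst lborel.emeasure_pair_measure_Times) (auto simp: ennreal_mult[symmetric])
  also have "(\<integral>\<^sup>+w. indicator ({0..<s} \<times> {0..<s}) (d / s * fst w + - b / s * snd w, - c / s * fst w + a / s * snd w) \<partial>lborel)
    = (\<integral>\<^sup>+w. indicator fund_parallelogram (ofcols ((e, f), w)) \<partial>lborel)"
  proof (intro nn_integral_cong)
    fix w :: "real \<times> real"
    obtain p q where w: "w = (p, q)" by (cases w)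
    have "d / s * p + - b / s * q = (d * p - b * q) / s" "- c / s * p + a / s * q = (a * q - c * p) / s"
      using s by (simp_all add: field_simps)
    moreover have "0 \<le> t / s \<longleftrightarrow> 0 \<le> t" "t / s < s \<longleftrightarrow> t < a * d - b * c" for t
      using s ss by (simp_all add: zero_le_divide_iff pos_divide_less_eq)
    ultimately show "indicator ({0..<s} \<times> {0..<s}) (d / s * fst w + - b / s * snd w, - c / s * fst w + a / s * snd w)
      = (indicator fund_parallelogram (ofcols ((e, f), w)) :: ennreal)"
      by (simp add: indicator_def fund_parallelogram_def ef w adet_coords)
  qed
  finally show ?thesis by (simp add: ss ef)
qed

lemma siegel_subset: "siegel \<subseteq> (siegel_cols \<inter> fund_parallelogram) \<union> {x. ca x = 0}"
  by (auto simp: siegel_def siegel_cols_def fund_parallelogram_def)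

lemma AE_ca_nonzero: "AE x in lborel. ca x \<noteq> 0"
proof -
  have "negligible {x :: aff. (((1, 0), 0), ((0, 0), 0)) \<bullet> x = 0}"
    by (rule negligible_hyperplane) (simp add: zero_prod_def)
  moreover have "{x :: aff. (((1, 0), 0), ((0, 0), 0)) \<bullet> x = 0} = {x. ca x = 0}"
    by (simp add: ca_def inner_prod_def)
  ultimately have "{x. ca x = 0} \<in> null_sets lebesgue" by (simp add: negligible_iff_null_sets)
  then have "{x. ca x = 0} \<in> null_sets lborel"
    by (subst (asm) null_sets_completion_iff) simp_all
  then show ?thesis by (rule AE_I') simp
qed

lemma siegel_integral_bound:
  fixes h :: "aff \<Rightarrow> ennreal"
  assumes [measurable]: "h \<in> borel_measurable borel"
    and h: "\<And>e f. 0 < fst e * snd f - fst f * snd e \<Longrightarrow> fst e * snd f - fst f * snd e \<le> 1 \<Longrightarrow>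
      (\<integral>\<^sup>+w. indicator fund_parallelogram (ofcols ((e, f), w)) * h (ofcols ((e, f), w)) \<partial>lborel) \<le> 1"
  shows "(\<integral>\<^sup>+x. indicator siegel x * h x \<partial>lborel) \<le> 16"
proof -
  have "AE x in lborel. indicator siegel x * h x \<le> indicator siegel_cols x * (indicator fund_parallelogram x * h x)"
    using AE_ca_nonzero
  proof eventually_elim
    fix x assume "ca x \<noteq> 0"
    then have "x \<in> siegel \<Longrightarrow> x \<in> siegel_cols \<and> x \<in> fund_parallelogram" using siegel_subset by auto
    then show "indicator siegel x * h x \<le> indicator siegel_cols x * (indicator fund_parallelogram x * h x)"
      by (cases "x \<in> siegel") simp_all
  qed
  then have "(\<integral>\<^sup>+x. indicator siegel x * h x \<partial>lborel) \<le> (\<integral>\<^sup>+x. indicator siegel_cols x * (indicator fund_parallelogram x * h x) \<partial>lborel)"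
    by (rule nn_integral_mono_AE)
  also have "\<dots> \<le> 16"
    by (rule siegel_bound[OF _ h]) simp_all
  finally show ?thesis .
qed

text \<open>The fundamental parallelogram has area equal to the determinant, which is at most one.\<close>

lemma siegel_volume: "emeasure lborel siegel \<le> 16"
proof -
  have "(\<integral>\<^sup>+x. indicator siegel x * 1 \<partial>lborel) \<le> 16"
    by (rule siegel_integral_bound) (auto simp: fund_parallelogram_area ennreal_le_1)
  then show ?thesis by simp
qed

lemma gtrans_mult: "x \<odot> gtrans m n = (((ca x, cb x), ca x * m + cb x * n + cp x), ((cc x, cd x), cc x * m + cd x * n + cq x))"
  by (simp add: aff_eq_iff gtrans_def)

text \<open>This is Siegel's mean value formula for affine lattices, as an inequality. For fixed columns,
summing over all lattice points while the marked point runs over one parallelogram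
amounts to letting the marked point run over the whole plane.\<close>

lemma siegel_count_bound:
  fixes u :: "aff \<Rightarrow> ennreal"
  assumes [measurable]: "u \<in> borel_measurable borel"
    and u: "\<And>e f. 0 < fst e * snd f - fst f * snd e \<Longrightarrow> fst e * snd f - fst f * snd e \<le> 1 \<Longrightarrow>
      (\<integral>\<^sup>+w. u (ofcols ((e, f), w)) \<partial>lborel) \<le> 1"
  shows "(\<integral>\<^sup>+x. indicator siegel x * (\<integral>\<^sup>+z. u (x \<odot> gtrans (fst z) (snd z)) \<partial>count_space UNIV) \<partial>lborel) \<le> 16"
proof (rule siegel_integral_bound)
  show "(\<lambda>x. \<integral>\<^sup>+z. u (x \<odot> gtrans (fst z) (snd z)) \<partial>count_space UNIV) \<in> borel_measurable borel"
    by (rule borel_measurable_nn_integral_count) auto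
  fix e f :: "real \<times> real"
  assume det: "0 < fst e * snd f - fst f * snd e" "fst e * snd f - fst f * snd e \<le> 1"
  define v :: "int \<times> int \<Rightarrow> real \<times> real" where "v z = of_int (fst z) *\<^sub>R e + of_int (snd z) *\<^sub>R f" for z
  have shift: "ofcols ((e, f), w) \<odot> gtrans (fst z) (snd z) = ofcols ((e, f), w + v z)" for w z
    by (cases e, cases f, cases w) (simp add: gtrans_mult aff_eq_iff v_def ofcols_def)
  have one: "(\<integral>\<^sup>+z. indicator fund_parallelogram (ofcols ((e, f), w - v z)) \<partial>count_space UNIV) \<le> (1 :: ennreal)" for w
  proof -
    let ?A = "{z. ofcols ((e, f), w - v z) \<in> fund_parallelogram}"
    have "z = z'" if "z \<in> ?A" "z' \<in> ?A" for z z'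
    proof -
      obtain a c b d p q where ef: "e = (a, c)" "f = (b, d)" "w = (p, q)" by (cases e, cases f, cases w)
      define D where "D = a * d - b * c"
      have D: "D > 0" using det by (simp add: D_def ef)
      have key: "0 \<le> d * p - b * q - D * fst z" "d * p - b * q - D * fst z < D"
        "0 \<le> a * q - c * p - D * snd z" "a * q - c * p - D * snd z < D" if "z \<in> ?A" for z
      proof -
        let ?y = "ofcols ((e, f), w - v z)"
        have "cd ?y * cp ?y - cb ?y * cq ?y = d * p - b * q - D * fst z"
          "ca ?y * cq ?y - cc ?y * cp ?y = a * q - c * p - D * snd z" "adet ?y = D"
          by (simp_all add: ef v_def D_def adet_coords algebra_simps)
        then show "0 \<le> d * p - b * q - D * fst z" "d * p - b * q - D * fst z < D"
          "0 \<le> a * q - c * p - D * snd z" "a * q - c * p - D * snd z < D"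
          using that by (simp_all only: mem_Collect_eq fund_parallelogram_def)
      qed
      have "\<bar>D * (fst z - fst z')\<bar> < \<bar>D\<bar>" "\<bar>D * (snd z - snd z')\<bar> < \<bar>D\<bar>"
        using key[OF that(1)] key[OF that(2)] D unfolding of_int_diff right_diff_distrib by linarith+
      then have "fst z - fst z' = 0" "snd z - snd z' = 0"
        using abs_int_mult_less[of D "fst z - fst z'"] abs_int_mult_less[of D "snd z - snd z'"] by simp_all
      then show ?thesis by (simp add: prod_eq_iff)
    qed
    then have "?A = {} \<or> (\<exists>z. ?A = {z})" by blast
    then have "emeasure (count_space UNIV) ?A \<le> 1"
      by (elim disjE exE) (simp_all del: mem_Collect_eq)
    also have "emeasure (count_space UNIV) ?A = (\<integral>\<^sup>+z. indicator ?A z \<partial>count_space UNIV)"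
      by simp
    finally show ?thesis by (simp add: indicator_def)
  qed
  have "(\<integral>\<^sup>+w. indicator fund_parallelogram (ofcols ((e, f), w)) * (\<integral>\<^sup>+z. u (ofcols ((e, f), w) \<odot> gtrans (fst z) (snd z)) \<partial>count_space UNIV) \<partial>lborel)
    = (\<integral>\<^sup>+w. \<integral>\<^sup>+z. indicator fund_parallelogram (ofcols ((e, f), w)) * u (ofcols ((e, f), w + v z)) \<partial>count_space UNIV \<partial>lborel)"
    unfolding shift by (subst nn_integral_cmult) auto
  also have "\<dots> = (\<integral>\<^sup>+z. \<integral>\<^sup>+w. indicator fund_parallelogram (ofcols ((e, f), w)) * u (ofcols ((e, f), w + v z)) \<partial>lborel \<partial>count_space UNIV)"
    by (rule nn_integral_count_commute) (auto intro: lborel.sigma_finite_measure_axioms)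
  also have "\<dots> = (\<integral>\<^sup>+z. \<integral>\<^sup>+w. indicator fund_parallelogram (ofcols ((e, f), w - v z)) * u (ofcols ((e, f), w)) \<partial>lborel \<partial>count_space UNIV)"
  proof (rule nn_integral_cong)
    fix z
    show "(\<integral>\<^sup>+w. indicator fund_parallelogram (ofcols ((e, f), w)) * u (ofcols ((e, f), w + v z)) \<partial>lborel)
      = (\<integral>\<^sup>+w. indicator fund_parallelogram (ofcols ((e, f), w - v z)) * u (ofcols ((e, f), w)) \<partial>lborel)"
      using preserving_nn_integral[OF preserving_translation[of "v z"], of "\<lambda>w. indicator fund_parallelogram (ofcols ((e, f), w - v z)) * u (ofcols ((e, f), w))"]
      by simp
  qed
  also have "\<dots> = (\<integral>\<^sup>+w. \<integral>\<^sup>+z. u (ofcols ((e, f), w)) * indicator fund_parallelogram (ofcols ((e, f), w - v z)) \<partial>count_space UNIV \<partial>lborel)"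
    by (subst nn_integral_count_commute[symmetric]) (auto intro: lborel.sigma_finite_measure_axioms simp: mult.commute)
  also have "\<dots> = (\<integral>\<^sup>+w. u (ofcols ((e, f), w)) * (\<integral>\<^sup>+z. indicator fund_parallelogram (ofcols ((e, f), w - v z)) \<partial>count_space UNIV) \<partial>lborel)"
    by (subst nn_integral_cmult) auto
  also have "\<dots> \<le> (\<integral>\<^sup>+w. u (ofcols ((e, f), w)) * 1 \<partial>lborel)"
    by (intro nn_integral_mono mult_left_mono one) auto
  also have "\<dots> \<le> 1" using u[OF det] by simp
  finally show "(\<integral>\<^sup>+w. indicator fund_parallelogram (ofcols ((e, f), w)) * (\<integral>\<^sup>+z. u (ofcols ((e, f), w) \<odot> gtrans (fst z) (snd z)) \<partial>count_space UNIV) \<partial>lborel) \<le> 1" .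
qed

definition mult_siegel :: "aff \<Rightarrow> ennreal"
  where "mult_siegel x = (\<integral>\<^sup>+g. indicator siegel (x \<odot> g) \<partial>count_space Gam)"

definition siegel_wt :: "aff \<Rightarrow> ennreal"
  where "siegel_wt x = indicator siegel x / mult_siegel x"

lemma mult_siegel_measurable [measurable]: "mult_siegel \<in> borel_measurable borel"
  unfolding mult_siegel_def by (rule borel_measurable_nn_integral_count) (auto intro: countable_Gam)

lemma mult_siegel_Gam: "g \<in> Gam \<Longrightarrow> mult_siegel (x \<odot> g) = mult_siegel x"
  unfolding mult_siegel_def amul_assoc
  by (rule nn_integral_bij_count_space[OF bij_betw_Gam_mult])

lemma mult_siegel_eq: "mult_siegel x = emeasure (count_space Gam) {g\<in>Gam. x \<odot> g \<in> siegel}"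
proof -
  have "emeasure (count_space Gam) {g\<in>Gam. x \<odot> g \<in> siegel}
    = (\<integral>\<^sup>+g. indicator {g\<in>Gam. x \<odot> g \<in> siegel} g \<partial>count_space Gam)"
    by simp
  also have "\<dots> = mult_siegel x"
    unfolding mult_siegel_def by (intro nn_integral_cong) (simp add: indicator_def)
  finally show ?thesis by simp
qed

lemma mult_siegel_bounds:
  assumes "x \<in> Yset" shows "1 \<le> mult_siegel x" "mult_siegel x < \<infinity>"
proof -
  let ?S = "{g\<in>Gam. x \<odot> g \<in> siegel}"
  have fin: "finite ?S" using assms by (intro siegel_finite) (simp add: Yset_def)
  have "?S \<noteq> {}" using siegel_meets[OF assms] by auto
  then have "1 \<le> card ?S" using fin by (simp add: Suc_le_eq card_gt_0_iff)
  moreover have "mult_siegel x = of_nat (card ?S)"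
    unfolding mult_siegel_eq using fin by (subst emeasure_count_space_finite) auto
  ultimately show "1 \<le> mult_siegel x" "mult_siegel x < \<infinity>"
    by (auto simp: of_nat_less_top)
qed

lemma weight_siegel_wt: "weight siegel_wt"
proof -
  have "(\<integral>\<^sup>+g. siegel_wt (x \<odot> g) \<partial>count_space Gam) = indicator Yset x" for x
  proof -
    have "(\<integral>\<^sup>+g. siegel_wt (x \<odot> g) \<partial>count_space Gam) = (\<integral>\<^sup>+g. indicator siegel (x \<odot> g) / mult_siegel x \<partial>count_space Gam)"
      by (intro nn_integral_cong) (simp add: siegel_wt_def mult_siegel_Gam)
    also have "\<dots> = mult_siegel x / mult_siegel x"
      by (subst nn_integral_divide) (auto simp: mult_siegel_def)
    also have "\<dots> = indicator Yset x"
    proof (cases "x \<in> Yset")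
      case True
      have "mult_siegel x \<noteq> 0" "mult_siegel x \<noteq> \<top>" using mult_siegel_bounds[OF True] by auto
      then show ?thesis using True by (simp add: ennreal_divide_self less_top)
    next
      case False
      then have "x \<odot> g \<notin> siegel" if "g \<in> Gam" for g
        using that by (auto simp: siegel_def Yset_Gam)
      then have "mult_siegel x = (\<integral>\<^sup>+g. 0 \<partial>count_space Gam)"
        unfolding mult_siegel_def by (intro nn_integral_cong) simp
      then show ?thesis using False by simp
    qed
    finally show ?thesis .
  qed
  then show ?thesis by (simp add: weight_def siegel_wt_def[abs_def])
qed

lemma siegel_wt_measurable [measurable]: "siegel_wt \<in> borel_measurable borel"
  by (rule weight_measurable[OF weight_siegel_wt])

lemma siegel_wt_le: "siegel_wt x \<le> indicator siegel x"
proof (cases "x \<in> siegel")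
  case True
  then have "x \<in> Yset" by (simp add: siegel_def)
  note m = mult_siegel_bounds[OF this]
  then have "1 / mult_siegel x \<le> mult_siegel x / mult_siegel x" by (intro divide_right_mono_ennreal)
  moreover have "mult_siegel x / mult_siegel x = 1" using m by (intro ennreal_divide_self) auto
  ultimately have "1 / mult_siegel x \<le> 1" by simp
  then show ?thesis using True by (simp add: siegel_wt_def)
qed (simp add: siegel_wt_def)

definition vol :: ennreal where "vol = (\<integral>\<^sup>+x. siegel_wt x \<partial>lborel)"

lemma vol_finite: "vol < \<infinity>"
proof -
  have "vol \<le> (\<integral>\<^sup>+x. indicator siegel x \<partial>lborel)" unfolding vol_def by (intro nn_integral_mono siegel_wt_le)
  also have "\<dots> \<le> 16" using siegel_volume by simp
  also have "\<dots> < \<infinity>" by simp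
  finally show ?thesis .
qed

lemma open_not_null:
  fixes S :: "'a::euclidean_space set"
  assumes "open S" "S \<noteq> {}" shows "emeasure lborel S \<noteq> 0"
proof
  assume "emeasure lborel S = 0"
  then have "S \<in> null_sets lborel" using assms by (intro null_setsI) auto
  then have "S \<in> null_sets lebesgue" by (simp add: null_sets_completionI)
  then show False using open_not_negligible[OF assms] by (simp add: negligible_iff_null_sets)
qed

lemma vol_pos: "vol \<noteq> 0"
proof
  assume "vol = 0"
  then have "emeasure lborel (UNIV \<inter> Yset) = 0"
    by (subst weight_null_iff[OF weight_siegel_wt, symmetric]) (auto simp: vol_def)
  then have "emeasure lborel Yset = 0" by simp
  have "open {x. 0 < adet x \<and> adet x < 1}"
    unfolding adet_conv by (intro open_Collect_conj open_Collect_less continuous_intros)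
  moreover have "(((1/2, 0), 0), ((0, 1), 0)) \<in> {x. 0 < adet x \<and> adet x < 1}" by simp
  ultimately have "emeasure lborel {x. 0 < adet x \<and> adet x < 1} \<noteq> 0"
    by (intro open_not_null) blast+
  moreover have "emeasure lborel {x. 0 < adet x \<and> adet x < 1} \<le> emeasure lborel Yset"
    by (intro emeasure_mono) (auto simp: Yset_def)
  ultimately show False using \<open>emeasure lborel Yset = 0\<close> by simp
qed

section \<open>Continuity of translation\<close>

lemma preserving_integrable:
  fixes f :: "'a::euclidean_space \<Rightarrow> real"
  assumes "preserving T" "integrable lborel f" shows "integrable lborel (\<lambda>x. f (T x))"
proof -
  have T: "T \<in> measurable lborel borel" and d: "distr lborel borel T = lborel" using assms by (auto simp: preserving_def)
  have f: "f \<in> borel_measurable borel" using borel_measurable_integrable[OF assms(2)] by simp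
  show ?thesis using integrable_distr_eq[OF T f] assms(2) unfolding d by simp
qed

lemma preserving_integral:
  fixes f :: "'a::euclidean_space \<Rightarrow> real"
  assumes "preserving T" "f \<in> borel_measurable borel" shows "(\<integral>x. f (T x) \<partial>lborel) = (\<integral>x. f x \<partial>lborel)"
proof -
  have T: "T \<in> measurable lborel borel" and d: "distr lborel borel T = lborel" using assms by (auto simp: preserving_def)
  show ?thesis using integral_distr[OF T assms(2)] unfolding d by simp
qed

text \<open>Since \<open>T k\<close> preserves measure, the symmetric difference of \<open>A\<close> and its preimage has twice the measure of
one half of it. Inside an open set \<open>U\<close> slightly larger than \<open>A\<close>, the points of \<open>A\<close> stay in \<open>U\<close> for
large \<open>k\<close> by pointwise convergence, and \<open>U - A\<close> is small.\<close>

lemma L1_continuity_indicator: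
  fixes T :: "nat \<Rightarrow> 'a::euclidean_space \<Rightarrow> 'a" and A :: "'a set"
  assumes T: "\<And>k. preserving (T k)" and lim: "\<And>x. (\<lambda>k. T k x) \<longlonglongrightarrow> x"
    and A [measurable]: "A \<in> sets borel" and fin: "emeasure lborel A < \<infinity>"
  shows "(\<lambda>k. \<integral>x. \<bar>indicator A (T k x) - indicator A x\<bar> \<partial>lborel) \<longlonglongrightarrow> (0 :: real)"
proof (rule LIMSEQ_I)
  fix e :: real assume e: "0 < e"
  have [measurable]: "T k \<in> borel_measurable borel" for k using T by (simp add: preserving_def)
  obtain U where U: "open U" "A \<subseteq> U" "emeasure lborel (U - A) < ennreal (e / 4)"
    using outer_regular_lborel[OF A, of "e / 4"] e by auto
  have [measurable]: "U \<in> sets borel" using U by simp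
  have intA: "integrable lborel (indicator A :: 'a \<Rightarrow> real)"
    using fin by (simp add: integrable_indicator_iff)
  have intUA: "integrable lborel (indicator (U - A) :: 'a \<Rightarrow> real)"
    using order.strict_trans[OF U(3) ennreal_less_top] by (simp add: integrable_indicator_iff)
  have UA: "measure lborel (U - A) < e / 4"
  proof -
    have "emeasure lborel (U - A) = ennreal (measure lborel (U - A))"
      using U(3) by (intro emeasure_eq_ennreal_measure) auto
    then show ?thesis using U(3) e by (simp add: ennreal_less_iff)
  qed
  have "(\<lambda>k. \<integral>x. indicator A x * (1 - indicator U (T k x)) \<partial>lborel) \<longlonglongrightarrow> (integral\<^sup>L (lborel :: 'a measure) (\<lambda>_. 0 :: real))"
  proof (rule integral_dominated_convergence[where w="indicator A"])
    show "AE x in lborel. (\<lambda>k. indicator A x * (1 - indicator U (T k x))) \<longlonglongrightarrow> (0::real)"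
    proof (rule AE_I2)
      fix x
      show "(\<lambda>k. indicator A x * (1 - indicator U (T k x))) \<longlonglongrightarrow> (0::real)"
      proof (cases "x \<in> A")
        case True
        then have "\<forall>\<^sub>F k in sequentially. T k x \<in> U"
          using lim[of x] U topological_tendstoD by blast
        then have "\<forall>\<^sub>F k in sequentially. indicator A x * (1 - indicator U (T k x)) = (0::real)"
          by eventually_elim simp
        then show ?thesis by (rule tendsto_eventually)
      qed simp
    qed
  qed (use intA in \<open>auto simp: indicator_def\<close>)
  then have "(\<lambda>k. \<integral>x. indicator A x * (1 - indicator U (T k x)) \<partial>lborel) \<longlonglongrightarrow> (0::real)" by simp
  from LIMSEQ_D[OF this, of "e/4"] e obtain N where
    N: "\<And>k. k \<ge> N \<Longrightarrow> \<bar>\<integral>x. indicator A x * (1 - indicator U (T k x)) \<partial>lborel :: real\<bar> < e / 4" by auto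
  show "\<exists>N. \<forall>k\<ge>N. norm ((\<integral>x. \<bar>indicator A (T k x) - indicator A x\<bar> \<partial>lborel) - (0::real)) < e"
  proof (intro exI[of _ N] allI impI)
    fix k assume k: "N \<le> k"
    have iT: "integrable lborel (\<lambda>x. indicator A (T k x) :: real)"
      "integrable lborel (\<lambda>x. indicator (U - A) (T k x) :: real)"
      using preserving_integrable[OF T intA] preserving_integrable[OF T intUA] by simp_all
    have iI: "integrable lborel (\<lambda>x. indicator A x * (1 - indicator U (T k x)) :: real)"
      by (rule Bochner_Integration.integrable_bound[OF intA]) (auto simp: indicator_def)
    have "(\<integral>x. \<bar>indicator A (T k x) - indicator A x\<bar> \<partial>lborel)
      \<le> (\<integral>x. (indicator A (T k x) - indicator A x) + 2 * (indicator A x * (1 - indicator U (T k x)) + indicator (U - A) (T k x)) \<partial>lborel :: real)"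
    proof (rule integral_mono)
      show "\<bar>indicator A (T k x) - indicator A x\<bar> \<le> (indicator A (T k x) - indicator A x) +
        2 * (indicator A x * (1 - indicator U (T k x)) + indicator (U - A) (T k x) :: real)" for x
        using U(2) by (auto simp: indicator_def)
    qed (use iT iI intA in simp_all)
    also have "\<dots> = (\<integral>x. indicator A (T k x) \<partial>lborel) - (\<integral>x. indicator A x \<partial>lborel) +
       2 * ((\<integral>x. indicator A x * (1 - indicator U (T k x)) \<partial>lborel) + (\<integral>x. indicator (U - A) (T k x) \<partial>lborel))"
      using iT iI intA by simp
    also have "\<dots> = 2 * ((\<integral>x. indicator A x * (1 - indicator U (T k x)) \<partial>lborel) + measure lborel (U - A))"
      using preserving_integral[OF T, of "indicator A" k] preserving_integral[OF T, of "indicator (U - A)" k] by simp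
    also have "\<dots> < 2 * (e / 4 + e / 4)"
      by (intro mult_strict_left_mono add_strict_mono UA le_less_trans[OF abs_ge_self N[OF k]]) simp
    also have "\<dots> = e" by simp
    finally show "norm ((\<integral>x. \<bar>indicator A (T k x) - indicator A x\<bar> \<partial>lborel) - (0::real)) < e" by simp
  qed
qed

lemma L1_continuity:
  fixes T :: "nat \<Rightarrow> 'a::euclidean_space \<Rightarrow> 'a" and h :: "'a \<Rightarrow> real"
  assumes T: "\<And>k. preserving (T k)" and lim: "\<And>x. (\<lambda>k. T k x) \<longlonglongrightarrow> x" and h: "integrable lborel h"
  shows "(\<lambda>k. \<integral>x. \<bar>h (T k x) - h x\<bar> \<partial>lborel) \<longlonglongrightarrow> 0"
  using h
proof (induction h rule: integrable_induct)
  case (base A c)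
  have "(\<lambda>k. (\<integral>x. \<bar>indicator A (T k x) - indicator A x\<bar> \<partial>lborel) * \<bar>c\<bar>) \<longlonglongrightarrow> 0 * \<bar>c\<bar>"
    using base by (intro tendsto_mult_right L1_continuity_indicator T lim) auto
  moreover have "\<bar>indicator A y *\<^sub>R c - indicator A x *\<^sub>R c\<bar> = \<bar>indicator A y - indicator A x\<bar> * \<bar>c\<bar>" for x y
    by (simp add: abs_mult left_diff_distrib[symmetric])
  ultimately show ?case by simp
next
  case (add f g)
  note iT = preserving_integrable[OF T]
  show ?case
  proof (rule tendsto_sandwich[OF _ _ tendsto_const])
    show "(\<lambda>k. (\<integral>x. \<bar>f (T k x) - f x\<bar> \<partial>lborel) + (\<integral>x. \<bar>g (T k x) - g x\<bar> \<partial>lborel)) \<longlonglongrightarrow> 0"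
      using tendsto_add[OF add(3,4)] by simp
    show "\<forall>\<^sub>F k in sequentially. (\<integral>x. \<bar>f (T k x) + g (T k x) - (f x + g x)\<bar> \<partial>lborel)
      \<le> (\<integral>x. \<bar>f (T k x) - f x\<bar> \<partial>lborel) + (\<integral>x. \<bar>g (T k x) - g x\<bar> \<partial>lborel)"
    proof (rule always_eventually, rule allI)
      fix k
      have "(\<integral>x. \<bar>f (T k x) + g (T k x) - (f x + g x)\<bar> \<partial>lborel)
        \<le> (\<integral>x. \<bar>f (T k x) - f x\<bar> + \<bar>g (T k x) - g x\<bar> \<partial>lborel)"
        using add(1,2) iT[OF add(1), of k] iT[OF add(2), of k] by (intro integral_mono) auto
      also have "\<dots> = (\<integral>x. \<bar>f (T k x) - f x\<bar> \<partial>lborel) + (\<integral>x. \<bar>g (T k x) - g x\<bar> \<partial>lborel)"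
        using add(1,2) iT[OF add(1), of k] iT[OF add(2), of k] by (intro Bochner_Integration.integral_add) auto
      finally show "(\<integral>x. \<bar>f (T k x) + g (T k x) - (f x + g x)\<bar> \<partial>lborel)
        \<le> (\<integral>x. \<bar>f (T k x) - f x\<bar> \<partial>lborel) + (\<integral>x. \<bar>g (T k x) - g x\<bar> \<partial>lborel)" .
    qed
  qed (auto intro!: always_eventually)
next
  case (lim f s)
  note iT = preserving_integrable[OF T]
  have int_s: "integrable lborel (s i)" and int_f: "integrable lborel f"
    and conv_s: "(\<lambda>k. \<integral>x. \<bar>s i (T k x) - s i x\<bar> \<partial>lborel) \<longlonglongrightarrow> 0" for i
    by (rule lim)+
  have s_lim: "(\<lambda>i. s i x) \<longlonglongrightarrow> f x" and s_bound: "norm (s i x) \<le> 2 * norm (f x)" for i x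
    by (rule lim, simp)+
  have fm [measurable]: "f \<in> borel_measurable borel" and sm [measurable]: "s i \<in> borel_measurable borel" for i
    using borel_measurable_integrable[OF int_f] borel_measurable_integrable[OF int_s] by simp_all
  show ?case
  proof (rule LIMSEQ_I)
    fix e :: real assume e: "0 < e"
    have "(\<lambda>i. \<integral>x. \<bar>s i x - f x\<bar> \<partial>lborel) \<longlonglongrightarrow> (integral\<^sup>L (lborel :: 'a measure) (\<lambda>_. 0 :: real))"
    proof (rule integral_dominated_convergence[where w="\<lambda>x. 3 * \<bar>f x\<bar>"])
      show "AE x in lborel. (\<lambda>i. \<bar>s i x - f x\<bar>) \<longlonglongrightarrow> 0"
      proof (rule AE_I2)
        fix x :: 'a
        have "(\<lambda>i. \<bar>s i x - f x\<bar>) \<longlonglongrightarrow> \<bar>f x - f x\<bar>"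
          using s_lim[of x] by (intro tendsto_intros) auto
        then show "(\<lambda>i. \<bar>s i x - f x\<bar>) \<longlonglongrightarrow> 0" by simp
      qed
      show "AE x in lborel. norm \<bar>s i x - f x\<bar> \<le> 3 * \<bar>f x\<bar>" for i
        by (intro AE_I2) (use s_bound[of i] in \<open>simp, smt (verit)\<close>)
    qed (use int_f in auto)
    then have "(\<lambda>i. \<integral>x. \<bar>s i x - f x\<bar> \<partial>lborel) \<longlonglongrightarrow> 0" by simp
    from LIMSEQ_D[OF this, of "e/3"] e obtain i where "norm ((\<integral>x. \<bar>s i x - f x\<bar> \<partial>lborel) - 0) < e / 3" by auto
    then have i: "(\<integral>x. \<bar>s i x - f x\<bar> \<partial>lborel) < e / 3" by simp
    from LIMSEQ_D[OF conv_s[of i], of "e/3"] e obtain N where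
      N: "\<And>k. k \<ge> N \<Longrightarrow> \<bar>\<integral>x. \<bar>s i (T k x) - s i x\<bar> \<partial>lborel\<bar> < e / 3" by auto
    show "\<exists>N. \<forall>k\<ge>N. norm ((\<integral>x. \<bar>f (T k x) - f x\<bar> \<partial>lborel) - 0) < e"
    proof (intro exI[of _ N] allI impI)
      fix k assume k: "N \<le> k"
      have [measurable]: "T k \<in> borel_measurable borel" using T by (simp add: preserving_def)
      have "(\<integral>x. \<bar>f (T k x) - f x\<bar> \<partial>lborel)
        \<le> (\<integral>x. \<bar>s i (T k x) - f (T k x)\<bar> + \<bar>s i (T k x) - s i x\<bar> + \<bar>s i x - f x\<bar> \<partial>lborel)"
        using int_s[of i] int_f iT[OF int_s[of i], of k] iT[OF int_f, of k] by (intro integral_mono) auto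
      also have "\<dots> = (\<integral>x. \<bar>s i (T k x) - f (T k x)\<bar> \<partial>lborel) + (\<integral>x. \<bar>s i (T k x) - s i x\<bar> \<partial>lborel) + (\<integral>x. \<bar>s i x - f x\<bar> \<partial>lborel)"
        using int_s[of i] int_f iT[OF int_s[of i], of k] iT[OF int_f, of k] by simp
      also have "(\<integral>x. \<bar>s i (T k x) - f (T k x)\<bar> \<partial>lborel) = (\<integral>x. \<bar>s i x - f x\<bar> \<partial>lborel)"
        by (rule preserving_integral[OF T, of "\<lambda>x. \<bar>s i x - f x\<bar>"]) measurable
      finally show "norm ((\<integral>x. \<bar>f (T k x) - f x\<bar> \<partial>lborel) - 0) < e"
        using i N[OF k] by simp
    qed
  qed
qed

section \<open>The finite measure on the affine group\<close>

text \<open>On sets invariant under \<open>Gam\<close> this finite measure is the invariant measure of the quotient;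
on other sets it depends on the weight.\<close>

definition J :: "aff measure" where "J = density lborel siegel_wt"

lemma sets_J [simp, measurable_cong]: "sets J = sets borel" and space_J [simp]: "space J = UNIV"
  by (simp_all add: J_def)

lemma emeasure_J: "A \<in> sets borel \<Longrightarrow> emeasure J A = (\<integral>\<^sup>+x. siegel_wt x * indicator A x \<partial>lborel)"
  by (simp add: J_def emeasure_density)

interpretation J: finite_measure J
  by (rule finite_measureI) (use vol_finite in \<open>simp add: emeasure_J vol_def\<close>)

definition Gam_set :: "aff set \<Rightarrow> bool"
  where "Gam_set B \<longleftrightarrow> B \<in> sets borel \<and> (\<forall>x. \<forall>g\<in>Gam. x \<odot> g \<in> B \<longleftrightarrow> x \<in> B)"

lemma Gam_set_sets: "Gam_set B \<Longrightarrow> B \<in> sets borel" by (simp add: Gam_set_def)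

lemma Gam_set_vimage:
  assumes "Gam_set B" "good_map T" shows "Gam_set (T -` B)"
proof -
  have "T \<in> borel_measurable borel" using assms by (simp add: good_map_measurable)
  then have "T -` B \<inter> space borel \<in> sets borel" using assms by (intro measurable_sets) (auto simp: Gam_set_def)
  then show ?thesis using assms by (auto simp: Gam_set_def good_map_Gam)
qed

lemma Gam_set_Int: "Gam_set B \<Longrightarrow> Gam_set C \<Longrightarrow> Gam_set (B \<inter> C)" and Gam_set_Diff: "Gam_set B \<Longrightarrow> Gam_set C \<Longrightarrow> Gam_set (B - C)"
  by (auto simp: Gam_set_def)

lemma emeasure_J_vimage:
  assumes B: "Gam_set B" and T: "good_map T" "good_map T'" "\<And>x. T' (T x) = x"
  shows "emeasure J (T -` B) = emeasure J B"
proof -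
  have [measurable]: "B \<in> sets borel" "T -` B \<in> sets borel" using B Gam_set_vimage[OF B T(1)] by (auto simp: Gam_set_def)
  have "emeasure J (T -` B) = (\<integral>\<^sup>+x. siegel_wt x * indicator B (T x) \<partial>lborel)"
    by (simp add: emeasure_J indicator_vimage)
  also have "\<dots> = (\<integral>\<^sup>+x. siegel_wt x * indicator B x \<partial>lborel)"
    by (rule weight_integral_good_map[OF weight_siegel_wt _ _ T]) (use B in \<open>auto simp: Ginv_def Gam_set_def indicator_def\<close>)
  finally show ?thesis by (simp add: emeasure_J)
qed

lemma J_null_iff: "Gam_set B \<Longrightarrow> emeasure J B = 0 \<longleftrightarrow> (AE x in lborel. x \<in> Yset \<longrightarrow> x \<notin> B)"
proof -
  assume B: "Gam_set B"
  then have [measurable]: "B \<in> sets borel" by (rule Gam_set_sets)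
  have "emeasure J B = 0 \<longleftrightarrow> emeasure lborel (B \<inter> Yset) = 0"
    using B by (simp add: emeasure_J weight_null_iff[OF weight_siegel_wt] Gam_set_def)
  also have "\<dots> \<longleftrightarrow> (AE x in lborel. x \<notin> B \<inter> Yset)"
    by (subst AE_iff_measurable[OF _ refl]) (simp_all add: Int_def)
  also have "\<dots> \<longleftrightarrow> (AE x in lborel. x \<in> Yset \<longrightarrow> x \<notin> B)" by (rule AE_cong) auto
  finally show ?thesis .
qed

text \<open>Invariance modulo null sets, tested on the part of the cone of finite volume.\<close>

definition keeps :: "aff set \<Rightarrow> (aff \<Rightarrow> aff) \<Rightarrow> bool"
  where "keeps B T \<longleftrightarrow> (AE x in lborel. x \<in> Yset \<longrightarrow> (T x \<in> B \<longleftrightarrow> x \<in> B))"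

lemma good_map_Yset: "good_map T \<Longrightarrow> T x \<in> Yset \<longleftrightarrow> x \<in> Yset"
  by (simp add: Yset_def good_map_det)

lemma keeps_comp:
  assumes "keeps B T" "keeps B S" "good_map S" shows "keeps B (\<lambda>x. T (S x))"
proof -
  have "AE x in lborel. S x \<in> Yset \<longrightarrow> (T (S x) \<in> B \<longleftrightarrow> S x \<in> B)"
    using preserving_AE[OF good_map_preserving[OF assms(3)] assms(1)[unfolded keeps_def]] .
  then show ?thesis using assms(2) unfolding keeps_def
    by eventually_elim (simp add: good_map_Yset[OF assms(3)])
qed

lemma keeps_inverse:
  assumes "keeps B T" "good_map T'" "\<And>x. T (T' x) = x" shows "keeps B T'"
proof -
  have "AE x in lborel. T' x \<in> Yset \<longrightarrow> (T (T' x) \<in> B \<longleftrightarrow> T' x \<in> B)"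
    using preserving_AE[OF good_map_preserving[OF assms(2)] assms(1)[unfolded keeps_def]] .
  then show ?thesis unfolding keeps_def
    by eventually_elim (simp add: good_map_Yset[OF assms(2)] assms(3))
qed

lemma keeps_id: "keeps B (\<lambda>x. x)" by (simp add: keeps_def)

lemma keeps_funpow:
  assumes "keeps B T" "good_map T" shows "keeps B (T ^^ n)"
proof (induction n)
  case 0 show ?case using keeps_id by (simp add: id_def)
next
  case (Suc n) then show ?case
    using keeps_comp[OF assms(1) Suc good_map_funpow[OF assms(2)]] by (simp add: o_def)
qed

text \<open>In a finite measure space, a set whose measure-preserving preimage meets it in full measure
agrees with that preimage up to a null set.\<close>

lemma keepsI:
  assumes B: "Gam_set B" and T: "good_map T" "good_map T'" "\<And>x. T' (T x) = x"
    and eq: "measure J (B \<inter> T -` B) = measure J B"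
  shows "keeps B T"
proof -
  have TB: "Gam_set (T -` B)" by (rule Gam_set_vimage[OF B T(1)])
  have [measurable]: "B \<in> sets borel" "T -` B \<in> sets borel" using B TB by (auto simp: Gam_set_def)
  have "measure J (T -` B) = measure J B" by (simp add: measure_def emeasure_J_vimage[OF B T])
  then have "measure J (B - T -` B) = 0" "measure J (T -` B - B) = 0"
    using J.finite_measure_Diff'[of B "T -` B"] J.finite_measure_Diff'[of "T -` B" B] eq
    by (simp_all add: Int_commute)
  then have "emeasure J (B - T -` B) = 0" "emeasure J (T -` B - B) = 0"
    by (simp_all add: J.emeasure_eq_measure)
  then have "AE x in lborel. x \<in> Yset \<longrightarrow> x \<notin> B - T -` B" "AE x in lborel. x \<in> Yset \<longrightarrow> x \<notin> T -` B - B"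
    using J_null_iff[OF Gam_set_Diff[OF B TB]] J_null_iff[OF Gam_set_Diff[OF TB B]] by blast+
  then show ?thesis unfolding keeps_def by eventually_elim auto
qed

text \<open>Moving the transformation to the integrable function, the weight restricted to \<open>B\<close>, turns the claim into
continuity of translation.\<close>

lemma weak_continuity:
  assumes [measurable]: "B \<in> sets borel" "C \<in> sets borel"
    and T: "\<And>k. preserving (T k)" "\<And>k. preserving (T' k)" "\<And>k x. T' k (T k x) = x"
    and lim: "\<And>x. (\<lambda>k. T' k x) \<longlonglongrightarrow> x"
  shows "(\<lambda>k. measure J (B \<inter> T k -` C)) \<longlonglongrightarrow> measure J (B \<inter> C)"
proof -
  have [measurable]: "T k \<in> borel_measurable borel" "T' k \<in> borel_measurable borel" for k
    using T(1,2) by (auto simp: preserving_def)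
  define h :: "aff \<Rightarrow> real" where "h x = enn2real (siegel_wt x) * indicator B x" for x
  have [measurable]: "h \<in> borel_measurable borel" unfolding h_def by measurable
  have siegel_wt: "ennreal (enn2real (siegel_wt x)) = siegel_wt x" for x
    using siegel_wt_le[of x] by (intro ennreal_enn2real) (auto simp: indicator_def top.not_eq_extremum split: if_splits intro: order.strict_trans1)
  have meas: "measure J (B \<inter> D) = (\<integral>x. h x * indicator D x \<partial>lborel)" if [measurable]: "D \<in> sets borel" for D
  proof -
    have "emeasure J (B \<inter> D) = (\<integral>\<^sup>+x. ennreal (h x * indicator D x) \<partial>lborel)"
      using that by (subst emeasure_J) (auto intro!: nn_integral_cong simp: h_def indicator_def siegel_wt)
    then show ?thesis unfolding measure_def
      by (subst integral_eq_nn_integral) (auto simp: h_def)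
  qed
  have hint: "integrable lborel h"
  proof (rule integrableI_nonneg)
    have "(\<integral>\<^sup>+x. ennreal (h x) \<partial>lborel) \<le> vol"
      unfolding vol_def by (intro nn_integral_mono) (auto simp: h_def indicator_def siegel_wt)
    then show "(\<integral>\<^sup>+x. ennreal (h x) \<partial>lborel) < \<infinity>" using vol_finite by (rule le_less_trans)
  qed (auto simp: h_def)
  have "(\<lambda>k. measure J (B \<inter> T k -` C) - measure J (B \<inter> C)) \<longlonglongrightarrow> 0"
  proof (rule Lim_null_comparison)
    show "(\<lambda>k. \<integral>x. \<bar>h (T' k x) - h x\<bar> \<partial>lborel) \<longlonglongrightarrow> 0"
      by (rule L1_continuity[OF T(2) lim hint])
    show "\<forall>\<^sub>F k in sequentially. norm (measure J (B \<inter> T k -` C) - measure J (B \<inter> C)) \<le> (\<integral>x. \<bar>h (T' k x) - h x\<bar> \<partial>lborel)"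
    proof (rule always_eventually, rule allI)
      fix k
      have ihT: "integrable lborel (\<lambda>x. h (T' k x))" by (rule preserving_integrable[OF T(2) hint])
      have bnd: "integrable lborel (\<lambda>x. f x * indicator C x)" if "integrable lborel f" for f :: "aff \<Rightarrow> real"
        by (rule Bochner_Integration.integrable_bound[OF that]) (use that in \<open>auto simp: indicator_def\<close>)
      have "T k -` C \<inter> space borel \<in> sets borel" by measurable
      then have "measure J (B \<inter> T k -` C) = (\<integral>x. h x * indicator C (T k x) \<partial>lborel)"
        by (subst meas) (auto simp: indicator_vimage)
      also have "\<dots> = (\<integral>x. h (T' k (T k x)) * indicator C (T k x) \<partial>lborel)" by (simp add: T)
      also have "\<dots> = (\<integral>x. h (T' k x) * indicator C x \<partial>lborel)"
        by (rule preserving_integral[OF T(1), of "\<lambda>x. h (T' k x) * indicator C x"]) measurable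
      finally have "measure J (B \<inter> T k -` C) - measure J (B \<inter> C) = (\<integral>x. (h (T' k x) - h x) * indicator C x \<partial>lborel)"
        using bnd[OF ihT] bnd[OF hint] by (simp add: meas left_diff_distrib)
      then have "norm (measure J (B \<inter> T k -` C) - measure J (B \<inter> C)) = \<bar>\<integral>x. (h (T' k x) - h x) * indicator C x \<partial>lborel\<bar>" by simp
      also have "\<dots> \<le> (\<integral>x. \<bar>(h (T' k x) - h x) * indicator C x\<bar> \<partial>lborel)" by (rule integral_abs_bound)
      also have "\<dots> \<le> (\<integral>x. \<bar>h (T' k x) - h x\<bar> \<partial>lborel)"
        using ihT hint bnd[of "\<lambda>x. h (T' k x) - h x"] by (intro integral_mono) (auto simp: indicator_def)
      finally show "norm (measure J (B \<inter> T k -` C) - measure J (B \<inter> C)) \<le> (\<integral>x. \<bar>h (T' k x) - h x\<bar> \<partial>lborel)" .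
    qed
  qed
  then show ?thesis by (rule LIM_zero_cancel)
qed

section \<open>The Mautner phenomenon\<close>

definition lin :: "real \<Rightarrow> real \<Rightarrow> real \<Rightarrow> real \<Rightarrow> aff"
  where "lin a b c d = (((a, b), 0), ((c, d), 0))"

lemma coord_lin [simp]: "ca (lin a b c d) = a" "cb (lin a b c d) = b" "cc (lin a b c d) = c"
  "cd (lin a b c d) = d" "cp (lin a b c d) = 0" "cq (lin a b c d) = 0"
  by (simp_all add: lin_def)

lemma adet_lin [simp]: "adet (lin a b c d) = a * d - b * c" by (simp add: adet_coords)

lemma lin_mult: "lin a b c d \<odot> lin a' b' c' d' = lin (a * a' + b * c') (a * b' + b * d') (c * a' + d * c') (c * b' + d * d')"
  by (simp add: aff_eq_iff)

lemma lin_one: "lin 1 0 0 1 = aone" by (simp add: aff_eq_iff)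

lemma lin_mult_cong:
  "a * a' + b * c' = e \<Longrightarrow> a * b' + b * d' = f \<Longrightarrow> c * a' + d * c' = g \<Longrightarrow> c * b' + d * d' = h \<Longrightarrow>
    lin a b c d \<odot> (lin a' b' c' d' \<odot> x) = lin e f g h \<odot> x"
  by (simp add: amul_assoc[symmetric] lin_mult)

text \<open>Translation of the marked point in units of the square root of the covolume, so that it commutes with rescaling the
lattice and thus acts on lattices of area one.\<close>

definition tau :: "real \<Rightarrow> real \<Rightarrow> aff \<Rightarrow> aff"
  where "tau u v x = (((1, 0), sqrt (adet x) * u), ((0, 1), sqrt (adet x) * v)) \<odot> x"

lemma coord_tau [simp]: "ca (tau u v x) = ca x" "cb (tau u v x) = cb x" "cc (tau u v x) = cc x" "cd (tau u v x) = cd x"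
  "cp (tau u v x) = cp x + sqrt (adet x) * u" "cq (tau u v x) = cq x + sqrt (adet x) * v"
  by (simp_all add: tau_def)

lemma adet_tau [simp]: "adet (tau u v x) = adet x" by (simp add: adet_coords)

lemma tau_tau: "tau u v (tau u' v' x) = tau (u + u') (v + v') x"
  by (simp add: aff_eq_iff algebra_simps)

lemma tau_zero: "tau 0 0 x = x" by (simp add: aff_eq_iff)

lemma borel_measurable_tau: "tau u v \<in> borel_measurable borel"
  unfolding tau_def by measurable

text \<open>In column coordinates this is a skew product over the columns.\<close>

lemma good_map_tau: "good_map (tau u v)"
proof -
  note [measurable] = borel_measurable_tau
  have "preserving (tau u v)"
  proof (rule preservingI)
    fix f :: "aff \<Rightarrow> ennreal" assume [measurable]: "f \<in> borel_measurable borel"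
    define k where "k ef = sqrt (adet (ofcols (ef, (0, 0)))) *\<^sub>R (u, v)" for ef
    have "preserving (\<lambda>z. (fst z, snd z + k (fst z)))"
      using preserving_skew[OF preserving_id, of k] unfolding k_def by simp
    from preserving_nn_integral[OF this, of "\<lambda>z. f (ofcols z)"]
    have "(\<integral>\<^sup>+z. f (ofcols (fst z, snd z + k (fst z))) \<partial>lborel) = (\<integral>\<^sup>+z. f (ofcols z) \<partial>lborel)" by simp
    moreover have "ofcols (fst z, snd z + k (fst z)) = tau u v (ofcols z)" for z
    proof -
      obtain a c b d p q where "z = (((a, c), (b, d)), (p, q))" by (metis prod.collapse)
      then show ?thesis by (simp add: aff_eq_iff k_def adet_coords)
    qed
    moreover have push: "(\<integral>\<^sup>+z. g (ofcols z) \<partial>lborel) = (\<integral>\<^sup>+x. g x \<partial>lborel)"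
      if [measurable]: "g \<in> borel_measurable borel" for g :: "aff \<Rightarrow> ennreal"
    proof -
      have "(\<integral>\<^sup>+x. g x \<partial>lborel) = (\<integral>\<^sup>+x. g x \<partial>distr lborel borel ofcols)"
        by (simp add: lborel_ofcols)
      then show ?thesis by (subst (asm) nn_integral_distr) auto
    qed
    ultimately show "(\<integral>\<^sup>+x. f (tau u v x) \<partial>lborel) = (\<integral>\<^sup>+x. f x \<partial>lborel)"
      using push[of f] push[of "\<lambda>x. f (tau u v x)"] by simp
  qed (rule borel_measurable_tau)
  moreover have "tau u v (x \<odot> g) = tau u v x \<odot> g" if "g \<in> Gam" for x g
    using Gam_det[OF that] by (simp add: tau_def adet_mult amul_assoc)
  ultimately show ?thesis by (simp add: good_map_def)
qed

lemma tendsto_lin: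
  assumes "a \<longlonglongrightarrow> 1" "b \<longlonglongrightarrow> 0" "c \<longlonglongrightarrow> 0" "d \<longlonglongrightarrow> 1"
  shows "(\<lambda>k. lin (a k) (b k) (c k) (d k) \<odot> x) \<longlonglongrightarrow> x"
proof -
  have "(\<lambda>k. (((a k * ca x + b k * cc x, a k * cb x + b k * cd x), a k * cp x + b k * cq x + 0),
    ((c k * ca x + d k * cc x, c k * cb x + d k * cd x), c k * cp x + d k * cq x + 0))) \<longlonglongrightarrow>
    (((1 * ca x + 0 * cc x, 1 * cb x + 0 * cd x), 1 * cp x + 0 * cq x + 0),
    ((0 * ca x + 1 * cc x, 0 * cb x + 1 * cd x), 0 * cp x + 1 * cq x + 0))"
    by (intro tendsto_intros assms)
  moreover have "lin a b c d \<odot> x = (((a * ca x + b * cc x, a * cb x + b * cd x), a * cp x + b * cq x + 0),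
    ((c * ca x + d * cc x, c * cb x + d * cd x), c * cp x + d * cq x + 0))" for a b c d
    by (simp add: aff_eq_iff)
  moreover have "x = (((1 * ca x + 0 * cc x, 1 * cb x + 0 * cd x), 1 * cp x + 0 * cq x + 0),
    ((0 * ca x + 1 * cc x, 0 * cb x + 1 * cd x), 0 * cp x + 1 * cq x + 0))"
    by (simp add: aff_eq_iff)
  ultimately show ?thesis by simp
qed

lemma tendsto_tau:
  assumes "u \<longlonglongrightarrow> 0" "v \<longlonglongrightarrow> 0"
  shows "(\<lambda>k. tau (u k) (v k) x) \<longlonglongrightarrow> x"
proof -
  have "(\<lambda>k. (((ca x, cb x), cp x + sqrt (adet x) * u k), ((cc x, cd x), cq x + sqrt (adet x) * v k))) \<longlonglongrightarrow>
     (((ca x, cb x), cp x + sqrt (adet x) * 0), ((cc x, cd x), cq x + sqrt (adet x) * 0))"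
    by (intro tendsto_intros assms)
  moreover have "tau u v x = (((ca x, cb x), cp x + sqrt (adet x) * u), ((cc x, cd x), cq x + sqrt (adet x) * v))" for u v
    by (simp add: aff_eq_iff)
  moreover have "x = (((ca x, cb x), cp x + sqrt (adet x) * 0), ((cc x, cd x), cq x + sqrt (adet x) * 0))"
    by (simp add: aff_eq_iff)
  ultimately show ?thesis by simp
qed

lemma measure_J_vimage:
  "Gam_set B \<Longrightarrow> good_map T \<Longrightarrow> good_map T' \<Longrightarrow> (\<And>x. T' (T x) = x) \<Longrightarrow> measure J (T -` B) = measure J B"
  by (simp add: measure_def emeasure_J_vimage)

lemma measure_J_cong:
  assumes "B \<in> sets borel" "C \<in> sets borel" "AE x in lborel. x \<in> Yset \<longrightarrow> (x \<in> B \<longleftrightarrow> x \<in> C)"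
  shows "measure J B = measure J C"
proof -
  have "emeasure J B = emeasure J C"
    unfolding emeasure_J[OF assms(1)] emeasure_J[OF assms(2)]
    by (rule nn_integral_cong_AE, use assms(3) in eventually_elim)
       (use weight_outside[OF weight_siegel_wt] in \<open>auto simp: indicator_def\<close>)
  then show ?thesis by (simp add: measure_def)
qed

lemma funpow_inverse:
  fixes A A' :: "'a \<Rightarrow> 'a"
  assumes "\<And>x. A' (A x) = x" shows "(A' ^^ k) ((A ^^ k) x) = x"
proof (induction k arbitrary: x)
  case (Suc k)
  have "(A' ^^ Suc k) ((A ^^ Suc k) x) = (A' ^^ k) (A' (A ((A ^^ k) x)))"
    by (simp only: funpow_Suc_right[of k A'] o_def funpow.simps(2)[of k A])
  then show ?case using Suc assms by simp
qed simp

text \<open>If \<open>T\<close> is conjugate, by the \<open>k\<close>-th power of a map that keeps \<open>B\<close>, to a map \<open>m k\<close> close to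
the identity, then \<open>B\<close> overlaps its preimages under \<open>T\<close> and under \<open>m k\<close> equally much, and the latter
overlap tends to the measure of \<open>B\<close>.\<close>

lemma keeps_conjugate:
  assumes B: "Gam_set B"
    and A: "good_map A" "good_map A'" "\<And>x. A' (A x) = x" "\<And>x. A (A' x) = x" "keeps B A"
    and m: "\<And>k. good_map (m k)" "\<And>k. good_map (m' k)" "\<And>k x. m' k (m k x) = x" "\<And>x. (\<lambda>k. m' k x) \<longlonglongrightarrow> x"
    and T: "good_map T" "good_map T'" "\<And>x. T' (T x) = x"
    and conj: "\<And>k x. T x = (A' ^^ k) (m k ((A ^^ k) x))"
  shows "keeps B T"
proof (rule keepsI[OF B T])
  have eq: "measure J (B \<inter> T -` B) = measure J (B \<inter> m k -` B)" for k
  proof -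
    define P Q where "P = A ^^ k" and "Q = A' ^^ k"
    have P: "good_map P" "keeps B P" and Q: "good_map Q" "keeps B Q" and QP: "\<And>x. Q (P x) = x"
      unfolding P_def Q_def
      by (auto intro!: good_map_funpow keeps_funpow A funpow_inverse keeps_inverse[OF A(5) A(2)])
    have T_eq: "T x = Q (m k (P x))" for x using conj[of x k] by (simp add: P_def Q_def)
    have "Gam_set (B \<inter> m k -` B)" by (intro Gam_set_Int B Gam_set_vimage[OF B m(1)])
    note GSm = this Gam_set_vimage[OF this P(1)]
    have "measure J (B \<inter> T -` B) = measure J (P -` (B \<inter> m k -` B))"
    proof (rule measure_J_cong)
      show "B \<inter> T -` B \<in> sets borel" by (intro Gam_set_sets Gam_set_Int B Gam_set_vimage[OF B T(1)])
      show "P -` (B \<inter> m k -` B) \<in> sets borel" by (rule Gam_set_sets[OF GSm(2)])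
      have "AE x in lborel. m k (P x) \<in> Yset \<longrightarrow> (Q (m k (P x)) \<in> B \<longleftrightarrow> m k (P x) \<in> B)"
        using preserving_AE[OF preserving_comp[OF good_map_preserving[OF m(1)] good_map_preserving[OF P(1)]] Q(2)[unfolded keeps_def]] .
      then show "AE x in lborel. x \<in> Yset \<longrightarrow> (x \<in> B \<inter> T -` B \<longleftrightarrow> x \<in> P -` (B \<inter> m k -` B))"
        using P(2)[unfolded keeps_def]
        by eventually_elim (simp add: good_map_Yset[OF m(1)] good_map_Yset[OF P(1)] T_eq)
    qed
    also have "\<dots> = measure J (B \<inter> m k -` B)"
      by (rule measure_J_vimage[OF GSm(1) P(1) Q(1) QP])
    finally show ?thesis .
  qed
  have "(\<lambda>k. measure J (B \<inter> m k -` B)) \<longlonglongrightarrow> measure J (B \<inter> B)"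
    by (rule weak_continuity[OF Gam_set_sets[OF B] Gam_set_sets[OF B] good_map_preserving[OF m(1)] good_map_preserving[OF m(2)] m(3,4)])
  then have "(\<lambda>k::nat. measure J (B \<inter> T -` B)) \<longlonglongrightarrow> measure J B"
    unfolding eq[symmetric] by simp
  then show "measure J (B \<inter> T -` B) = measure J B"
    by (simp add: LIMSEQ_const_iff)
qed

lemma good_map_lin: "a * d - b * c = 1 \<Longrightarrow> good_map (\<lambda>x. lin a b c d \<odot> x)"
  by (rule good_map_left) simp

text \<open>The map \<open>u(2k) n(1/2k) u(-k)\<close> overlaps \<open>B\<close> with its preimage as much as \<open>n(1/2k)\<close> does, because \<open>B\<close> is
invariant under integer lower unipotents. It equals \<open>a n(1/k)\<close>, so in the limit \<open>a\<close> behaves like the identity.\<close>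

lemma keeps_diagonal:
  assumes B: "Gam_set B" and U: "\<And>x. lin 1 0 1 1 \<odot> x \<in> B \<longleftrightarrow> x \<in> B"
  shows "keeps B (\<lambda>x. lin (1/2) 0 0 2 \<odot> x)"
proof -
  have Un: "lin 1 0 (real n) 1 \<odot> x \<in> B \<longleftrightarrow> x \<in> B" for n x
  proof (induction n arbitrary: x)
    case 0 show ?case by (simp add: lin_one)
  next
    case (Suc n)
    have "lin 1 0 (real (Suc n)) 1 \<odot> x = lin 1 0 1 1 \<odot> (lin 1 0 (real n) 1 \<odot> x)"
      by (rule lin_mult_cong[symmetric]) simp_all
    then show ?case using Suc U by simp
  qed
  have Um: "lin 1 0 (- real n) 1 \<odot> x \<in> B \<longleftrightarrow> x \<in> B" for n x
  proof -
    have "lin 1 0 (real n) 1 \<odot> (lin 1 0 (- real n) 1 \<odot> x) = lin 1 0 0 1 \<odot> x"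
      by (rule lin_mult_cong) simp_all
    then show ?thesis using Un[of n "lin 1 0 (- real n) 1 \<odot> x"] by (simp add: lin_one)
  qed
  let ?a = "\<lambda>x. lin (1/2) 0 0 2 \<odot> x"
  \<comment> \<open>The integer of the identity is \<open>Suc k\<close>, which keeps the quotients defined.\<close>
  define s where "s k = 1 / real (Suc k)" for k
  let ?n = "\<lambda>t x. lin 1 t 0 1 \<odot> x"
  have n: "good_map (?n t)" "?n (- t) (?n t x) = x" for t x
  proof -
    show "good_map (?n t)" by (rule good_map_lin) simp
    have "?n (- t) (?n t x) = lin 1 0 0 1 \<odot> x" by (rule lin_mult_cong) simp_all
    then show "?n (- t) (?n t x) = x" by (simp add: lin_one)
  qed
  have a: "good_map ?a" by (rule good_map_lin) simp
  have aB: "Gam_set (?a -` B)" by (rule Gam_set_vimage[OF B a])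
  have s0: "s \<longlonglongrightarrow> 0" unfolding s_def using LIMSEQ_Suc[OF lim_1_over_n] by simp
  have s1: "(\<lambda>k. s k / 2) \<longlonglongrightarrow> 0" using tendsto_divide[OF s0 tendsto_const[of 2]] by simp
  have "(\<lambda>k. measure J (B \<inter> ?n (s k) -` (?a -` B))) \<longlonglongrightarrow> measure J (B \<inter> ?a -` B)"
    by (rule weak_continuity[OF Gam_set_sets[OF B] Gam_set_sets[OF aB] good_map_preserving[OF n(1)] good_map_preserving[OF n(1)] n(2)])
       (intro tendsto_lin tendsto_const tendsto_minus[OF s0, simplified])
  moreover have "measure J (B \<inter> ?n (s k) -` (?a -` B)) = measure J (B \<inter> ?n (s k / 2) -` B)" for k
  proof -
    let ?k = "Suc k"
    let ?u = "\<lambda>x. lin 1 0 (- real ?k) 1 \<odot> x"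
    have id: "?a (?n (s k) x) = lin 1 0 (real (2 * ?k)) 1 \<odot> (?n (s k / 2) (?u x))" for x
    proof -
      have "?n (s k / 2) (?u x) = lin (1/2) (s k / 2) (- real ?k) 1 \<odot> x"
        by (rule lin_mult_cong) (simp_all add: s_def field_simps)
      also have "lin 1 0 (real (2 * ?k)) 1 \<odot> (lin (1/2) (s k / 2) (- real ?k) 1 \<odot> x) = lin (1/2) (s k / 2) 0 2 \<odot> x"
        by (rule lin_mult_cong) (simp_all add: s_def field_simps)
      moreover have "?a (?n (s k) x) = lin (1/2) (s k / 2) 0 2 \<odot> x"
        by (rule lin_mult_cong) simp_all
      ultimately show ?thesis by simp
    qed
    have "B \<inter> ?n (s k) -` (?a -` B) = ?u -` (B \<inter> ?n (s k / 2) -` B)"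
      using Um[of ?k] unfolding vimage_def mem_Collect_eq id Un by auto
    also have "measure J \<dots> = measure J (B \<inter> ?n (s k / 2) -` B)"
    proof (rule measure_J_vimage)
      show "Gam_set (B \<inter> ?n (s k / 2) -` B)" by (intro Gam_set_Int B Gam_set_vimage[OF B n(1)])
      show "good_map ?u" by (rule good_map_lin) simp
      show "good_map (\<lambda>x. lin 1 0 (real ?k) 1 \<odot> x)" by (rule good_map_lin) simp
      fix x
      have "lin 1 0 (real ?k) 1 \<odot> ?u x = lin 1 0 0 1 \<odot> x" by (rule lin_mult_cong) simp_all
      then show "lin 1 0 (real ?k) 1 \<odot> ?u x = x" by (simp add: lin_one)
    qed
    finally show ?thesis .
  qed
  moreover have "(\<lambda>k. measure J (B \<inter> ?n (s k / 2) -` B)) \<longlonglongrightarrow> measure J (B \<inter> B)"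
    by (rule weak_continuity[OF Gam_set_sets[OF B] Gam_set_sets[OF B] good_map_preserving[OF n(1)] good_map_preserving[OF n(1)] n(2)])
       (intro tendsto_lin tendsto_const tendsto_minus[OF s1, simplified])
  ultimately have eq: "measure J (B \<inter> ?a -` B) = measure J B"
    by (simp add: LIMSEQ_unique)
  show ?thesis
  proof (rule keepsI[OF B a _ _ eq])
    show "good_map (\<lambda>x. lin 2 0 0 (1/2) \<odot> x)" by (rule good_map_lin) simp
    fix x
    have "lin 2 0 0 (1/2) \<odot> ?a x = lin 1 0 0 1 \<odot> x" by (rule lin_mult_cong) simp_all
    then show "lin 2 0 0 (1/2) \<odot> ?a x = x" by (simp add: lin_one)
  qed
qed

lemma lin_diag_funpow: "((\<lambda>x. lin a 0 0 d \<odot> x) ^^ k) x = lin (a ^ k) 0 0 (d ^ k) \<odot> x"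
proof (induction k)
  case 0 show ?case by (simp add: lin_one)
next
  case (Suc k)
  show ?case using Suc by simp (rule lin_mult_cong, simp_all)
qed

lemma lin_tau: "lin a b c d \<odot> tau u v x = tau (a * u + b * v) (c * u + d * v) (lin a b c d \<odot> x)" if "a * d - b * c = 1"
  using that by (simp add: aff_eq_iff adet_mult algebra_simps)

text \<open>The diagonal map contracts the upper unipotents and the horizontal translations, and
its inverse contracts the lower unipotents and the vertical translations.\<close>

lemma mautner:
  assumes B: "Gam_set B" and U: "\<And>x. lin 1 0 1 1 \<odot> x \<in> B \<longleftrightarrow> x \<in> B"
  shows "keeps B (\<lambda>x. lin 1 t 0 1 \<odot> x)" "keeps B (\<lambda>x. lin 1 0 t 1 \<odot> x)" "keeps B (tau u v)"
proof -
  let ?a = "\<lambda>x. lin (1/2) 0 0 2 \<odot> x" and ?a' = "\<lambda>x. lin 2 0 0 (1/2) \<odot> x"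
  let ?n = "\<lambda>t x. lin 1 t 0 1 \<odot> x" and ?u = "\<lambda>t x. lin 1 0 t 1 \<odot> x"
  have a: "good_map ?a" "good_map ?a'" by (rule good_map_lin, simp)+
  have inv: "?a' (?a x) = x" "?a (?a' x) = x" for x
  proof -
    have "?a' (?a x) = lin 1 0 0 1 \<odot> x" "?a (?a' x) = lin 1 0 0 1 \<odot> x" by (rule lin_mult_cong, simp_all)+
    then show "?a' (?a x) = x" "?a (?a' x) = x" by (simp_all add: lin_one)
  qed
  have ka: "keeps B ?a" by (rule keeps_diagonal[OF B U])
  have ka': "keeps B ?a'" by (rule keeps_inverse[OF ka a(2) inv(2)])
  have n: "good_map (?n t)" "?n (- t) (?n t x) = x" and u: "good_map (?u t)" "?u (- t) (?u t x) = x" for t x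
  proof -
    show "good_map (?n t)" "good_map (?u t)" by (rule good_map_lin, simp)+
    have "?n (- t) (?n t x) = lin 1 0 0 1 \<odot> x" "?u (- t) (?u t x) = lin 1 0 0 1 \<odot> x" by (rule lin_mult_cong, simp_all)+
    then show "?n (- t) (?n t x) = x" "?u (- t) (?u t x) = x" by (simp_all add: lin_one)
  qed
  have t: "tau (- u) (- v) (tau u v x) = x" for u v x by (simp add: tau_tau tau_zero)
  have lim4: "(\<lambda>k. - (c * (1/4) ^ k)) \<longlonglongrightarrow> 0" and lim2: "(\<lambda>k. - (c * (1/2) ^ k)) \<longlonglongrightarrow> 0" for c :: real
    using tendsto_minus[OF tendsto_mult_right_zero[OF LIMSEQ_power_zero[of "1/4::real"], of c]]
      tendsto_minus[OF tendsto_mult_right_zero[OF LIMSEQ_power_zero[of "1/2::real"], of c]] by simp_all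
  have pw: "(1/2::real) ^ k * 2 ^ k = 1" "(2::real) ^ k * (1/2) ^ k = 1" "(1/2::real) ^ k * (1/2) ^ k = (1/4) ^ k" for k
    by (simp_all add: power_mult_distrib[symmetric])
  show "keeps B (?n t)"
  proof (rule keeps_conjugate[OF B a inv ka, where m="\<lambda>k. ?n (t * (1/4) ^ k)" and m'="\<lambda>k. ?n (- (t * (1/4) ^ k))" and T'="?n (- t)"])
    fix k x
    have "?n (t * (1/4) ^ k) (lin ((1/2) ^ k) 0 0 (2 ^ k) \<odot> x) = lin ((1/2) ^ k) (t * (1/4) ^ k * 2 ^ k) 0 (2 ^ k) \<odot> x"
      by (rule lin_mult_cong) simp_all
    also have "lin (2 ^ k) 0 0 ((1/2) ^ k) \<odot> \<dots> = ?n t x"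
    proof (rule lin_mult_cong)
      have "(2::real) ^ k * (t * (1/4) ^ k * 2 ^ k) = t * ((2 * (1/4) * 2) ^ k)"
        by (simp only: power_mult_distrib mult_ac)
      then show "2 ^ k * (t * (1/4) ^ k * 2 ^ k) + 0 * 2 ^ k = t" by simp
    qed (simp_all add: pw)
    finally show "?n t x = (?a' ^^ k) (?n (t * (1/4) ^ k) ((?a ^^ k) x))"
      unfolding lin_diag_funpow by simp
  qed (intro n tendsto_lin tendsto_const lim4)+
  show "keeps B (?u t)"
  proof (rule keeps_conjugate[OF B a(2,1) inv(2,1) ka', where m="\<lambda>k. ?u (t * (1/4) ^ k)" and m'="\<lambda>k. ?u (- (t * (1/4) ^ k))" and T'="?u (- t)"])
    fix k x
    have "?u (t * (1/4) ^ k) (lin (2 ^ k) 0 0 ((1/2) ^ k) \<odot> x) = lin (2 ^ k) 0 (t * (1/4) ^ k * 2 ^ k) ((1/2) ^ k) \<odot> x"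
      by (rule lin_mult_cong) simp_all
    also have "lin ((1/2) ^ k) 0 0 (2 ^ k) \<odot> \<dots> = ?u t x"
    proof (rule lin_mult_cong)
      have "(2::real) ^ k * (t * (1/4) ^ k * 2 ^ k) = t * ((2 * (1/4) * 2) ^ k)"
        by (simp only: power_mult_distrib mult_ac)
      then show "0 * 2 ^ k + 2 ^ k * (t * (1/4) ^ k * 2 ^ k) = t" by simp
    qed (simp_all add: pw)
    finally show "?u t x = (?a ^^ k) (?u (t * (1/4) ^ k) ((?a' ^^ k) x))"
      unfolding lin_diag_funpow by simp
  qed (intro u tendsto_lin tendsto_const lim4)+
  have "keeps B (tau u 0)"
  proof (rule keeps_conjugate[OF B a inv ka, where m="\<lambda>k. tau (u * (1/2) ^ k) 0" and m'="\<lambda>k. tau (- (u * (1/2) ^ k)) 0" and T'="tau (- u) 0"])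
    fix k x
    have "(?a' ^^ k) (tau (u * (1/2) ^ k) 0 ((?a ^^ k) x)) = tau (2 ^ k * (u * (1/2) ^ k)) 0 ((?a' ^^ k) ((?a ^^ k) x))"
      unfolding lin_diag_funpow by (subst lin_tau) (simp_all add: pw)
    also have "(?a' ^^ k) ((?a ^^ k) x) = x" by (rule funpow_inverse[where A="?a" and A'="?a'", OF inv(1)])
    also have "2 ^ k * (u * (1/2) ^ k) = u" using pw(2)[of k] by (simp add: algebra_simps)
    finally show "tau u 0 x = (?a' ^^ k) (tau (u * (1/2) ^ k) 0 ((?a ^^ k) x))" by simp
  qed (use t[of _ 0] in \<open>auto intro!: good_map_tau tendsto_tau tendsto_const lim2\<close>)
  moreover have "keeps B (tau 0 v)"
  proof (rule keeps_conjugate[OF B a(2,1) inv(2,1) ka', where m="\<lambda>k. tau 0 (v * (1/2) ^ k)" and m'="\<lambda>k. tau 0 (- (v * (1/2) ^ k))" and T'="tau 0 (- v)"])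
    fix k x
    have "(?a ^^ k) (tau 0 (v * (1/2) ^ k) ((?a' ^^ k) x)) = tau 0 (2 ^ k * (v * (1/2) ^ k)) ((?a ^^ k) ((?a' ^^ k) x))"
      unfolding lin_diag_funpow by (subst lin_tau) (simp_all add: pw)
    also have "(?a ^^ k) ((?a' ^^ k) x) = x" by (rule funpow_inverse[where A="?a'" and A'="?a", OF inv(2)])
    also have "2 ^ k * (v * (1/2) ^ k) = v" using pw(2)[of k] by (simp add: algebra_simps)
    finally show "tau 0 v x = (?a ^^ k) (tau 0 (v * (1/2) ^ k) ((?a' ^^ k) x))" by simp
  qed (use t[of 0] in \<open>auto intro!: good_map_tau tendsto_tau tendsto_const lim2\<close>)
  ultimately have "keeps B (\<lambda>x. tau u 0 (tau 0 v x))"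
    by (rule keeps_comp[OF _ _ good_map_tau])
  then show "keeps B (tau u v)" by (simp add: tau_tau)
qed

lemma keeps_lin:
  assumes B: "Gam_set B" and U: "\<And>x. lin 1 0 1 1 \<odot> x \<in> B \<longleftrightarrow> x \<in> B" and det: "a * d - b * c = 1"
  shows "keeps B (\<lambda>x. lin a b c d \<odot> x)"
proof -
  note n = mautner(1)[OF B U] and u = mautner(2)[OF B U]
  have gm: "good_map (\<lambda>x. lin 1 t 0 1 \<odot> x)" "good_map (\<lambda>x. lin 1 0 t 1 \<odot> x)" for t
    by (rule good_map_lin, simp)+
  have *: "keeps B (\<lambda>x. lin a b c d \<odot> x)" if det: "a * d - b * c = 1" and b: "b \<noteq> 0" for a b c d
  proof -
    have "keeps B (\<lambda>x. lin 1 0 ((d - 1) / b) 1 \<odot> (lin 1 b 0 1 \<odot> (lin 1 0 ((a - 1) / b) 1 \<odot> x)))"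
      by (rule keeps_comp[OF u keeps_comp[OF n u gm(2)] good_map_comp[OF gm(1,2)]])
    moreover have "lin 1 0 ((d - 1) / b) 1 \<odot> (lin 1 b 0 1 \<odot> (lin 1 0 ((a - 1) / b) 1 \<odot> x)) = lin a b c d \<odot> x" for x
    proof -
      have "lin 1 b 0 1 \<odot> (lin 1 0 ((a - 1) / b) 1 \<odot> x) = lin a b ((a - 1) / b) 1 \<odot> x"
        using b by (intro lin_mult_cong) simp_all
      also have "lin 1 0 ((d - 1) / b) 1 \<odot> \<dots> = lin a b c d \<odot> x"
        using b det by (intro lin_mult_cong) (simp_all add: field_simps)
      finally show ?thesis .
    qed
    ultimately show ?thesis by simp
  qed
  show ?thesis
  proof (cases "b = 0")
    case True
    then have "a \<noteq> 0" using det by auto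
    \<comment> \<open>A shear on the right makes the upper right entry nonzero.\<close>
    then have "keeps B (\<lambda>x. lin a a c (c + d) \<odot> x)" using * True det by (simp add: algebra_simps)
    from keeps_comp[OF this n[of "-1"] gm(1)]
    have "keeps B (\<lambda>x. lin a a c (c + d) \<odot> (lin 1 (- 1) 0 1 \<odot> x))" .
    moreover have "lin a a c (c + d) \<odot> (lin 1 (- 1) 0 1 \<odot> x) = lin a b c d \<odot> x" for x
      by (rule lin_mult_cong) (simp_all add: True)
    ultimately show ?thesis by simp
  qed (use * det in blast)
qed

section \<open>Ergodicity\<close>

lemma coord_scaleR [simp]: "ca (r *\<^sub>R x) = r * ca x" "cb (r *\<^sub>R x) = r * cb x" "cc (r *\<^sub>R x) = r * cc x"
  "cd (r *\<^sub>R x) = r * cd x" "cp (r *\<^sub>R x) = r * cp x" "cq (r *\<^sub>R x) = r * cq x"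
  by (simp_all add: coord_defs)

lemma coord_add [simp]: "ca (x + y) = ca x + ca y" "cb (x + y) = cb x + cb y" "cc (x + y) = cc x + cc y"
  "cd (x + y) = cd x + cd y" "cp (x + y) = cp x + cp y" "cq (x + y) = cq x + cq y"
  by (simp_all add: coord_defs)

lemma adet_scaleR: "adet (r *\<^sub>R x) = r\<^sup>2 * adet x"
  by (simp add: adet_coords power2_eq_square algebra_simps)

lemma lin_scaleR: "lin a b c d \<odot> (r *\<^sub>R x) = r *\<^sub>R (lin a b c d \<odot> x)"
  by (simp add: aff_eq_iff algebra_simps)

lemma tau_scaleR: "0 \<le> r \<Longrightarrow> tau u v (r *\<^sub>R x) = r *\<^sub>R tau u v x"
  by (simp add: aff_eq_iff adet_scaleR real_sqrt_mult algebra_simps)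

lemma AE_linear_inverse:
  fixes f g :: "'a::euclidean_space \<Rightarrow> 'a"
  assumes g: "linear g" "\<And>x. g (f x) = x" and P: "AE x in lborel. P x"
  shows "AE x in lborel. P (f x)"
proof -
  obtain N where N: "N \<in> null_sets lborel" "{x. \<not> P x} \<subseteq> N"
    using P by (auto simp: eventually_ae_filter)
  then have "negligible N" by (simp add: negligible_iff_null_sets null_sets_completionI)
  then have "negligible (g ` N)"
    by (rule negligible_differentiable_image_negligible[OF order_refl])
       (intro linear_imp_differentiable_on g)
  moreover have "{x. \<not> P (f x)} \<subseteq> g ` N"
    using N(2) g(2) by (metis (mono_tags, lifting) image_eqI mem_Collect_eq subset_iff)
  ultimately have "AE x in lebesgue. P (f x)"
    by (intro AE_I'[of "g ` N"]) (auto simp: negligible_iff_null_sets)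
  then show ?thesis by (simp add: AE_completion_iff)
qed

lemma AE_scaleR:
  fixes P :: "'a::euclidean_space \<Rightarrow> bool"
  assumes "r \<noteq> 0" "AE x in lborel. P x" shows "AE x in lborel. P (r *\<^sub>R x)"
proof (rule AE_linear_inverse[OF _ _ assms(2)])
  show "linear (\<lambda>x::'a. (1 / r) *\<^sub>R x)" by (simp add: linear_scale_self linear_scaleR)
qed (use assms in simp)

text \<open>The cone is the union of countably many rescaled copies of \<open>Yset\<close>.\<close>

lemma AE_cone:
  assumes Q: "AE x in lborel. x \<in> Yset \<longrightarrow> Q x" and sc: "\<And>r x. r > 0 \<Longrightarrow> Q (r *\<^sub>R x) \<longleftrightarrow> Q x"
  shows "AE x in lborel. adet x > 0 \<longrightarrow> Q x"
proof -
  have "AE x in lborel. \<forall>n. (1 / real (Suc n)) *\<^sub>R x \<in> Yset \<longrightarrow> Q ((1 / real (Suc n)) *\<^sub>R x)"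
    by (subst AE_all_countable, intro allI AE_scaleR[OF _ Q]) simp
  then show ?thesis
  proof eventually_elim
    fix x
    assume *: "\<forall>n. (1 / real (Suc n)) *\<^sub>R x \<in> Yset \<longrightarrow> Q ((1 / real (Suc n)) *\<^sub>R x)"
    show "adet x > 0 \<longrightarrow> Q x"
    proof
      assume x: "adet x > 0"
      obtain n where n: "adet x \<le> real n" using real_arch_simple by blast
      have "adet x \<le> (real (Suc n))\<^sup>2"
      proof -
        have "real n \<le> real (Suc n) * 1" by simp
        also have "\<dots> \<le> real (Suc n) * real (Suc n)" by (intro mult_left_mono) auto
        finally show ?thesis using n by (simp add: power2_eq_square)
      qed
      then have "(1 / real (Suc n)) *\<^sub>R x \<in> Yset"
        using x by (simp add: Yset_def adet_scaleR power_one_over field_simps)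
      then have "Q ((1 / real (Suc n)) *\<^sub>R x)" using * by blast
      then show "Q x" by (simp add: sc del: of_nat_Suc)
    qed
  qed
qed

lemma keeps_everywhere:
  assumes T: "keeps B T" "\<And>r x. r > 0 \<Longrightarrow> T (r *\<^sub>R x) = r *\<^sub>R T x"
    and sc: "\<And>r x. r > 0 \<Longrightarrow> r *\<^sub>R x \<in> B \<longleftrightarrow> x \<in> B"
  shows "AE x in lborel. adet x > 0 \<longrightarrow> (T x \<in> B \<longleftrightarrow> x \<in> B)"
  using T(1)[unfolded keeps_def] by (rule AE_cone) (simp add: T sc)

text \<open>For positive determinants of \<open>y\<close>, this composes a rescaling, a translation \<open>tau\<close> and a linear map of determinant one
(\<open>scact_eq\<close>); for fixed \<open>x\<close> it is linear in \<open>y\<close>.\<close>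

definition scact :: "aff \<Rightarrow> aff \<Rightarrow> aff"
  where "scact y x = (((ca y, cb y), sqrt (adet x) * cp y), ((cc y, cd y), sqrt (adet x) * cq y)) \<odot> x"

lemma scact_measurable: "(\<lambda>z. scact (fst z) (snd z)) \<in> borel_measurable borel"
  unfolding scact_def amul_conv adet_conv coord_defs
  by (intro borel_measurable_continuous_onI continuous_intros)

lemma scact_eq:
  assumes y: "adet y > 0"
  shows "scact y x = sqrt (adet y) *\<^sub>R tau (cp y / sqrt (adet y)) (cq y / sqrt (adet y))
    (lin (ca y / sqrt (adet y)) (cb y / sqrt (adet y)) (cc y / sqrt (adet y)) (cd y / sqrt (adet y)) \<odot> x)"
proof -
  define s where "s = sqrt (adet y)"
  have s: "s \<noteq> 0" "s * s = adet y" using y by (simp_all add: s_def)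
  have "adet (lin (ca y / s) (cb y / s) (cc y / s) (cd y / s) \<odot> x) = adet x"
  proof -
    \<comment> \<open>Dividing by the square root of the determinant makes the linear part unimodular.\<close>
    have "ca y / s * (cd y / s) - cb y / s * (cc y / s) = adet y / (s * s)"
      by (simp add: adet_coords diff_divide_distrib)
    also have "\<dots> = 1" using s(1) by (simp add: s(2)[symmetric])
    finally show ?thesis by (simp add: adet_mult)
  qed
  then show ?thesis using s unfolding s_def[symmetric]
    by (simp add: aff_eq_iff scact_def field_simps)
qed

text \<open>For every \<open>y\<close>, membership in \<open>B\<close> is unchanged by \<open>scact y\<close> at almost every \<open>x\<close>. By Fubini's
theorem there is one point \<open>x0\<close> for which this holds at almost every \<open>y\<close>, and
\<open>scact y x0\<close> then covers almost the whole cone, with null sets going to null sets.\<close>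

theorem ergodic_dichotomy:
  assumes B: "Gam_set B" and U: "\<And>x. lin 1 0 1 1 \<odot> x \<in> B \<longleftrightarrow> x \<in> B"
    and sc: "\<And>r x. r > 0 \<Longrightarrow> r *\<^sub>R x \<in> B \<longleftrightarrow> x \<in> B"
  shows "(AE x in lborel. adet x > 0 \<longrightarrow> x \<in> B) \<or> (AE x in lborel. adet x > 0 \<longrightarrow> x \<notin> B)"
proof -
  have [measurable]: "B \<in> sets borel" using B by (rule Gam_set_sets)
  note [measurable] = scact_measurable
  define P where "P y x \<longleftrightarrow> (adet y > 0 \<and> adet x > 0 \<longrightarrow> (scact y x \<in> B \<longleftrightarrow> x \<in> B))" for y x
  have "AE x in lborel. P y x" for y
  proof (cases "adet y > 0")
    case True
    define s where "s = sqrt (adet y)"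
    have s: "s > 0" "s * s = adet y" using True by (simp_all add: s_def)
    let ?l = "\<lambda>x. lin (ca y / s) (cb y / s) (cc y / s) (cd y / s) \<odot> x"
    have det: "ca y / s * (cd y / s) - cb y / s * (cc y / s) = 1"
      using s True by (simp add: diff_divide_distrib[symmetric] adet_coords)
    have "keeps B (\<lambda>x. tau (cp y / s) (cq y / s) (?l x))"
      by (rule keeps_comp[OF mautner(3)[OF B U] keeps_lin[OF B U det] good_map_lin[OF det]])
    from keeps_everywhere[OF this _ sc]
    have "AE x in lborel. adet x > 0 \<longrightarrow> (tau (cp y / s) (cq y / s) (?l x) \<in> B \<longleftrightarrow> x \<in> B)"
      by (simp add: lin_scaleR tau_scaleR)
    then show ?thesis
      unfolding P_def scact_eq[OF True] s_def[symmetric] 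
      by eventually_elim (simp add: sc[OF s(1)])
  qed (simp add: P_def)
  then have "AE y in lborel. AE x in lborel. P y x" by simp
  then have AE: "AE x in lborel. AE y in lborel. P y x"
  proof (subst (asm) lborel_pair.AE_commute)
    have "Measurable.pred borel (\<lambda>z. P (fst z) (snd z))"
      unfolding P_def by measurable
    then have "Measurable.pred (lborel \<Otimes>\<^sub>M lborel) (\<lambda>z. P (fst z) (snd z))"
      by (simp add: lborel_prod)
    then show "{z \<in> space (lborel \<Otimes>\<^sub>M lborel). P (fst z) (snd z)} \<in> sets (lborel \<Otimes>\<^sub>M lborel)"
      by (rule pred_def[THEN iffD1])
  qed
  have "\<exists>x0. adet x0 > 0 \<and> (AE y in lborel. P y x0)"
  proof (rule ccontr)
    assume "\<not> ?thesis"
    then have "AE x in lborel. \<not> 0 < adet x" using AE by (rule_tac AE_mp[OF AE]) auto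
    then have "emeasure lborel {x. 0 < adet x} = 0"
      by (subst (asm) AE_iff_measurable[OF _ refl]) (auto simp: not_le)
    moreover have "open {x. 0 < adet x}"
      unfolding adet_conv by (intro open_Collect_less continuous_intros)
    moreover have "aone \<in> {x. 0 < adet x}" by simp
    ultimately show False using open_not_null[of "{x. 0 < adet x}"] by blast
  qed
  then obtain x0 where x0: "adet x0 > 0" and AE0: "AE y in lborel. P y x0" by blast
  define r where "r = sqrt (adet x0)"
  have r: "r > 0" using x0 by (simp add: r_def)
  define pull where "pull z = (let w = z \<odot> ainv x0 in (((ca w, cb w), cp w / r), ((cc w, cd w), cq w / r)))" for z
  have "AE z in lborel. P (pull z) x0"
  proof (rule AE_linear_inverse[OF _ _ AE0])
    show "linear (\<lambda>y. scact y x0)"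
      by (rule linearI) (simp_all add: aff_eq_iff scact_def algebra_simps)
    fix z
    have "scact (pull z) x0 = (z \<odot> ainv x0) \<odot> x0"
      using r by (simp add: scact_def pull_def Let_def r_def[symmetric] aff_eq_iff)
    then show "scact (pull z) x0 = z" using x0 by (simp add: amul_assoc amul_ainv_left)
  qed
  moreover have "P (pull z) x0 \<longleftrightarrow> (adet z > 0 \<longrightarrow> (z \<in> B \<longleftrightarrow> x0 \<in> B))" for z
  proof -
    have "scact (pull z) x0 = (z \<odot> ainv x0) \<odot> x0"
      using r by (simp add: scact_def pull_def Let_def r_def[symmetric] aff_eq_iff)
    then have "scact (pull z) x0 = z" using x0 by (simp add: amul_assoc amul_ainv_left)
    moreover have "adet (pull z) = adet z / adet x0"
    proof -
      have "adet (pull z) = adet (z \<odot> ainv x0)" by (simp only: adet_coords) (simp add: pull_def Let_def)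
      then show ?thesis by (simp add: adet_mult adet_ainv)
    qed
    ultimately show ?thesis using x0 by (simp add: P_def zero_less_divide_iff)
  qed
  ultimately have "AE z in lborel. adet z > 0 \<longrightarrow> (z \<in> B \<longleftrightarrow> x0 \<in> B)" by simp
  then show ?thesis by (cases "x0 \<in> B") simp_all
qed

section \<open>The pointwise ergodic theorem\<close>

locale ergodic_system = prob_space M for M :: "'a measure" +
  fixes T :: "'a \<Rightarrow> 'a"
  assumes T_measurable [measurable]: "T \<in> measurable M M"
    and T_preserves: "distr M M T = M"
    and ergodic: "\<And>E. E \<in> sets M \<Longrightarrow> T -` E \<inter> space M = E \<Longrightarrow> prob E = 0 \<or> prob E = 1"
begin

lemma T_integral:
  fixes f :: "'a \<Rightarrow> real" assumes "f \<in> borel_measurable M"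
  shows "(\<integral>x. f (T x) \<partial>M) = (\<integral>x. f x \<partial>M)"
  using integral_distr[OF T_measurable assms] by (simp add: T_preserves)

lemma T_integrable:
  fixes f :: "'a \<Rightarrow> real" assumes "integrable M f"
  shows "integrable M (\<lambda>x. f (T x))"
  using integrable_distr_eq[OF T_measurable borel_measurable_integrable[OF assms]] assms by (simp add: T_preserves)

lemma T_AE: "AE x in M. P x \<Longrightarrow> AE x in M. P (T x)"
  by (rule AE_distrD[OF T_measurable]) (subst T_preserves)

lemma T_space: "x \<in> space M \<Longrightarrow> T x \<in> space M"
  using T_measurable by (rule measurable_space)

text \<open>The largest of the ergodic sums of lengths \<open>0\<close> to \<open>n\<close>, written so that its relation to the
dynamics is explicit.\<close>

primrec runmax :: "('a \<Rightarrow> real) \<Rightarrow> nat \<Rightarrow> 'a \<Rightarrow> real"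
  where "runmax f 0 x = 0" | "runmax f (Suc n) x = max 0 (f x + runmax f n (T x))"

lemma runmax_nonneg: "0 \<le> runmax f n x"
  by (cases n) simp_all

lemma runmax_mono: "runmax f n x \<le> runmax f (Suc n) x"
proof (induction n arbitrary: x)
  case (Suc n)
  have "max 0 (f x + runmax f n (T x)) \<le> max 0 (f x + runmax f (Suc n) (T x))"
    by (intro max.mono add_left_mono order_refl Suc)
  then show ?case by (simp only: runmax.simps(2))
qed simp

lemma runmax_incseq: "m \<le> n \<Longrightarrow> runmax f m x \<le> runmax f n x"
  using lift_Suc_mono_le[of "\<lambda>n. runmax f n x"] runmax_mono by blast

lemma sum_le_runmax: "(\<Sum>k<n. f ((T ^^ k) x)) \<le> runmax f n x"
proof (induction n arbitrary: x)
  case (Suc n)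
  have "(\<Sum>k<Suc n. f ((T ^^ k) x)) = f x + (\<Sum>k<n. f ((T ^^ k) (T x)))"
    by (simp add: sum.lessThan_Suc_shift funpow_Suc_right del: funpow.simps sum.lessThan_Suc) 
  also have "\<dots> \<le> runmax f (Suc n) x" using Suc[of "T x"] by simp
  finally show ?case .
qed simp

lemma runmax_integrable: "integrable M f \<Longrightarrow> integrable M (runmax f n)"
  by (induction n) (auto intro!: T_integrable Bochner_Integration.integrable_add Bochner_Integration.integrable_max simp: runmax.simps[abs_def])

text \<open>The set where the ergodic sums are unbounded is invariant. If it had full measure, then
\<open>runmax f (Suc n) - runmax f n \<circ> T\<close> would converge to \<open>f\<close> almost everywhere, while its integral is
nonnegative because \<open>T\<close> preserves the measure and \<open>runmax\<close> increases in \<open>n\<close>.\<close>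

lemma sums_bounded_above:
  fixes f :: "'a \<Rightarrow> real"
  assumes f: "integrable M f" and neg: "(\<integral>x. f x \<partial>M) < 0"
  shows "AE x in M. \<exists>C. \<forall>n. (\<Sum>k<n. f ((T ^^ k) x)) \<le> C"
proof -
  note int = runmax_integrable[OF f]
  have [measurable]: "f \<in> borel_measurable M" "runmax f n \<in> borel_measurable M" for n
    using f int[of n] by (auto intro: borel_measurable_integrable)
  define E where "E = {x\<in>space M. \<forall>C::nat. \<exists>n. real C < runmax f n x}"
  have E: "E \<in> sets M" unfolding E_def by measurable
  have "T x \<in> E \<longleftrightarrow> x \<in> E" if "x \<in> space M" for x
  proof
    assume TE: "T x \<in> E"
    have "\<exists>n. real C < runmax f n x" for C :: nat
    proof -
      obtain D :: nat where D: "real C - f x \<le> D" using real_arch_simple by blast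
      obtain n where "real D < runmax f n (T x)" using TE by (auto simp: E_def)
      then have "real C < runmax f (Suc n) x" using D by simp
      then show ?thesis by blast
    qed
    then show "x \<in> E" using that by (simp add: E_def)
  next
    assume xE: "x \<in> E"
    have "\<exists>n. real C < runmax f n (T x)" for C :: nat
    proof -
      obtain D :: nat where D: "real C + \<bar>f x\<bar> \<le> D" using real_arch_simple by blast
      obtain n where n: "real D < runmax f n x" using xE by (auto simp: E_def)
      then obtain m where "n = Suc m" by (cases n) auto
      then have "real C < runmax f m (T x)" using D n by auto
      then show ?thesis by blast
    qed
    then show "T x \<in> E" using that T_space by (simp add: E_def)
  qed
  then have "T -` E \<inter> space M = E" using sets.sets_into_space[OF E] by auto
  from ergodic[OF E this] show ?thesis
  proof
    assume "prob E = 0"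
    then have "AE x in M. x \<notin> E" using E by (subst AE_iff_measurable[OF E]) (auto simp: emeasure_eq_measure dest: sets.sets_into_space)
    then show ?thesis
    proof (rule AE_mp, intro AE_I2 impI)
      fix x assume "x \<in> space M" "x \<notin> E"
      then obtain C :: nat where "\<And>n. runmax f n x \<le> C" by (auto simp: E_def not_less)
      then have "\<forall>n. (\<Sum>k<n. f ((T ^^ k) x)) \<le> C" using sum_le_runmax order_trans by blast
      then show "\<exists>C. \<forall>n. (\<Sum>k<n. f ((T ^^ k) x)) \<le> C" by blast
    qed
  next
    assume "prob E = 1"
    then have "AE x in M. x \<in> E" using E by (simp add: prob_eq_1)
    then have TE: "AE x in M. T x \<in> E" by (rule T_AE)
    have "(\<lambda>n. \<integral>x. runmax f (Suc n) x - runmax f n (T x) \<partial>M) \<longlonglongrightarrow> (\<integral>x. f x \<partial>M)"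
    proof (rule integral_dominated_convergence[where w="\<lambda>x. \<bar>f x\<bar>"])
      show "AE x in M. norm (runmax f (Suc n) x - runmax f n (T x)) \<le> \<bar>f x\<bar>" for n
      proof (rule AE_I2)
        fix x
        have "\<bar>max 0 (f x + r) - r\<bar> \<le> \<bar>f x\<bar>" if "0 \<le> r" for r using that by (simp add: max_def)
        from this[OF runmax_nonneg] show "norm (runmax f (Suc n) x - runmax f n (T x)) \<le> \<bar>f x\<bar>" by simp
      qed
      show "AE x in M. (\<lambda>n. runmax f (Suc n) x - runmax f n (T x)) \<longlonglongrightarrow> f x"
        using TE
      proof eventually_elim
        fix x assume "T x \<in> E"
        obtain D :: nat where D: "\<bar>f x\<bar> \<le> D" using real_arch_simple by blast
        obtain N where N: "real D < runmax f N (T x)" using \<open>T x \<in> E\<close> by (auto simp: E_def)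
        have "runmax f (Suc n) x - runmax f n (T x) = f x" if "N \<le> n" for n
          using runmax_incseq[OF that, of f "T x"] N D by (auto simp: max_def)
        then show "(\<lambda>n. runmax f (Suc n) x - runmax f n (T x)) \<longlonglongrightarrow> f x"
          by (intro tendsto_eventually eventually_sequentiallyI[of N])
      qed
    qed (use f in \<open>simp_all del: runmax.simps\<close>)
    moreover have "0 \<le> (\<integral>x. runmax f (Suc n) x - runmax f n (T x) \<partial>M)" for n
    proof -
      have "(\<integral>x. runmax f (Suc n) x - runmax f n (T x) \<partial>M) = (\<integral>x. runmax f (Suc n) x \<partial>M) - (\<integral>x. runmax f n (T x) \<partial>M)"
        by (intro Bochner_Integration.integral_diff int T_integrable)
      also have "(\<integral>x. runmax f n (T x) \<partial>M) = (\<integral>x. runmax f n x \<partial>M)" by (rule T_integral) measurable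
      finally show ?thesis using integral_mono[OF int[of n] int[of "Suc n"] runmax_mono] by (simp del: runmax.simps)
    qed
    ultimately have "0 \<le> (\<integral>x. f x \<partial>M)" by (intro LIMSEQ_le_const) (assumption, blast)
    with neg show ?thesis by simp
  qed
qed

text \<open>Apply \<open>sums_bounded_above\<close> to \<open>f\<close> minus a constant slightly above its mean, and to a constant
slightly below the mean minus \<open>f\<close>.\<close>

theorem birkhoff:
  fixes f :: "'a \<Rightarrow> real"
  assumes f: "integrable M f"
  shows "AE x in M. (\<lambda>n. (\<Sum>k<n. f ((T ^^ k) x)) / real n) \<longlonglongrightarrow> (\<integral>x. f x \<partial>M)"
proof -
  define c where "c = (\<integral>x. f x \<partial>M)"
  \<comment> \<open>Countably many tolerances suffice, so that one null set serves for all of them.\<close>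
  define e where "e j = 1 / real (Suc j)" for j
  have e: "e j > 0" for j by (simp add: e_def)
  have up: "AE x in M. \<exists>C. \<forall>n. (\<Sum>k<n. f ((T ^^ k) x)) - real n * (c + e j) \<le> C" for j
  proof -
    have "AE x in M. \<exists>C. \<forall>n. (\<Sum>k<n. f ((T ^^ k) x) - (c + e j)) \<le> C"
      using f e[of j] by (intro sums_bounded_above) (auto simp: c_def prob_space)
    then show ?thesis by (simp add: sum_subtractf)
  qed
  have lo: "AE x in M. \<exists>C. \<forall>n. real n * (c - e j) - (\<Sum>k<n. f ((T ^^ k) x)) \<le> C" for j
  proof -
    have "AE x in M. \<exists>C. \<forall>n. (\<Sum>k<n. (c - e j) - f ((T ^^ k) x)) \<le> C"
      using f e[of j] by (intro sums_bounded_above) (auto simp: c_def prob_space)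
    then show ?thesis by (simp add: sum_subtractf)
  qed
  have "AE x in M. \<forall>j. (\<exists>C. \<forall>n. (\<Sum>k<n. f ((T ^^ k) x)) - real n * (c + e j) \<le> C) \<and>
     (\<exists>C. \<forall>n. real n * (c - e j) - (\<Sum>k<n. f ((T ^^ k) x)) \<le> C)"
    unfolding AE_all_countable using up lo by auto
  then show ?thesis
  proof eventually_elim
    fix x
    define S where "S n = (\<Sum>k<n. f ((T ^^ k) x))" for n
    assume "\<forall>j. (\<exists>C. \<forall>n. (\<Sum>k<n. f ((T ^^ k) x)) - real n * (c + e j) \<le> C) \<and>
     (\<exists>C. \<forall>n. real n * (c - e j) - (\<Sum>k<n. f ((T ^^ k) x)) \<le> C)"
    then have *: "\<And>j. \<exists>C. \<forall>n. S n - real n * (c + e j) \<le> C" "\<And>j. \<exists>C. \<forall>n. real n * (c - e j) - S n \<le> C"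
      unfolding S_def by blast+
    have "(\<lambda>n. S n / real n) \<longlonglongrightarrow> c"
    proof (rule LIMSEQ_I)
      fix r :: real assume r: "0 < r"
      obtain j where j: "e j < r / 2" using reals_Archimedean[of "r/2"] r by (auto simp: e_def inverse_eq_divide)
      obtain C1 where C1: "\<And>n. S n - real n * (c + e j) \<le> C1" using *(1) by blast
      obtain C2 where C2: "\<And>n. real n * (c - e j) - S n \<le> C2" using *(2) by blast
      obtain N :: nat where N: "(\<bar>C1\<bar> + \<bar>C2\<bar> + 1) * 2 / r < N" using reals_Archimedean2 by blast
      show "\<exists>N. \<forall>n\<ge>N. norm (S n / real n - c) < r"
      proof (intro exI[of _ N] allI impI)
        fix n assume n: "N \<le> n"
        have "0 \<le> (\<bar>C1\<bar> + \<bar>C2\<bar> + 1) * 2 / r" using r by simp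
        then have n0: "real n > 0" using N n by linarith
        have "(\<bar>C1\<bar> + \<bar>C2\<bar> + 1) * 2 / r < n" using N n by linarith
        then have "\<bar>C1\<bar> + \<bar>C2\<bar> + 1 < n * (r / 2)" using r by (simp add: field_simps)
        moreover have "n * e j < n * (r / 2)" using n0 j by simp
        ultimately have "S n - n * c < n * r" "n * c - S n < n * r"
          using C1[of n] C2[of n] by (auto simp: algebra_simps)
        then have "\<bar>S n - n * c\<bar> < n * r" by linarith
        moreover have "S n / real n - c = (S n - n * c) / n" using n0 by (simp add: field_simps)
        ultimately show "norm (S n / real n - c) < r" using n0 by (simp add: abs_divide pos_divide_less_eq mult.commute)
      qed
    qed
    then show "(\<lambda>n. (\<Sum>k<n. f ((T ^^ k) x)) / real n) \<longlonglongrightarrow> (\<integral>x. f x \<partial>M)"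
      by (simp add: S_def c_def)
  qed
qed

end

section \<open>The space of affine lattices\<close>

text \<open>The two coordinate systems on pairs of a matrix and a vector are matched by a permutation of the
standard basis, hence carry the same Lebesgue measure.\<close>

definition emb :: "aff \<Rightarrow> (real^2^2) \<times> (real^2)"
  where "emb x = (vector [vector [ca x, cb x], vector [cc x, cd x]], vector [cp x, cq x])"

definition unemb :: "(real^2^2) \<times> (real^2) \<Rightarrow> aff"
  where "unemb z = (((fst z $ 1 $ 1, fst z $ 1 $ 2), snd z $ 1), ((fst z $ 2 $ 1, fst z $ 2 $ 2), snd z $ 2))"

lemma unemb_emb [simp]: "unemb (emb x) = x"
  by (simp add: aff_eq_iff emb_def unemb_def)

lemma emb_unemb [simp]: "emb (unemb z) = z"
  by (cases z) (simp add: emb_def unemb_def vec_eq_iff forall_2)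

lemma det_emb [simp]: "det (fst (emb x)) = adet x"
  by (simp add: det_2 emb_def adet_coords)

lemma adet_unemb [simp]: "adet (unemb (M, w)) = det M"
  by (simp add: det_2 unemb_def)

lemma emb_measurable [measurable]: "emb \<in> borel_measurable borel"
  and unemb_measurable [measurable]: "unemb \<in> borel_measurable borel"
proof -
  have "linear emb" by (rule linearI) (simp_all add: emb_def vec_eq_iff forall_2)
  then show "emb \<in> borel_measurable borel"
    by (intro borel_measurable_continuous_onI linear_continuous_on linear_conv_bounded_linear[THEN iffD1])
  show "unemb \<in> borel_measurable borel" unfolding unemb_def
    by (intro borel_measurable_continuous_onI continuous_intros)
qed

lemma lborel_emb: "distr lborel borel emb = lborel"
proof (rule lborel_distr_basis_bij)
  show "linear emb" by (rule linearI) (simp_all add: emb_def vec_eq_iff forall_2)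
  show "emb x \<bullet> emb y = x \<bullet> y" for x y
    by (simp add: emb_def inner_vec_def sum_2) (simp add: coord_defs inner_prod_def)
  show "bij_betw emb Basis Basis"
  proof (rule bij_betw_imageI)
    show inj: "inj_on emb Basis" by (rule inj_on_inverseI[of _ unemb]) simp
    have "emb b \<in> Basis" if "b \<in> Basis" for b
    proof -
      have ax: "vector [1, 0] = (axis 1 1 :: real^2)" "vector [0, 1] = (axis 2 1 :: real^2)" "vector [0, 0] = (0 :: real^2)"
        "vector [0, 0] = (0 :: real^2^2)" "vector [v, 0] = (axis 1 v :: real^2^2)" "vector [0, v] = (axis 2 v :: real^2^2)"
        "axis 1 0 = (0 :: real^2^2)" for v
        by (simp_all add: vec_eq_iff forall_2 axis_def)
      have B1: "(axis i (axis j 1), 0) \<in> (Basis :: ((real^2^2) \<times> (real^2)) set)" for i j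
        unfolding Basis_prod_def by (rule UnI1, rule imageI) (simp add: axis_in_Basis_iff)
      have B2: "(0, axis i 1) \<in> (Basis :: ((real^2^2) \<times> (real^2)) set)" for i
        unfolding Basis_prod_def by (rule UnI2, rule imageI) (simp add: axis_in_Basis_iff)
      have "b = (((1, 0), 0), ((0, 0), 0)) \<or> b = (((0, 1), 0), ((0, 0), 0)) \<or> b = (((0, 0), 1), ((0, 0), 0)) \<or>
        b = (((0, 0), 0), ((1, 0), 0)) \<or> b = (((0, 0), 0), ((0, 1), 0)) \<or> b = (((0, 0), 0), ((0, 0), 1))"
        using that by (auto simp: Basis_prod_def zero_prod_def)
      then show ?thesis
        by (elim disjE) (simp_all only: emb_def coord_simps ax B1 B2)
    qed
    moreover have "card (emb ` Basis) = card (Basis :: ((real^2^2) \<times> (real^2)) set)"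
      using card_image[OF inj] by simp
    ultimately show "emb ` Basis = Basis"
      by (intro card_subset_eq) auto
  qed
qed

definition lat :: "aff \<Rightarrow> (real^2) set"
  where "lat x = affine_lattice (fst (emb x)) (snd (emb x))"

definition lat_pt :: "aff \<Rightarrow> int \<times> int \<Rightarrow> real^2"
  where "lat_pt x z = vector [cp (x \<odot> gtrans (fst z) (snd z)), cq (x \<odot> gtrans (fst z) (snd z))]"

lemma lat_eq: "lat x = range (lat_pt x)"
proof
  show "lat x \<subseteq> range (lat_pt x)"
  proof
    fix P assume "P \<in> lat x"
    then obtain z where z: "z \<in> int_lattice" "P = fst (emb x) *v z + snd (emb x)"
      by (auto simp: lat_def affine_lattice_def)
    have "z $ 1 \<in> \<int>" "z $ 2 \<in> \<int>" using z by (simp_all add: int_lattice_def)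
    then obtain m n where "z $ 1 = of_int m" "z $ 2 = of_int n" by (elim Ints_cases)
    then have "P = lat_pt x (m, n)"
      using z by (simp add: lat_pt_def emb_def vec_eq_iff forall_2 matrix_vector_mult_def sum_2 gtrans_mult)
    then show "P \<in> range (lat_pt x)" by simp
  qed
  show "range (lat_pt x) \<subseteq> lat x"
  proof clarify
    fix m n
    have "vector [of_int m, of_int n] \<in> int_lattice" by (simp add: int_lattice_def forall_2)
    moreover have "lat_pt x (m, n) = fst (emb x) *v vector [of_int m, of_int n] + snd (emb x)"
      by (simp add: lat_pt_def emb_def vec_eq_iff forall_2 matrix_vector_mult_def sum_2 gtrans_mult)
    ultimately show "lat_pt x (m, n) \<in> lat x" unfolding lat_def affine_lattice_def by blast
  qed
qed

lemma lat_Gam: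
  assumes g: "g \<in> Gam" shows "lat (x \<odot> g) = lat x"
proof -
  have sub: "lat (x \<odot> g) \<subseteq> lat x" if g: "g \<in> Gam" for x g
  proof
    fix P assume "P \<in> lat (x \<odot> g)"
    then obtain m n where P: "P = lat_pt (x \<odot> g) (m, n)" by (auto simp: lat_eq)
    have "cp (g \<odot> gtrans m n) \<in> \<int>" "cq (g \<odot> gtrans m n) \<in> \<int>"
      using Gam_mult[OF g Gam_generators(2)] unfolding Gam_def by blast+
    then obtain m' n' where mn: "cp (g \<odot> gtrans m n) = of_int m'" "cq (g \<odot> gtrans m n) = of_int n'"
      by (auto elim!: Ints_cases)
    have "P = lat_pt x (m', n')"
      unfolding P lat_pt_def amul_assoc fst_conv snd_conv coord_mult(5,6)[of x "g \<odot> gtrans m n"] mn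
      by (simp add: gtrans_def)
    then show "P \<in> lat x" by (simp add: lat_eq)
  qed
  from sub[OF g, of x] sub[OF Gam_inv[OF g], of "x \<odot> g"] show ?thesis by (simp add: g)
qed

text \<open>The affine lattice, rescaled to area one.\<close>

definition nlat :: "aff \<Rightarrow> (real^2) set"
  where "nlat x = (\<lambda>p. p /\<^sub>R sqrt (adet x)) ` lat x"

lemma nlat_Gam: "g \<in> Gam \<Longrightarrow> nlat (x \<odot> g) = nlat x"
  by (simp add: nlat_def lat_Gam adet_mult Gam_det)

lemma lat_pt_scaleR: "lat_pt (r *\<^sub>R x) z = r *\<^sub>R lat_pt x z"
  by (simp add: lat_pt_def vec_eq_iff forall_2 algebra_simps)

lemma lat_scaleR: "lat (r *\<^sub>R x) = (\<lambda>p. r *\<^sub>R p) ` lat x"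
  by (simp add: lat_eq image_image lat_pt_scaleR)

lemma nlat_eq_lat: "nlat x = lat ((1 / sqrt (adet x)) *\<^sub>R x)"
  by (simp add: nlat_def lat_scaleR inverse_eq_divide)

lemma nlat_scaleR: "r > 0 \<Longrightarrow> nlat (r *\<^sub>R x) = nlat x"
  by (simp add: nlat_eq_lat adet_scaleR real_sqrt_mult)

lemma nlat_AX2:
  assumes "adet x > 0" shows "nlat x \<in> AX2"
proof -
  have "adet ((1 / sqrt (adet x)) *\<^sub>R x) = 1"
    using assms by (simp add: adet_scaleR power_divide)
  then have "fst (emb ((1 / sqrt (adet x)) *\<^sub>R x)) \<in> SL2" by (simp add: SL2_def del: det_emb add: det_emb[symmetric])
  then show ?thesis unfolding nlat_eq_lat lat_def AX2_def by blast
qed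

lemma AX2_nlat: "\<omega> \<in> AX2 \<Longrightarrow> \<exists>x. adet x = 1 \<and> \<omega> = nlat x"
proof -
  assume "\<omega> \<in> AX2"
  then obtain h v where hv: "\<omega> = affine_lattice h v" "det h = 1" by (auto simp: AX2_def SL2_def)
  then have "adet (unemb (h, v)) = 1" "\<omega> = nlat (unemb (h, v))"
    by (simp_all add: nlat_eq_lat lat_def)
  then show ?thesis by blast
qed

lemma nlat_emb: "det h = 1 \<Longrightarrow> nlat (unemb (h, v)) = affine_lattice h v"
  by (simp add: nlat_eq_lat lat_def)

definition preim :: "(real^2) set set \<Rightarrow> ((real^2^2) \<times> (real^2)) set"
  where "preim S = {(h, v). h \<in> SL2 \<and> affine_lattice h v \<in> S}"

lemma SL2_borel [measurable]: "{z :: (real^2^2) \<times> (real^2). fst z \<in> SL2} \<in> sets borel"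
proof -
  have "closed {z :: (real^2^2) \<times> (real^2). det (fst z) = 1}"
    unfolding det_2 by (intro closed_Collect_eq continuous_intros)
  then show ?thesis by (simp add: SL2_def)
qed

text \<open>The generating family is already a \<open>\<sigma>\<close>-algebra.\<close>

lemma sets_borel_AX2: "sets borel_AX2 = {S. S \<subseteq> AX2 \<and> preim S \<in> sets borel}"
  and space_borel_AX2: "space borel_AX2 = AX2"
proof -
  let ?F = "{S. S \<subseteq> AX2 \<and> preim S \<in> sets borel}"
  have d: "borel_AX2 = sigma AX2 ?F" by (simp add: borel_AX2_def preim_def)
  have "sigma_algebra AX2 ?F"
    unfolding sigma_algebra_iff2
  proof (intro conjI ballI allI impI)
    show "{} \<in> ?F" by (simp add: preim_def)
    fix S assume "S \<in> ?F"
    moreover have "preim (AX2 - S) = {z. fst z \<in> SL2} - preim S"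
      by (auto simp: preim_def AX2_def)
    ultimately show "AX2 - S \<in> ?F" using SL2_borel by (auto intro: sets.Diff)
  next
    fix A :: "nat \<Rightarrow> (real^2) set set" assume "range A \<subseteq> ?F"
    moreover have "preim (\<Union>i. A i) = (\<Union>i. preim (A i))" by (auto simp: preim_def)
    ultimately show "(\<Union>i. A i) \<in> ?F" by (auto simp: image_subset_iff)
  qed auto
  then interpret sigma_algebra AX2 ?F .
  show "sets borel_AX2 = ?F" unfolding d by (rule sets_measure_of_eq)
  show "space borel_AX2 = AX2" unfolding d by (rule space_measure_of) auto
qed

text \<open>The cone over a set of unit-area lattices, in the coordinates of \<open>aff\<close>.\<close>

definition lift :: "(real^2) set set \<Rightarrow> aff set"
  where "lift S = {x. adet x > 0 \<and> nlat x \<in> S}"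

lemma lift_borel:
  assumes "S \<in> sets borel_AX2" shows "lift S \<in> sets borel"
proof -
  define f where "f x = emb ((1 / sqrt (adet x)) *\<^sub>R x)" for x
  have [measurable]: "f \<in> borel_measurable borel" unfolding f_def by measurable
  have [measurable]: "preim S \<in> sets borel" using assms by (simp add: sets_borel_AX2)
  have "lift S = {x. adet x > 0 \<and> f x \<in> preim S}"
  proof -
    have "nlat x \<in> S \<longleftrightarrow> f x \<in> preim S" if "adet x > 0" for x
    proof -
      have "adet ((1 / sqrt (adet x)) *\<^sub>R x) = 1" using that by (simp add: adet_scaleR power_divide)
      then have "fst (f x) \<in> SL2" by (simp add: f_def SL2_def)
      moreover have "nlat x = affine_lattice (fst (f x)) (snd (f x))" by (simp add: nlat_eq_lat lat_def f_def)
      ultimately show ?thesis by (simp add: preim_def case_prod_beta)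
    qed
    then show ?thesis by (auto simp: lift_def)
  qed
  also have "\<dots> \<in> sets borel" by measurable
  finally show ?thesis .
qed

lemma lift_Gam_set: "S \<in> sets borel_AX2 \<Longrightarrow> Gam_set (lift S)"
  by (simp add: Gam_set_def lift_borel) (simp add: lift_def nlat_Gam adet_mult Gam_det)

lemma lift_scaleR: "r > 0 \<Longrightarrow> r *\<^sub>R x \<in> lift S \<longleftrightarrow> x \<in> lift S"
  by (simp add: lift_def nlat_scaleR adet_scaleR zero_less_mult_iff)

lemma preim_lift: "preim S = {z. fst z \<in> SL2} \<inter> unemb -` lift S"
  by (auto simp: preim_def lift_def SL2_def nlat_emb)

lemma sets_AX2I:
  assumes "S \<subseteq> AX2" "lift S \<in> sets borel" shows "S \<in> sets borel_AX2"
proof -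
  have "unemb -` lift S \<inter> space borel \<in> sets borel" by (rule measurable_sets[OF unemb_measurable assms(2)])
  then have "preim S \<in> sets borel" unfolding preim_lift using SL2_borel by simp
  then show ?thesis using assms by (simp add: sets_borel_AX2)
qed

text \<open>Outside the cone any unit-area lattice serves as a value; the weight vanishes there.\<close>

definition nlat' :: "aff \<Rightarrow> (real^2) set"
  where "nlat' x = nlat (if adet x > 0 then x else aone)"

lemma nlat'_measurable: "nlat' \<in> measurable borel borel_AX2"
proof (rule measurableI)
  show "nlat' x \<in> space borel_AX2" for x by (simp add: nlat'_def space_borel_AX2 nlat_AX2)
  fix S assume S: "S \<in> sets borel_AX2"
  have "nlat' -` S \<inter> space borel = lift S \<union> (if nlat aone \<in> S then {x. \<not> adet x > 0} else {})"
  proof -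
    have "nlat' x \<in> S \<longleftrightarrow> x \<in> lift S \<or> (nlat aone \<in> S \<and> \<not> adet x > 0)" for x
      by (simp add: nlat'_def lift_def)
    then show ?thesis by (simp add: set_eq_iff)
  qed
  moreover have "{x. \<not> adet x > 0} \<in> sets borel" by measurable
  ultimately show "nlat' -` S \<inter> space borel \<in> sets borel" using lift_borel[OF S] by auto
qed

text \<open>The invariant probability measure, as the image of the normalised weight.\<close>

definition mu :: "(real^2) set measure"
  where "mu = distr (density lborel (\<lambda>x. siegel_wt x / vol)) borel_AX2 nlat'"

lemma sets_mu [simp, measurable_cong]: "sets mu = sets borel_AX2" and space_mu [simp]: "space mu = AX2"
  by (simp_all add: mu_def space_borel_AX2)

lemma nn_integral_mu:
  assumes [measurable]: "f \<in> borel_measurable borel_AX2"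
  shows "(\<integral>\<^sup>+\<omega>. f \<omega> \<partial>mu) = (\<integral>\<^sup>+x. siegel_wt x * f (nlat x) \<partial>lborel) / vol"
proof -
  note [measurable] = nlat'_measurable
  have "(\<integral>\<^sup>+\<omega>. f \<omega> \<partial>mu) = (\<integral>\<^sup>+x. siegel_wt x / vol * f (nlat' x) \<partial>lborel)"
    unfolding mu_def by (subst nn_integral_distr; (subst nn_integral_density)?) auto
  also have "\<dots> = (\<integral>\<^sup>+x. siegel_wt x * f (nlat' x) / vol \<partial>lborel)"
    by (simp add: divide_ennreal_def mult_ac)
  also have "\<dots> = (\<integral>\<^sup>+x. siegel_wt x * f (nlat' x) \<partial>lborel) / vol"
    by (subst nn_integral_divide) auto
  also have "(\<integral>\<^sup>+x. siegel_wt x * f (nlat' x) \<partial>lborel) = (\<integral>\<^sup>+x. siegel_wt x * f (nlat x) \<partial>lborel)"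
  proof (intro nn_integral_cong)
    fix x show "siegel_wt x * f (nlat' x) = siegel_wt x * f (nlat x)"
      using weight_outside[OF weight_siegel_wt, of x] by (cases "adet x > 0") (auto simp: nlat'_def Yset_def)
  qed
  finally show ?thesis .
qed

lemma emeasure_mu:
  assumes S: "S \<in> sets borel_AX2" shows "emeasure mu S = emeasure J (lift S) / vol"
proof -
  have "emeasure mu S = (\<integral>\<^sup>+\<omega>. indicator S \<omega> \<partial>mu)" using S by simp
  also have "\<dots> = (\<integral>\<^sup>+x. siegel_wt x * indicator S (nlat x) \<partial>lborel) / vol"
    using S by (intro nn_integral_mu) simp
  also have "(\<integral>\<^sup>+x. siegel_wt x * indicator S (nlat x) \<partial>lborel) = (\<integral>\<^sup>+x. siegel_wt x * indicator (lift S) x \<partial>lborel)"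
  proof (intro nn_integral_cong)
    fix x show "siegel_wt x * indicator S (nlat x) = siegel_wt x * indicator (lift S) x"
      using weight_outside[OF weight_siegel_wt, of x] by (cases "adet x > 0") (auto simp: lift_def Yset_def indicator_def)
  qed
  finally show ?thesis by (simp add: emeasure_J lift_borel[OF S])
qed

text \<open>The cone over a set is null exactly if its part below area one is, by rescaling.\<close>

lemma mu_null_iff:
  assumes S: "S \<in> sets borel_AX2"
  shows "emeasure mu S = 0 \<longleftrightarrow> (AE x in lborel. adet x > 0 \<longrightarrow> nlat x \<notin> S)"
proof -
  have "emeasure mu S = 0 \<longleftrightarrow> emeasure J (lift S) = 0"
  proof -
    have "vol \<noteq> \<top>" using vol_finite by auto
    then show ?thesis by (simp add: emeasure_mu[OF S] ennreal_divide_eq_0_iff)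
  qed
  also have "\<dots> \<longleftrightarrow> (AE x in lborel. x \<in> Yset \<longrightarrow> x \<notin> lift S)" by (rule J_null_iff[OF lift_Gam_set[OF S]])
  also have "\<dots> \<longleftrightarrow> (AE x in lborel. adet x > 0 \<longrightarrow> x \<notin> lift S)"
  proof
    assume "AE x in lborel. x \<in> Yset \<longrightarrow> x \<notin> lift S"
    then show "AE x in lborel. adet x > 0 \<longrightarrow> x \<notin> lift S" by (rule AE_cone) (simp add: lift_scaleR)
  next
    assume "AE x in lborel. adet x > 0 \<longrightarrow> x \<notin> lift S"
    then show "AE x in lborel. x \<in> Yset \<longrightarrow> x \<notin> lift S" by eventually_elim (simp add: Yset_def)
  qed
  also have "\<dots> \<longleftrightarrow> (AE x in lborel. adet x > 0 \<longrightarrow> nlat x \<notin> S)"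
    by (rule AE_cong) (auto simp: lift_def)
  finally show ?thesis .
qed

lemma null_period_cone_iff:
  assumes S: "S \<in> sets borel_AX2"
  shows "period_cone S \<in> null_sets lborel \<longleftrightarrow> (AE x in lborel. adet x > 0 \<longrightarrow> nlat x \<notin> S)"
proof -
  have eq: "period_cone S = unemb -` lift S"
    by (auto simp: period_cone_def lift_def nlat_def lat_def)
  have "period_cone S \<in> null_sets lborel \<longleftrightarrow> period_cone S \<in> null_sets (distr lborel borel emb)"
    by (simp add: lborel_emb)
  also have "\<dots> \<longleftrightarrow> emb -` period_cone S \<in> null_sets lborel"
  proof -
    have "unemb -` lift S \<inter> space borel \<in> sets borel" by (rule measurable_sets[OF unemb_measurable lift_borel[OF S]])
    then have "period_cone S \<in> sets borel" by (simp add: eq)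
    then show ?thesis by (subst null_sets_distr_iff) auto
  qed
  also have "emb -` period_cone S = lift S" by (simp add: eq vimage_def)
  also have "lift S \<in> null_sets lborel \<longleftrightarrow> (AE x in lborel. x \<notin> lift S)"
    using lift_borel[OF S] by (subst AE_iff_null_sets) auto
  also have "\<dots> \<longleftrightarrow> (AE x in lborel. adet x > 0 \<longrightarrow> nlat x \<notin> S)"
    by (rule AE_cong) (auto simp: lift_def)
  finally show ?thesis .
qed

lemma prob_space_mu: "prob_space mu"
proof
  have "lift AX2 = {x. adet x > 0}" by (auto simp: lift_def nlat_AX2)
  moreover have "AX2 \<in> sets borel_AX2" using sets.top[of borel_AX2] by (simp add: space_borel_AX2)
  ultimately have "emeasure mu AX2 = emeasure J {x. adet x > 0} / vol" by (simp add: emeasure_mu)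
  also have "emeasure J {x. adet x > 0} = vol"
    unfolding vol_def
    by (subst emeasure_J, measurable, intro nn_integral_cong)
       (use weight_outside[OF weight_siegel_wt] in \<open>auto simp: indicator_def Yset_def\<close>)
  also have "vol / vol = 1" using vol_finite vol_pos by (intro ennreal_divide_self) auto
  finally show "emeasure mu (space mu) = 1" by simp
qed

definition aff_of :: "real^2^2 \<Rightarrow> aff" where "aff_of A = unemb (A, 0)"

lemma adet_aff_of [simp]: "adet (aff_of A) = det A" by (simp add: aff_of_def)

lemma nlat_act:
  assumes "det A = 1" shows "nlat (aff_of A \<odot> x) = SL2_act A (nlat x)"
proof -
  have "lat_pt (aff_of A \<odot> x) z = A *v lat_pt x z" for z
    by (simp add: lat_pt_def aff_of_def unemb_def vec_eq_iff forall_2 matrix_vector_mult_def sum_2 algebra_simps)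
  then show ?thesis using assms
    by (simp add: nlat_def SL2_act_def lat_eq image_image adet_mult matrix_vector_mult_scaleR)
qed

lemma SL2_act_vimage:
  assumes A: "A \<in> SL2" and S: "S \<in> sets borel_AX2"
  shows "lift (SL2_act A -` S \<inter> AX2) = (\<lambda>x. aff_of A \<odot> x) -` lift S"
    and "SL2_act A -` S \<inter> AX2 \<in> sets borel_AX2"
proof -
  have det: "det A = 1" using A by (simp add: SL2_def)
  show *: "lift (SL2_act A -` S \<inter> AX2) = (\<lambda>x. aff_of A \<odot> x) -` lift S"
    using det by (auto simp: lift_def nlat_act nlat_AX2 adet_mult)
  have "(\<lambda>x. aff_of A \<odot> x) -` lift S \<inter> space borel \<in> sets borel"
    by (rule measurable_sets[OF _ lift_borel[OF S]]) measurable
  then show "SL2_act A -` S \<inter> AX2 \<in> sets borel_AX2" by (intro sets_AX2I) (auto simp: *)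
qed

lemma SL2_act_AX2: "A \<in> SL2 \<Longrightarrow> \<omega> \<in> AX2 \<Longrightarrow> SL2_act A \<omega> \<in> AX2"
  using AX2_nlat[of \<omega>] nlat_AX2[of "aff_of A \<odot> _"] by (auto simp: nlat_act[symmetric] SL2_def adet_mult intro!: nlat_AX2)

lemma SL2_act_measurable: "A \<in> SL2 \<Longrightarrow> SL2_act A \<in> measurable borel_AX2 borel_AX2"
  by (rule measurableI) (auto simp: space_borel_AX2 SL2_act_AX2 SL2_act_vimage)

lemma SL2_invariant_mu: "SL2_invariant mu"
  unfolding SL2_invariant_def
proof (intro ballI measure_eqI)
  fix A S assume A: "A \<in> SL2" and "S \<in> sets (distr mu borel_AX2 (SL2_act A))"
  then have S: "S \<in> sets borel_AX2" by simp
  have det: "det A = 1" using A by (simp add: SL2_def)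
  have m: "SL2_act A \<in> measurable mu borel_AX2" using SL2_act_measurable[OF A] by simp
  have "emeasure (distr mu borel_AX2 (SL2_act A)) S = emeasure mu (SL2_act A -` S \<inter> AX2)"
    by (subst emeasure_distr[OF m S]) simp
  also have "\<dots> = emeasure J ((\<lambda>x. aff_of A \<odot> x) -` lift S) / vol"
    by (simp add: emeasure_mu SL2_act_vimage[OF A S])
  also have "emeasure J ((\<lambda>x. aff_of A \<odot> x) -` lift S) = emeasure J (lift S)"
  proof (rule emeasure_J_vimage[OF lift_Gam_set[OF S]])
    show "good_map (\<lambda>x. aff_of A \<odot> x)" "good_map (\<lambda>x. ainv (aff_of A) \<odot> x)"
      by (rule good_map_left, simp add: adet_ainv det)+
    show "ainv (aff_of A) \<odot> (aff_of A \<odot> x) = x" for x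
      by (simp add: amul_assoc[symmetric] amul_ainv_left det)
  qed
  finally show "emeasure (distr mu borel_AX2 (SL2_act A)) S = emeasure mu S" by (simp add: emeasure_mu[OF S])
qed simp

lemma invariant_Lebesgue_class_prob_mu: "invariant_Lebesgue_class_prob mu"
  unfolding invariant_Lebesgue_class_prob_def in_Lebesgue_class_def
  by (auto simp: prob_space_mu SL2_invariant_mu null_period_cone_iff mu_null_iff null_sets_def)
     (use null_period_cone_iff in \<open>auto simp: null_sets_def\<close>)

text \<open>The shear that lowers every slope by one.\<close>

definition step_mat :: "real^2^2" where "step_mat = vector [vector [1, 0], vector [-1, 1]]"

definition step :: "(real^2) set \<Rightarrow> (real^2) set" where "step = SL2_act step_mat"

lemma step_mat_SL2: "step_mat \<in> SL2" by (simp add: SL2_def step_mat_def det_2)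

lemma aff_of_step: "aff_of step_mat = lin 1 0 (-1) 1"
  by (simp add: aff_of_def unemb_def step_mat_def aff_eq_iff)

lemma ergodic_step: "ergodic_system mu step"
proof -
  interpret prob_space mu by (rule prob_space_mu)
  show ?thesis
  proof
    show "step \<in> measurable mu mu" using SL2_act_measurable[OF step_mat_SL2] by (simp add: step_def)
    have "distr mu mu step = distr mu borel_AX2 step" by (rule distr_cong) auto
    then show "distr mu mu step = mu"
      using SL2_invariant_mu step_mat_SL2 by (simp add: SL2_invariant_def step_def)
    fix E assume "E \<in> sets mu" and inv: "step -` E \<inter> space mu = E"
    then have E: "E \<in> sets borel_AX2" by simp
    have EA: "E \<subseteq> AX2" using sets.sets_into_space[OF E] by (simp add: space_borel_AX2)
    have "lift E = (\<lambda>x. lin 1 0 (-1) 1 \<odot> x) -` lift E"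
      using SL2_act_vimage(1)[OF step_mat_SL2 E] inv by (simp add: step_def aff_of_step)
    then have D: "lin 1 0 (-1) 1 \<odot> x \<in> lift E \<longleftrightarrow> x \<in> lift E" for x by blast
    have U: "lin 1 0 1 1 \<odot> x \<in> lift E \<longleftrightarrow> x \<in> lift E" for x
    proof -
      have "lin 1 0 (-1) 1 \<odot> (lin 1 0 1 1 \<odot> x) = lin 1 0 0 1 \<odot> x" by (rule lin_mult_cong) simp_all
      then show ?thesis using D[of "lin 1 0 1 1 \<odot> x"] by (simp add: lin_one)
    qed
    from ergodic_dichotomy[OF lift_Gam_set[OF E] U lift_scaleR]
    show "prob E = 0 \<or> prob E = 1"
    proof
      assume "AE x in lborel. adet x > 0 \<longrightarrow> x \<notin> lift E"
      then have "AE x in lborel. adet x > 0 \<longrightarrow> nlat x \<notin> E" by eventually_elim (simp add: lift_def)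
      then have "emeasure mu E = 0" by (simp add: mu_null_iff[OF E])
      then show ?thesis by (simp add: emeasure_eq_measure)
    next
      assume "AE x in lborel. adet x > 0 \<longrightarrow> x \<in> lift E"
      then have "AE x in lborel. adet x > 0 \<longrightarrow> nlat x \<notin> AX2 - E" by eventually_elim (simp add: lift_def)
      moreover have "AX2 - E \<in> sets borel_AX2" using sets.compl_sets[OF E] by (simp add: space_borel_AX2)
      ultimately have "emeasure mu (AX2 - E) = 0" by (simp add: mu_null_iff)
      then have "prob (space mu - E) = 0" by (simp add: emeasure_eq_measure)
      then show ?thesis using prob_compl[of E] E by simp
    qed
  qed
qed

section \<open>Counting consecutive slopes\<close>

definition vpts :: "(real^2) set \<Rightarrow> (real^2) set"
  where "vpts \<Lambda> = {P\<in>\<Lambda>. 0 < P $ 1 \<and> P $ 1 \<le> 1}"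

definition sl :: "real^2 \<Rightarrow> real" where "sl P = P $ 2 / P $ 1"

text \<open>Pairs of lattice points in the vertical strip with consecutive slopes whose difference lies in
\<open>D\<close>. Negative slopes are included, so that the notion is invariant under shears.\<close>

definition gpairs :: "(real^2) set \<Rightarrow> real set \<Rightarrow> ((real^2) \<times> (real^2)) set"
  where "gpairs \<Lambda> D = {(P, Q). P \<in> vpts \<Lambda> \<and> Q \<in> vpts \<Lambda> \<and> sl P < sl Q \<and>
    (\<forall>R\<in>vpts \<Lambda>. \<not> (sl P < sl R \<and> sl R < sl Q)) \<and> sl Q - sl P \<in> D}"

text \<open>The values are extended nonnegative reals, so that the mean count is the integral of a countable sum of indicators.\<close>

definition cnt :: "real set \<Rightarrow> (real^2) set \<Rightarrow> ennreal"
  where "cnt D \<Lambda> = emeasure (count_space UNIV) {(P, Q) \<in> gpairs \<Lambda> D. 0 < sl Q \<and> sl Q \<le> 1}"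

definition px :: "aff \<Rightarrow> int \<times> int \<Rightarrow> real" where "px x z = cp (x \<odot> gtrans (fst z) (snd z))"
definition py :: "aff \<Rightarrow> int \<times> int \<Rightarrow> real" where "py x z = cq (x \<odot> gtrans (fst z) (snd z))"

text \<open>The strip condition for the rescaled lattice; slopes do not change under rescaling.\<close>

definition in_strip :: "aff \<Rightarrow> int \<times> int \<Rightarrow> bool"
  where "in_strip x z \<longleftrightarrow> 0 < px x z \<and> px x z \<le> sqrt (adet x)"

definition slope_at :: "aff \<Rightarrow> int \<times> int \<Rightarrow> real" where "slope_at x z = py x z / px x z"

definition consec :: "aff \<Rightarrow> (int \<times> int) \<times> (int \<times> int) \<Rightarrow> bool"
  where "consec x zz \<longleftrightarrow> in_strip x (fst zz) \<and> in_strip x (snd zz) \<and> slope_at x (fst zz) < slope_at x (snd zz) \<and>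
    (\<forall>z. in_strip x z \<longrightarrow> \<not> (slope_at x (fst zz) < slope_at x z \<and> slope_at x z < slope_at x (snd zz))) \<and> 0 < slope_at x (snd zz) \<and> slope_at x (snd zz) \<le> 1"

definition nlat_pt :: "aff \<Rightarrow> int \<times> int \<Rightarrow> real^2"
  where "nlat_pt x z = lat_pt x z /\<^sub>R sqrt (adet x)"

lemma nlat_eq_range: "nlat x = range (nlat_pt x)"
  by (simp add: nlat_def lat_eq nlat_pt_def image_image)

lemma px_eq: "px x z = ca x * fst z + cb x * snd z + cp x"
  and py_eq: "py x z = cc x * fst z + cd x * snd z + cq x"
  by (simp_all add: px_def py_def gtrans_def)

lemma nlat_pt_coords: "nlat_pt x z $ 1 = px x z / sqrt (adet x)" "nlat_pt x z $ 2 = py x z / sqrt (adet x)"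
  by (simp_all add: nlat_pt_def lat_pt_def px_def py_def field_simps)

lemma nlat_pt_vpts: "adet x > 0 \<Longrightarrow> nlat_pt x z \<in> vpts (nlat x) \<longleftrightarrow> in_strip x z"
  by (auto simp: vpts_def nlat_eq_range nlat_pt_coords in_strip_def zero_less_divide_iff)

lemma sl_nlat_pt: "adet x > 0 \<Longrightarrow> sl (nlat_pt x z) = slope_at x z"
  by (simp add: sl_def nlat_pt_coords slope_at_def)

lemma inj_nlat_pt:
  assumes "adet x > 0" shows "inj (nlat_pt x)"
proof (rule injI)
  fix z z' assume "nlat_pt x z = nlat_pt x z'"
  then have "nlat_pt x z $ 1 = nlat_pt x z' $ 1" "nlat_pt x z $ 2 = nlat_pt x z' $ 2" by simp_all
  then have e: "px x z = px x z'" "py x z = py x z'" using assms by (simp_all add: nlat_pt_coords)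
  define m n where "m = real_of_int (fst z - fst z')" and "n = real_of_int (snd z - snd z')"
  have 1: "ca x * m + cb x * n = 0" "cc x * m + cd x * n = 0"
    using e by (simp_all add: px_eq py_eq m_def n_def algebra_simps)
  have "adet x * m = cd x * (ca x * m + cb x * n) - cb x * (cc x * m + cd x * n)"
    "adet x * n = ca x * (cc x * m + cd x * n) - cc x * (ca x * m + cb x * n)"
    by (simp_all add: adet_coords algebra_simps)
  then have "adet x * m = 0" "adet x * n = 0" unfolding 1 by simp_all
  then have "m = 0" "n = 0" using assms by simp_all
  then show "z = z'" by (simp add: m_def n_def prod_eq_iff)
qed

lemma vpts_range: "adet x > 0 \<Longrightarrow> R \<in> vpts (nlat x) \<longleftrightarrow> (\<exists>z. R = nlat_pt x z \<and> in_strip x z)"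
  using nlat_pt_vpts[of x] by (auto simp: vpts_def nlat_eq_range)

lemma gpairs_image:
  assumes x: "adet x > 0"
  shows "{(P, Q) \<in> gpairs (nlat x) D. 0 < sl Q \<and> sl Q \<le> 1}
    = map_prod (nlat_pt x) (nlat_pt x) ` {zz. consec x zz \<and> slope_at x (snd zz) - slope_at x (fst zz) \<in> D}" (is "?L = ?R")
proof
  show "?L \<subseteq> ?R"
  proof clarify
    fix P Q assume *: "(P, Q) \<in> gpairs (nlat x) D" and Q: "0 < sl Q" "sl Q \<le> 1"
    then obtain z z' where z: "P = nlat_pt x z" "in_strip x z" "Q = nlat_pt x z'" "in_strip x z'"
      by (auto simp: gpairs_def vpts_range[OF x])
    have "\<not> (slope_at x z < slope_at x r \<and> slope_at x r < slope_at x z')" if "in_strip x r" for r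
    proof -
      have "nlat_pt x r \<in> vpts (nlat x)" using that by (simp add: nlat_pt_vpts[OF x])
      then have "\<not> (sl P < sl (nlat_pt x r) \<and> sl (nlat_pt x r) < sl Q)" using * unfolding gpairs_def by blast
      then show ?thesis by (simp add: z sl_nlat_pt[OF x])
    qed
    moreover have "slope_at x z < slope_at x z'" "0 < slope_at x z'" "slope_at x z' \<le> 1" "slope_at x z' - slope_at x z \<in> D"
      using * Q unfolding gpairs_def by (simp_all add: z sl_nlat_pt[OF x])
    ultimately have "consec x (z, z')" "slope_at x z' - slope_at x z \<in> D"
      using z by (simp_all add: consec_def)
    then show "(P, Q) \<in> ?R" using z by (intro image_eqI[of _ _ "(z, z')"]) auto
  qed
  show "?R \<subseteq> ?L"
    by (auto simp: gpairs_def consec_def sl_nlat_pt[OF x] vpts_range[OF x])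
qed

lemma cnt_nlat:
  assumes x: "adet x > 0"
  shows "cnt D (nlat x) = (\<integral>\<^sup>+zz. indicator {zz. consec x zz} zz * indicator D (slope_at x (snd zz) - slope_at x (fst zz)) \<partial>count_space UNIV)"
proof -
  let ?A = "{zz. consec x zz \<and> slope_at x (snd zz) - slope_at x (fst zz) \<in> D}"
  have inj: "inj_on (map_prod (nlat_pt x) (nlat_pt x)) ?A"
    using prod.inj_map[OF inj_nlat_pt[OF x] inj_nlat_pt[OF x]] by (rule inj_on_subset) simp
  have "cnt D (nlat x) = emeasure (count_space UNIV) (map_prod (nlat_pt x) (nlat_pt x) ` ?A)"
    by (simp add: cnt_def gpairs_image[OF x])
  also have "\<dots> = (\<integral>\<^sup>+y. indicator (map_prod (nlat_pt x) (nlat_pt x) ` ?A) y \<partial>count_space UNIV)" by simp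
  also have "\<dots> = (\<integral>\<^sup>+y. 1 \<partial>count_space (map_prod (nlat_pt x) (nlat_pt x) ` ?A))"
    by (subst nn_integral_count_space_indicator) auto
  also have "\<dots> = (\<integral>\<^sup>+y. 1 \<partial>count_space ?A)"
    by (rule nn_integral_bij_count_space[symmetric, OF inj_on_imp_bij_betw[OF inj]])
  also have "\<dots> = (\<integral>\<^sup>+zz. indicator ?A zz \<partial>count_space UNIV)"
    by (subst nn_integral_count_space_indicator) auto
  also have "\<dots> = (\<integral>\<^sup>+zz. indicator {zz. consec x zz} zz * indicator D (slope_at x (snd zz) - slope_at x (fst zz)) \<partial>count_space UNIV)"
    by (intro nn_integral_cong) (simp add: indicator_def)
  finally show ?thesis .
qed

lemma slope_measurable [measurable]:
  "(\<lambda>x. px x z) \<in> borel_measurable borel" "(\<lambda>x. py x z) \<in> borel_measurable borel"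
  "(\<lambda>x. slope_at x z) \<in> borel_measurable borel" "Measurable.pred borel (\<lambda>x. in_strip x z)"
  unfolding slope_at_def px_eq py_eq in_strip_def by measurable

lemma consec_measurable [measurable]: "Measurable.pred borel (\<lambda>x. consec x zz)"
  unfolding consec_def by measurable

lemma measurable_AX2I:
  fixes f :: "(real^2) set \<Rightarrow> 'b::topological_space"
  assumes g: "g \<in> borel_measurable borel" and fg: "\<And>x. adet x > 0 \<Longrightarrow> f (nlat x) = g x"
  shows "f \<in> borel_measurable borel_AX2"
proof (rule measurableI)
  fix C assume "C \<in> sets (borel :: 'b measure)"
  then have "g -` C \<inter> space borel \<in> sets borel" using g by (rule measurable_sets[rotated])
  moreover have "{x. adet x > 0} \<in> sets borel" by measurable
  ultimately have "{x. adet x > 0} \<inter> g -` C \<in> sets borel" by auto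
  moreover have "lift (f -` C \<inter> AX2) = {x. adet x > 0} \<inter> g -` C"
    using fg by (auto simp: lift_def nlat_AX2)
  ultimately show "f -` C \<inter> space borel_AX2 \<in> sets borel_AX2"
    by (intro sets_AX2I) (auto simp: space_borel_AX2)
qed simp

definition cntx :: "real set \<Rightarrow> aff \<Rightarrow> ennreal"
  where "cntx D x = (\<integral>\<^sup>+zz. indicator {zz. consec x zz} zz * indicator D (slope_at x (snd zz) - slope_at x (fst zz)) \<partial>count_space UNIV)"

text \<open>As lattice points are indexed by pairs of integers, the count is a countable sum of indicators.\<close>

lemma cntx_measurable [measurable]:
  assumes [measurable]: "D \<in> sets borel" shows "cntx D \<in> borel_measurable borel"
proof -
  have [measurable]: "(\<lambda>x. indicator {zz. consec x zz} zz :: ennreal) \<in> borel_measurable borel" for zz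
  proof -
    have "(\<lambda>x. indicator {zz. consec x zz} zz :: ennreal) = (\<lambda>x. if consec x zz then 1 else 0)"
      by (auto simp: indicator_def)
    then show ?thesis by simp
  qed
  show ?thesis unfolding cntx_def[abs_def] by (rule borel_measurable_nn_integral_count) auto
qed

lemma cnt_measurable: "D \<in> sets borel \<Longrightarrow> cnt D \<in> borel_measurable borel_AX2"
  by (rule measurable_AX2I[of "cntx D"]) (simp_all add: cnt_nlat cntx_def)

lemma integral_cnt:
  assumes D: "D \<in> sets borel"
  shows "(\<integral>\<^sup>+\<omega>. cnt D \<omega> \<partial>mu) = (\<integral>\<^sup>+x. siegel_wt x * cntx D x \<partial>lborel) / vol"
proof -
  have "siegel_wt x * cnt D (nlat x) = siegel_wt x * cntx D x" for x
    using weight_outside[OF weight_siegel_wt, of x] by (cases "adet x > 0") (simp_all add: cnt_nlat cntx_def Yset_def)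
  then show ?thesis by (simp add: nn_integral_mu[OF cnt_measurable[OF D]])
qed

text \<open>Equality of the two first coordinates is a linear condition on the first row.\<close>

lemma AE_px_distinct: "z \<noteq> z' \<Longrightarrow> AE x in lborel. px x z \<noteq> px x z'"
proof -
  assume z: "z \<noteq> z'"
  let ?m = "real_of_int (fst z) - real_of_int (fst z')" and ?n = "real_of_int (snd z) - real_of_int (snd z')"
  have "negligible {x :: aff. (((?m, ?n), 0), ((0, 0), 0)) \<bullet> x = 0}"
    using z by (intro negligible_hyperplane) (auto simp: zero_prod_def prod_eq_iff)
  moreover have "{x :: aff. (((?m, ?n), 0), ((0, 0), 0)) \<bullet> x = 0} = {x. px x z = px x z'}"
    by (auto simp: px_eq ca_def cb_def inner_prod_def algebra_simps)
  ultimately have "{x. px x z = px x z'} \<in> null_sets lebesgue" by (simp add: negligible_iff_null_sets)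
  then have "{x. px x z = px x z'} \<in> null_sets lborel"
    by (subst (asm) null_sets_completion_iff) simp_all
  then show ?thesis by (rule AE_I') simp
qed

text \<open>With \<open>X\<close>, \<open>X'\<close> the first coordinates of the two points, the difference of their slopes is affine in the second coordinate \<open>q\<close> of the marked point
with coefficient \<open>1 / X' - 1 / X\<close>. The coefficient is nonzero for almost every first row.\<close>

lemma AE_slope_difference:
  assumes N: "N \<in> null_sets lborel" and z: "z \<noteq> z'"
  shows "AE x in lborel. in_strip x z \<and> in_strip x z' \<longrightarrow> slope_at x z' - slope_at x z \<notin> N"
proof -
  have [measurable]: "N \<in> sets borel" using N by auto
  define bad where "bad = {x. px x z \<noteq> 0 \<and> px x z' \<noteq> 0 \<and> px x z \<noteq> px x z' \<and> slope_at x z' - slope_at x z \<in> N}"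
  have bad [measurable]: "bad \<in> sets borel" unfolding bad_def by measurable
  have "emeasure lborel bad = (\<integral>\<^sup>+x. indicator bad x \<partial>lborel)" by simp
  also have "\<dots> = (\<integral>\<^sup>+u. \<integral>\<^sup>+v. indicator bad (u, v) \<partial>lborel \<partial>lborel)"
    by (subst nn_integral_lborel_pair) auto
  also have "\<dots> = (\<integral>\<^sup>+u. \<integral>\<^sup>+v. \<integral>\<^sup>+q. indicator bad (u, (v, q)) \<partial>lborel \<partial>lborel \<partial>lborel)"
    by (intro nn_integral_cong, subst nn_integral_lborel_pair) auto
  also have "\<dots> = (\<integral>\<^sup>+u. \<integral>\<^sup>+v. 0 \<partial>(lborel :: (real \<times> real) measure) \<partial>(lborel :: ((real \<times> real) \<times> real) measure))"
  proof (intro nn_integral_cong)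
    fix u :: "(real \<times> real) \<times> real" and v :: "real \<times> real"
    obtain a b p where u: "u = ((a, b), p)" by (cases u) auto
    obtain c d where v: "v = (c, d)" by (cases v)
    define X X' where "X = a * fst z + b * snd z + p" and "X' = a * fst z' + b * snd z' + p"
    define k where "k = 1 / X' - 1 / X"
    define t where "t = (c * fst z' + d * snd z') / X' - (c * fst z + d * snd z) / X"
    have mem: "(u, (v, q)) \<in> bad \<longleftrightarrow> X \<noteq> 0 \<and> X' \<noteq> 0 \<and> X \<noteq> X' \<and> t + k * q \<in> N" for q
    proof -
      have "px (u, (v, q)) z = X" "px (u, (v, q)) z' = X'"
        by (simp_all add: px_eq u v X_def X'_def)
      moreover have "slope_at (u, (v, q)) z' - slope_at (u, (v, q)) z = t + k * q"
        unfolding slope_at_def calculation by (simp add: py_eq u v t_def k_def add_divide_distrib algebra_simps)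
      ultimately show ?thesis by (simp add: bad_def)
    qed
    have "AE q in lborel. (u, (v, q)) \<notin> bad"
    proof (cases "X \<noteq> 0 \<and> X' \<noteq> 0 \<and> X \<noteq> X'")
      case True
      then have "k \<noteq> 0" by (simp add: k_def field_simps)
      moreover have "AE q in lborel. q \<notin> N" using N by (rule AE_not_in)
      ultimately have "AE q in lborel. t + k * q \<notin> N"
        by (intro AE_borel_affine[of k "\<lambda>q. q \<notin> N"]) auto
      then show ?thesis by eventually_elim (simp add: mem)
    next
      case False
      then have "(u, (v, q)) \<notin> bad" for q using mem by blast
      then show ?thesis by simp
    qed
    then have "AE q in lborel. indicator bad (u, (v, q)) = (0 :: ennreal)" by eventually_elim simp
    then have "(\<integral>\<^sup>+q. indicator bad (u, (v, q)) \<partial>lborel) = (\<integral>\<^sup>+q. 0 \<partial>(lborel :: real measure))"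
      by (rule nn_integral_cong_AE)
    then show "(\<integral>\<^sup>+q. indicator bad (u, (v, q)) \<partial>lborel) = 0" by simp
  qed
  finally have "emeasure lborel bad = 0" by simp
  then have "AE x in lborel. x \<notin> bad" using bad by (intro AE_not_in null_setsI) auto
  with AE_px_distinct[OF z] show ?thesis
    by eventually_elim (auto simp: bad_def in_strip_def)
qed

definition distinct_slopes :: "aff \<Rightarrow> bool"
  where "distinct_slopes x \<longleftrightarrow> (\<forall>z z'. in_strip x z \<and> in_strip x z' \<and> slope_at x z = slope_at x z' \<longrightarrow> z = z')"

text \<open>Apply \<open>AE_slope_difference\<close> to the null set consisting of zero.\<close>

lemma AE_distinct_slopes: "AE x in lborel. distinct_slopes x"
proof -
  have "AE x in lborel. in_strip x z \<and> in_strip x z' \<and> slope_at x z = slope_at x z' \<longrightarrow> z = z'" for z z'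
  proof (cases "z = z'")
    case False
    have "{0::real} \<in> null_sets lborel" by (simp add: finite_imp_null_set_lborel)
    from AE_slope_difference[OF this False] show ?thesis by eventually_elim auto
  qed simp
  then show ?thesis unfolding distinct_slopes_def by (simp add: AE_all_countable)
qed

text \<open>If slopes are distinct, a consecutive pair is determined by its upper member.\<close>

lemma cntx_le:
  assumes x: "distinct_slopes x"
  shows "cntx D x \<le> (\<integral>\<^sup>+z. indicator {z. in_strip x z \<and> 0 < slope_at x z \<and> slope_at x z \<le> 1} z \<partial>count_space UNIV)"
proof -
  let ?A = "{zz. consec x zz \<and> slope_at x (snd zz) - slope_at x (fst zz) \<in> D}"
  have inj: "inj_on snd ?A"
  proof (rule inj_onI)
    fix zz ww assume "zz \<in> ?A" "ww \<in> ?A" and e: "snd zz = snd ww"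
    then have c: "consec x zz" "consec x ww" by simp_all
    then have "slope_at x (fst zz) = slope_at x (fst ww)"
      using e unfolding consec_def by (metis linorder_less_linear)
    then have "fst zz = fst ww" using x c unfolding distinct_slopes_def consec_def by blast
    then show "zz = ww" using e by (rule prod_eqI)
  qed
  have "cntx D x = (\<integral>\<^sup>+zz. indicator ?A zz \<partial>count_space UNIV)"
    unfolding cntx_def by (intro nn_integral_cong) (simp add: indicator_def)
  also have "\<dots> = (\<integral>\<^sup>+zz. 1 \<partial>count_space ?A)"
    by (subst (2) nn_integral_count_space_indicator) auto
  also have "\<dots> = (\<integral>\<^sup>+z. 1 \<partial>count_space (snd ` ?A))"
    by (rule nn_integral_bij_count_space[OF inj_on_imp_bij_betw[OF inj]])
  also have "\<dots> = (\<integral>\<^sup>+z. indicator (snd ` ?A) z \<partial>count_space UNIV)"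
    by (subst nn_integral_count_space_indicator) auto
  also have "\<dots> \<le> (\<integral>\<^sup>+z. indicator {z. in_strip x z \<and> 0 < slope_at x z \<and> slope_at x z \<le> 1} z \<partial>count_space UNIV)"
    by (intro nn_integral_mono indicator_leI) (auto simp: consec_def)
  finally show ?thesis .
qed

lemma integral_cntx_finite: "(\<integral>\<^sup>+x. siegel_wt x * cntx D x \<partial>lborel) \<le> 16"
proof -
  define u :: "aff \<Rightarrow> ennreal" where "u x = indicator {x. 0 < cp x \<and> cp x \<le> sqrt (adet x) \<and> 0 < cq x \<and> cq x \<le> cp x} x" for x
  have [measurable]: "u \<in> borel_measurable borel" unfolding u_def by measurable
  have u: "u (x \<odot> gtrans (fst z) (snd z)) = indicator {z. in_strip x z \<and> 0 < slope_at x z \<and> slope_at x z \<le> 1} z" for x z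
  proof -
    have "adet (x \<odot> gtrans (fst z) (snd z)) = adet x" by (simp add: adet_mult Gam_det Gam_generators)
    moreover have "0 < px x z \<and> px x z \<le> sqrt (adet x) \<and> 0 < py x z \<and> py x z \<le> px x z \<longleftrightarrow>
      in_strip x z \<and> 0 < slope_at x z \<and> slope_at x z \<le> 1"
      by (cases "0 < px x z") (auto simp: in_strip_def slope_at_def zero_less_divide_iff)
    ultimately show ?thesis
      unfolding u_def indicator_def mem_Collect_eq px_def[symmetric] py_def[symmetric] by simp
  qed
  have "(\<integral>\<^sup>+x. siegel_wt x * cntx D x \<partial>lborel)
    \<le> (\<integral>\<^sup>+x. indicator siegel x * (\<integral>\<^sup>+z. u (x \<odot> gtrans (fst z) (snd z)) \<partial>count_space UNIV) \<partial>lborel)"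
    unfolding u using AE_distinct_slopes
    by (intro nn_integral_mono_AE, use AE_distinct_slopes in eventually_elim) (intro mult_mono siegel_wt_le cntx_le, auto)
  also have "\<dots> \<le> 16"
  proof (rule siegel_count_bound)
    fix e f :: "real \<times> real"
    assume det: "0 < fst e * snd f - fst f * snd e" "fst e * snd f - fst f * snd e \<le> 1"
    have "u (ofcols ((e, f), w)) \<le> indicator ({0..1::real} \<times> {0..1::real}) w" for w
    proof -
      obtain a c b d p q where efw: "e = (a, c)" "f = (b, d)" "w = (p, q)" by (cases e, cases f, cases w)
      have "sqrt (a * d - b * c) \<le> 1" using det by (simp add: efw)
      then have "t \<le> sqrt (a * d - b * c) \<Longrightarrow> t \<le> 1" for t by (rule order_trans[rotated])
      then show ?thesis by (fastforce simp: u_def indicator_def efw adet_coords)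
    qed
    then have "(\<integral>\<^sup>+w. u (ofcols ((e, f), w)) \<partial>lborel) \<le> (\<integral>\<^sup>+w. indicator ({0..1::real} \<times> {0..1::real}) w \<partial>lborel)"
      by (rule nn_integral_mono)
    also have "\<dots> = emeasure lborel ({0..1::real} \<times> {0..1::real})"
      by (subst nn_integral_indicator) (auto simp: borel_prod[symmetric])
    also have "\<dots> = 1"
      by (subst lborel_prod[symmetric], subst lborel.emeasure_pair_measure_Times) auto
    finally show "(\<integral>\<^sup>+w. u (ofcols ((e, f), w)) \<partial>lborel) \<le> 1" .
  qed measurable
  finally show ?thesis .
qed

section \<open>The gap density\<close>

text \<open>The mean number of consecutive pairs with given slope difference, as a measure on the line.\<close>

definition gapm :: "real measure"
  where "gapm = distr (density (count_space UNIV \<Otimes>\<^sub>M lborel) (\<lambda>z. siegel_wt (snd z) * indicator {zz. consec (snd z) zz} (fst z)))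
    borel (\<lambda>z. slope_at (snd z) (snd (fst z)) - slope_at (snd z) (fst (fst z)))"

lemma sets_gapm [simp, measurable_cong]: "sets gapm = sets borel" and space_gapm [simp]: "space gapm = UNIV"
  by (simp_all add: gapm_def)

lemma emeasure_gapm:
  assumes [measurable]: "D \<in> sets borel"
  shows "emeasure gapm D = (\<integral>\<^sup>+x. siegel_wt x * cntx D x \<partial>lborel)"
proof -
  let ?K = "count_space UNIV \<Otimes>\<^sub>M lborel :: (((int \<times> int) \<times> (int \<times> int)) \<times> aff) measure"
  have ind [measurable]: "(\<lambda>x. indicator {zz. consec x zz} zz :: ennreal) \<in> borel_measurable borel" for zz
  proof -
    have "(\<lambda>x. indicator {zz. consec x zz} zz :: ennreal) = (\<lambda>x. if consec x zz then 1 else 0)"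
      by (auto simp: indicator_def)
    then show ?thesis by simp
  qed
  have m1 [measurable]: "(\<lambda>z. siegel_wt (snd z) * indicator {zz. consec (snd z) zz} (fst z)) \<in> borel_measurable ?K"
    by (rule measurable_pair_measure_countable1) auto
  have m2 [measurable]: "(\<lambda>z. slope_at (snd z) (snd (fst z)) - slope_at (snd z) (fst (fst z))) \<in> borel_measurable ?K"
    by (rule measurable_pair_measure_countable1) auto
  have "emeasure gapm D = (\<integral>\<^sup>+y. indicator D y \<partial>gapm)" by simp
  also have "\<dots> = (\<integral>\<^sup>+z. (siegel_wt (snd z) * indicator {zz. consec (snd z) zz} (fst z)) * indicator D (slope_at (snd z) (snd (fst z)) - slope_at (snd z) (fst (fst z))) \<partial>?K)"
    unfolding gapm_def by (subst nn_integral_distr; (subst nn_integral_density)?) auto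
  also have "\<dots> = (\<integral>\<^sup>+zz. \<integral>\<^sup>+x. (siegel_wt x * indicator {zz. consec x zz} zz) * indicator D (slope_at x (snd zz) - slope_at x (fst zz)) \<partial>lborel \<partial>count_space UNIV)"
    by (subst lborel.nn_integral_fst[symmetric]) auto
  also have "\<dots> = (\<integral>\<^sup>+x. \<integral>\<^sup>+zz. siegel_wt x * (indicator {zz. consec x zz} zz * indicator D (slope_at x (snd zz) - slope_at x (fst zz))) \<partial>count_space UNIV \<partial>lborel)"
    by (subst nn_integral_count_commute[symmetric]) (auto intro: lborel.sigma_finite_measure_axioms simp: mult.assoc)
  also have "\<dots> = (\<integral>\<^sup>+x. siegel_wt x * cntx D x \<partial>lborel)"
    unfolding cntx_def by (subst nn_integral_cmult) auto
  finally show ?thesis .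
qed

interpretation gapm: finite_measure gapm
  by (rule finite_measureI)
     (use integral_cntx_finite[of UNIV] in \<open>auto simp: emeasure_gapm top_unique\<close>)

lemma gapm_absolutely_continuous: "absolutely_continuous lborel gapm"
  unfolding absolutely_continuous_def
proof
  fix N :: "real set" assume N: "N \<in> null_sets lborel"
  then have [measurable]: "N \<in> sets borel" by auto
  have "AE x in lborel. \<forall>zz. fst zz \<noteq> snd zz \<longrightarrow> in_strip x (fst zz) \<and> in_strip x (snd zz) \<longrightarrow> slope_at x (snd zz) - slope_at x (fst zz) \<notin> N"
    unfolding AE_all_countable using AE_slope_difference[OF N] by auto
  then have "AE x in lborel. siegel_wt x * cntx N x = 0"
  proof eventually_elim
    fix x assume *: "\<forall>zz. fst zz \<noteq> snd zz \<longrightarrow> in_strip x (fst zz) \<and> in_strip x (snd zz) \<longrightarrow> slope_at x (snd zz) - slope_at x (fst zz) \<notin> N"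
    have "cntx N x = (\<integral>\<^sup>+zz. 0 \<partial>(count_space UNIV :: ((int \<times> int) \<times> (int \<times> int)) measure))"
      unfolding cntx_def
    proof (rule nn_integral_cong)
      fix zz
      show "indicator {zz. consec x zz} zz * indicator N (slope_at x (snd zz) - slope_at x (fst zz)) = (0 :: ennreal)"
      proof (cases "consec x zz")
        case True
        then have "fst zz \<noteq> snd zz" "in_strip x (fst zz)" "in_strip x (snd zz)" by (auto simp: consec_def)
        then show ?thesis using * by simp
      qed simp
    qed
    then show "siegel_wt x * cntx N x = 0" by simp
  qed
  then have "emeasure gapm N = 0" by (simp add: emeasure_gapm nn_integral_0_iff_AE)
  then show "N \<in> null_sets gapm" by (intro null_setsI) simp_all
qed

lemma gapm_nonpositive: "emeasure gapm {..0} = 0"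
proof -
  have "cntx {..0} x = (\<integral>\<^sup>+zz. 0 \<partial>(count_space UNIV :: ((int \<times> int) \<times> (int \<times> int)) measure))" for x
    unfolding cntx_def by (intro nn_integral_cong) (auto simp: indicator_def consec_def)
  then show ?thesis by (simp add: emeasure_gapm)
qed

section \<open>Gap statistics of a locally finite set\<close>

definition gap_pairs :: "real set \<Rightarrow> real set \<Rightarrow> real \<Rightarrow> real \<Rightarrow> (real \<times> real) set"
  where "gap_pairs V D a b = {(r, s). r \<in> V \<and> s \<in> V \<and> r < s \<and> (\<forall>t\<in>V. \<not> (r < t \<and> t < s)) \<and> s - r \<in> D \<and> a < s \<and> s \<le> b}"

lemma inj_snd_gap_pairs: "inj_on snd (gap_pairs V D a b)"
proof (rule inj_onI)
  fix x y assume "x \<in> gap_pairs V D a b" "y \<in> gap_pairs V D a b" "snd x = snd y"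
  then show "x = y"
    unfolding gap_pairs_def by (cases x, cases y, simp) (metis linorder_less_linear)
qed

lemma gap_pairs_finite:
  assumes "\<And>a b. finite (V \<inter> {a..b})" shows "finite (gap_pairs V D a b)"
proof -
  have "snd ` gap_pairs V D a b \<subseteq> V \<inter> {a..b}" by (auto simp: gap_pairs_def)
  then have "finite (snd ` gap_pairs V D a b)" by (rule finite_subset) (rule assms)
  then show ?thesis by (rule finite_imageD[OF _ inj_snd_gap_pairs])
qed

text \<open>The deterministic part: \<open>\<sigma>\<close> enumerates the positive elements of a locally finite set \<open>V\<close>
that has positive density, which is measured by its consecutive pairs.\<close>

locale slope_set =
  fixes V :: "real set" and \<sigma> :: "nat \<Rightarrow> real" and E :: real
  assumes fin: "\<And>a b. finite (V \<inter> {a..b})"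
    and \<sigma>_0: "\<sigma> 0 = 0"
    and \<sigma>_Suc: "\<And>n. \<sigma> (Suc n) = (LEAST s. s \<in> V \<inter> {0<..} \<and> \<sigma> n < s)"
    and E_pos: "E > 0"
    and density: "(\<lambda>n. real (card (gap_pairs V UNIV 0 (real n))) / real n) \<longlonglongrightarrow> E"
begin

lemma unbounded: "\<exists>s\<in>V. B < s"
proof (rule ccontr)
  assume "\<not> ?thesis"
  then have B: "\<And>s. s \<in> V \<Longrightarrow> s \<le> B" by (auto simp: not_less)
  define K where "K = card (V \<inter> {0..B})"
  have "card (gap_pairs V UNIV 0 (real n)) \<le> K" for n
  proof -
    have "card (gap_pairs V UNIV 0 (real n)) = card (snd ` gap_pairs V UNIV 0 (real n))"
      by (rule card_image[OF inj_snd_gap_pairs, symmetric])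
    also have "\<dots> \<le> K" unfolding K_def
      by (rule card_mono[OF fin]) (auto simp: gap_pairs_def B)
    finally show ?thesis .
  qed
  then have "\<And>n. real (card (gap_pairs V UNIV 0 (real n))) / real n \<le> real K / real n"
    by (intro divide_right_mono) simp_all
  then have "E \<le> 0"
    by (intro LIMSEQ_le[OF density lim_const_over_n[of "real K"]]) blast
  then show False using E_pos by simp
qed

lemma \<sigma>_least:
  "\<sigma> (Suc n) \<in> V" "0 < \<sigma> (Suc n)" "\<sigma> n < \<sigma> (Suc n)"
  "\<And>s. s \<in> V \<Longrightarrow> 0 < s \<Longrightarrow> \<sigma> n < s \<Longrightarrow> \<sigma> (Suc n) \<le> s"
proof -
  let ?P = "\<lambda>s. s \<in> V \<inter> {0<..} \<and> \<sigma> n < s"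
  obtain s0 where s0: "s0 \<in> V" "max 0 (\<sigma> n) < s0" using unbounded by blast
  define F where "F = {s \<in> V \<inter> {0..s0}. ?P s}"
  have F: "finite F" unfolding F_def by (rule finite_subset[OF _ fin[of 0 s0]]) auto
  have ne: "s0 \<in> F" using s0 by (auto simp: F_def)
  have PF: "Min F \<in> F" using F ne by (intro Min_in) auto
  have "\<sigma> (Suc n) = Min F" unfolding \<sigma>_Suc
  proof (rule Least_equality)
    show "?P (Min F)" using PF by (auto simp: F_def)
    fix y assume y: "?P y"
    show "Min F \<le> y"
    proof (cases "y \<le> s0")
      case True then have "y \<in> F" using y by (auto simp: F_def)
      then show ?thesis using F by simp
    next
      case False then show ?thesis using Min_le[OF F ne] by simp
    qed
  qed
  moreover have least: "Min F \<le> y" if y: "?P y" for y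
  proof (cases "y \<le> s0")
    case True then have "y \<in> F" using y by (auto simp: F_def)
    then show ?thesis using F by simp
  next
    case False then show ?thesis using Min_le[OF F ne] by simp
  qed
  ultimately show "\<sigma> (Suc n) \<in> V" "0 < \<sigma> (Suc n)" "\<sigma> n < \<sigma> (Suc n)"
    "\<And>s. s \<in> V \<Longrightarrow> 0 < s \<Longrightarrow> \<sigma> n < s \<Longrightarrow> \<sigma> (Suc n) \<le> s"
    using PF by (auto simp: F_def)
qed

lemma \<sigma>_mono: "strict_mono \<sigma>"
  by (rule strict_mono_Suc_iff[THEN iffD2]) (simp add: \<sigma>_least)

lemma \<sigma>_less_iff: "\<sigma> i < \<sigma> j \<longleftrightarrow> i < j" and \<sigma>_le_iff: "\<sigma> i \<le> \<sigma> j \<longleftrightarrow> i \<le> j"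
  using \<sigma>_mono by (simp_all add: strict_mono_less strict_mono_less_eq)

lemma \<sigma>_nonneg: "0 \<le> \<sigma> i"
  using \<sigma>_le_iff[of 0 i] \<sigma>_0 by simp

lemma \<sigma>_in: "1 \<le> i \<Longrightarrow> \<sigma> i \<in> V" "1 \<le> i \<Longrightarrow> 0 < \<sigma> i"
  using \<sigma>_least[of "i - 1"] by simp_all

lemma finite_below: "finite {i. \<sigma> i \<le> b}"
proof -
  have "\<sigma> ` {i. 1 \<le> i \<and> \<sigma> i \<le> b} \<subseteq> V \<inter> {0..b}" using \<sigma>_in by (auto simp: \<sigma>_nonneg)
  then have "finite (\<sigma> ` {i. 1 \<le> i \<and> \<sigma> i \<le> b})" by (rule finite_subset) (rule fin)
  then have "finite {i. 1 \<le> i \<and> \<sigma> i \<le> b}"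
    by (rule finite_imageD) (use \<sigma>_mono in \<open>auto intro: inj_on_subset strict_mono_imp_inj_on\<close>)
  then have "finite (insert 0 {i. 1 \<le> i \<and> \<sigma> i \<le> b})" by simp
  then show ?thesis by (rule finite_subset[rotated]) auto
qed

lemma \<sigma>_surj:
  assumes s: "s \<in> V" "0 < s" shows "\<exists>i\<ge>1. s = \<sigma> i"
proof -
  let ?I = "{i. \<sigma> i < s}"
  have fI: "finite ?I" by (rule finite_subset[OF _ finite_below[of s]]) auto
  have "0 \<in> ?I" using s \<sigma>_0 by simp
  then have "Max ?I \<in> ?I" using fI by (intro Max_in) auto
  then have "\<sigma> (Suc (Max ?I)) \<le> s" using \<sigma>_least(4) s by simp
  moreover have "Suc (Max ?I) \<notin> ?I" using Max_ge[OF fI, of "Suc (Max ?I)"] by auto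
  ultimately have "s = \<sigma> (Suc (Max ?I))" by simp
  then show ?thesis by (intro exI[of _ "Suc (Max ?I)"]) simp
qed

lemma \<sigma>_at_top: "filterlim \<sigma> at_top sequentially"
  unfolding filterlim_at_top
proof
  fix b
  obtain s where s: "s \<in> V" "max 0 b < s" using unbounded by blast
  then obtain i where i: "s = \<sigma> i" using \<sigma>_surj[of s] by auto
  show "\<forall>\<^sub>F n in sequentially. b \<le> \<sigma> n"
  proof (rule eventually_sequentiallyI[of i])
    fix n assume "i \<le> n"
    then have "\<sigma> i \<le> \<sigma> n" by (simp add: \<sigma>_le_iff)
    then show "b \<le> \<sigma> n" using s i by simp
  qed
qed

definition K :: "nat \<Rightarrow> nat" where "K n = card {i. 1 \<le> i \<and> \<sigma> i \<le> real n}"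

lemma K_set: "{i. 1 \<le> i \<and> \<sigma> i \<le> real n} = {1..K n}"
proof -
  let ?A = "{i. 1 \<le> i \<and> \<sigma> i \<le> real n}"
  have fA: "finite ?A" by (rule finite_subset[OF _ finite_below[of "real n"]]) auto
  have "?A = {1..(if ?A = {} then 0 else Max ?A)}"
  proof (cases "?A = {}")
    case False
    have mx: "Max ?A \<in> ?A" using fA False by (rule Max_in)
    show ?thesis
    proof (rule set_eqI)
      fix i
      show "i \<in> ?A \<longleftrightarrow> i \<in> {1..(if ?A = {} then 0 else Max ?A)}"
      proof
        assume "i \<in> ?A" then show "i \<in> {1..(if ?A = {} then 0 else Max ?A)}" using Max_ge[OF fA] False by auto
      next
        assume "i \<in> {1..(if ?A = {} then 0 else Max ?A)}"
        then have i: "1 \<le> i" "i \<le> Max ?A" using False by (auto split: if_splits)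
        then have "\<sigma> i \<le> \<sigma> (Max ?A)" by (simp add: \<sigma>_le_iff)
        then show "i \<in> ?A" using mx i by auto
      qed
    qed
  qed simp
  then obtain m where "?A = {1..m}" by blast
  then show ?thesis unfolding K_def by simp
qed

definition hits :: "real set \<Rightarrow> nat \<Rightarrow> nat"
  where "hits D N = card {i\<in>{1..N}. \<sigma> i - \<sigma> (i - 1) \<in> D}"

lemma hits_mono: "M \<le> N \<Longrightarrow> hits D M \<le> hits D N"
  unfolding hits_def by (intro card_mono) auto

lemma hits_UNIV: "hits UNIV N = N"
proof -
  have "{i\<in>{1..N}. \<sigma> i - \<sigma> (i - 1) \<in> UNIV} = {1..N}" by auto
  then show ?thesis by (simp only: hits_def card_atLeastAtMost)
qed

text \<open>Sending \<open>i\<close> to the pair of \<open>\<sigma> (i - 1)\<close> and \<open>\<sigma> i\<close> matches gaps and consecutive pairs, except at \<open>i = 1\<close>: the first gap starts at \<open>0\<close>,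
while the predecessor of \<open>\<sigma> 1\<close> in \<open>V\<close> is nonpositive or does not exist.\<close>

lemma hits_gap_pairs:
  "\<bar>real (hits D (K n)) - real (card (gap_pairs V D 0 (real n)))\<bar> \<le> 1"
proof -
  define A where "A = {i\<in>{2..K n}. \<sigma> i - \<sigma> (i - 1) \<in> D}"
  define H where "H = {i\<in>{1..K n}. \<sigma> i - \<sigma> (i - 1) \<in> D}"
  define G where "G = gap_pairs V D 0 (real n)"
  let ?f = "\<lambda>i. (\<sigma> (i - 1), \<sigma> i)"
  have finG: "finite G" by (simp add: G_def gap_pairs_finite[OF fin])
  have K: "i \<in> {1..K n} \<longleftrightarrow> 1 \<le> i \<and> \<sigma> i \<le> real n" for i using K_set[of n] by blast
  have inj: "inj_on ?f A"
    by (rule inj_onI) (use strict_mono_eq[OF \<sigma>_mono] in simp)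
  have sub: "?f ` A \<subseteq> G"
  proof
    fix y assume "y \<in> ?f ` A"
    then obtain i where i: "i \<in> A" and y: "y = ?f i" by blast
    then have i2: "2 \<le> i" "\<sigma> i \<le> real n" "\<sigma> i - \<sigma> (i - 1) \<in> D" using K[of i] by (auto simp: A_def)
    have "\<not> (\<sigma> (i - 1) < t \<and> t < \<sigma> i)" if "t \<in> V" for t
    proof
      assume *: "\<sigma> (i - 1) < t \<and> t < \<sigma> i"
      moreover have "0 < t" using * \<sigma>_nonneg[of "i - 1"] by linarith
      ultimately have "\<sigma> (Suc (i - 1)) \<le> t" using \<sigma>_least(4)[of t "i - 1"] that by blast
      then show False using * i2 by simp
    qed
    then show "y \<in> G" using i2 \<sigma>_in[of i] \<sigma>_in[of "i - 1"] \<sigma>_less_iff[of "i - 1" i]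
      by (auto simp: y G_def gap_pairs_def)
  qed
  have rest: "snd ` (G - ?f ` A) \<subseteq> {\<sigma> 1}"
  proof
    fix s assume "s \<in> snd ` (G - ?f ` A)"
    then obtain r where rs: "(r, s) \<in> G" "(r, s) \<notin> ?f ` A" by auto
    then have sV: "s \<in> V" "0 < s" "s \<le> real n" by (auto simp: G_def gap_pairs_def)
    then obtain i where i: "1 \<le> i" "s = \<sigma> i" using \<sigma>_surj by blast
    show "s \<in> {\<sigma> 1}"
    proof (rule ccontr)
      assume "s \<notin> {\<sigma> 1}"
      then have "i \<noteq> 1" using i by auto
      then have i2: "2 \<le> i" using i by simp
      have "r = \<sigma> (i - 1)"
      proof -
        have *: "\<sigma> (i - 1) \<in> V" "\<sigma> (i - 1) < s" using i i2 \<sigma>_in[of "i - 1"] \<sigma>_less_iff[of "i - 1" i] by auto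
        then have "\<sigma> (i - 1) \<le> r" using rs(1) by (auto simp: G_def gap_pairs_def not_less)
        moreover have "\<not> \<sigma> (i - 1) < r"
        proof
          assume l: "\<sigma> (i - 1) < r"
          then have "0 < r" using \<sigma>_nonneg[of "i - 1"] by linarith
          then have "\<sigma> (Suc (i - 1)) \<le> r" using l rs(1) \<sigma>_least(4)[of r "i - 1"] by (auto simp: G_def gap_pairs_def)
          then show False using i rs(1) by (auto simp: G_def gap_pairs_def)
        qed
        ultimately show ?thesis by simp
      qed
      then have "i \<in> A" using rs(1) i i2 sV K[of i] by (auto simp: A_def G_def gap_pairs_def)
      then show False using rs(2) \<open>r = \<sigma> (i - 1)\<close> i by auto
    qed
  qed
  have c1: "card A \<le> card G"
    using card_mono[OF finG sub] card_image[OF inj] by simp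
  have c2: "card G \<le> card A + 1"
  proof -
    have "card (G - ?f ` A) = card (snd ` (G - ?f ` A))"
      by (rule card_image[symmetric], rule inj_on_subset[OF inj_snd_gap_pairs[of V D 0 "real n"]]) (auto simp: G_def)
    also have "\<dots> \<le> card {\<sigma> 1}" by (rule card_mono[OF _ rest]) simp
    finally have "card (G - ?f ` A) \<le> 1" by simp
    moreover have "card G = card (?f ` A) + card (G - ?f ` A)"
      using finG sub by (metis card_Diff_subset card_mono finite_subset le_add_diff_inverse)
    ultimately show ?thesis using card_image[OF inj] by simp
  qed
  have "A \<subseteq> H" "H \<subseteq> insert 1 A" by (auto simp: A_def H_def)
  moreover have "finite A" "finite H" by (simp_all add: A_def H_def)
  ultimately have c3: "card A \<le> card H" "card H \<le> card A + 1"
    using card_mono[of H A] card_mono[of "insert 1 A" H] by (auto simp: card_insert_if split: if_splits)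
  show ?thesis using c1 c2 c3 unfolding hits_def H_def[symmetric] G_def[symmetric] by linarith
qed

text \<open>The hypotheses count up to integer heights, the conclusion counts the first \<open>N\<close> gaps. With \<open>t\<close> the integer
part of \<open>\<sigma> N\<close> one has \<open>K t \<le> N \<le> K (t + 1)\<close>, and counts are monotone.\<close>

lemma hits_limit:
  assumes D: "(\<lambda>n. real (card (gap_pairs V D 0 (real n))) / real n) \<longlonglongrightarrow> e"
  shows "(\<lambda>N. real (hits D N) / real N) \<longlonglongrightarrow> e / E"
proof -
  have lim: "(\<lambda>n. real (hits D' (K n)) / real n) \<longlonglongrightarrow> e'"
    if "(\<lambda>n. real (card (gap_pairs V D' 0 (real n))) / real n) \<longlonglongrightarrow> e'" for D' e'
  proof -
    have "(\<lambda>n. real (hits D' (K n)) / real n - real (card (gap_pairs V D' 0 (real n))) / real n) \<longlonglongrightarrow> 0"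
    proof (rule Lim_null_comparison[OF _ lim_1_over_n])
      have "norm (real (hits D' (K n)) / real n - real (card (gap_pairs V D' 0 (real n))) / real n) \<le> 1 / real n" for n
        using hits_gap_pairs[of D' n] by (simp add: diff_divide_distrib[symmetric] abs_divide divide_right_mono)
      then show "\<forall>\<^sub>F n in sequentially. norm (real (hits D' (K n)) / real n - real (card (gap_pairs V D' 0 (real n))) / real n) \<le> 1 / real n"
        by (intro always_eventually allI)
    qed
    from tendsto_add[OF this that] show ?thesis by simp
  qed
  note a = lim[OF D]
  have b: "(\<lambda>n. real (K n) / real n) \<longlonglongrightarrow> E" using lim[OF density] by (simp add: hits_UNIV)
  have quot: "(\<lambda>n. real (Suc n) / real n) \<longlonglongrightarrow> 1" using LIMSEQ_Suc_n_over_n by simp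
  have quot': "(\<lambda>n. real n / real (Suc n)) \<longlonglongrightarrow> 1" using LIMSEQ_n_over_Suc_n by simp
  have up: "(\<lambda>n. real (hits D (K (Suc n))) / real (K n)) \<longlonglongrightarrow> e / E"
  proof -
    have "(\<lambda>n. (real (hits D (K (Suc n))) / real (Suc n)) * (real (Suc n) / real n) / (real (K n) / real n)) \<longlonglongrightarrow> e * 1 / E"
      using E_pos by (intro tendsto_divide tendsto_mult LIMSEQ_Suc[OF a] quot b) auto
    moreover have "\<forall>\<^sub>F n in sequentially. (real (hits D (K (Suc n))) / real (Suc n)) * (real (Suc n) / real n) / (real (K n) / real n)
       = real (hits D (K (Suc n))) / real (K n)"
      by (rule eventually_sequentiallyI[of 1]) (simp add: field_simps del: of_nat_Suc)
    ultimately show ?thesis using Lim_transform_eventually by force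
  qed
  have lo: "(\<lambda>n. real (hits D (K n)) / real (K (Suc n))) \<longlonglongrightarrow> e / E"
  proof -
    have "(\<lambda>n. (real (hits D (K n)) / real n) * (real n / real (Suc n)) / (real (K (Suc n)) / real (Suc n))) \<longlonglongrightarrow> e * 1 / E"
      using E_pos by (intro tendsto_divide tendsto_mult a quot' LIMSEQ_Suc[OF b]) auto
    moreover have "\<forall>\<^sub>F n in sequentially. (real (hits D (K n)) / real n) * (real n / real (Suc n)) / (real (K (Suc n)) / real (Suc n))
       = real (hits D (K n)) / real (K (Suc n))"
      by (rule eventually_sequentiallyI[of 1]) (simp add: field_simps del: of_nat_Suc)
    ultimately show ?thesis using Lim_transform_eventually by force
  qed
  define t where "t N = nat \<lfloor>\<sigma> N\<rfloor>" for N
  have t_top: "filterlim t at_top sequentially"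
    unfolding t_def
    by (intro filterlim_compose[OF filterlim_nat_sequentially] filterlim_compose[OF filterlim_floor_sequentially] \<sigma>_at_top)
  have b_top: "\<forall>\<^sub>F n in sequentially. 0 < K n"
  proof -
    have "\<forall>\<^sub>F n in sequentially. 0 < real (K n) / real n" using order_tendstoD(1)[OF b E_pos] .
    then show ?thesis by eventually_elim (auto intro: ccontr)
  qed
  have bounds: "K (t N) \<le> N" "N \<le> K (Suc (t N))" if N: "1 \<le> N" for N
  proof -
    have tN: "real (t N) \<le> \<sigma> N" "\<sigma> N < real (Suc (t N))"
      using \<sigma>_nonneg[of N] by (simp_all add: t_def) linarith
    show "K (t N) \<le> N"
    proof (rule ccontr)
      assume "\<not> K (t N) \<le> N"
      then have "Suc N \<in> {1..K (t N)}" by simp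
      then have "\<sigma> (Suc N) \<le> real (t N)" using K_set[of "t N"] by blast
      then show False using tN \<sigma>_least(3)[of N] by linarith
    qed
    have "N \<in> {i. 1 \<le> i \<and> \<sigma> i \<le> real (Suc (t N))}" using tN N by simp
    then show "N \<le> K (Suc (t N))" unfolding K_set by simp
  qed
  show ?thesis
  proof (rule tendsto_sandwich)
    show "(\<lambda>N. real (hits D (K (t N))) / real (K (Suc (t N)))) \<longlonglongrightarrow> e / E" by (rule filterlim_compose[OF lo t_top])
    show "(\<lambda>N. real (hits D (K (Suc (t N)))) / real (K (t N))) \<longlonglongrightarrow> e / E" by (rule filterlim_compose[OF up t_top])
    show "\<forall>\<^sub>F N in sequentially. real (hits D (K (t N))) / real (K (Suc (t N))) \<le> real (hits D N) / real N"
    proof (rule eventually_sequentiallyI[of 1])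
      fix N :: nat assume N: "1 \<le> N"
      show "real (hits D (K (t N))) / real (K (Suc (t N))) \<le> real (hits D N) / real N"
        using bounds[OF N] N by (intro frac_le) (auto intro: hits_mono)
    qed
    have "\<forall>\<^sub>F N in sequentially. 0 < K (t N)" using filterlim_iff[THEN iffD1, OF t_top] b_top by blast
    then show "\<forall>\<^sub>F N in sequentially. real (hits D N) / real N \<le> real (hits D (K (Suc (t N)))) / real (K (t N))"
      using eventually_ge_at_top[of 1]
    proof eventually_elim
      fix N assume N: "0 < K (t N)" "1 \<le> N"
      show "real (hits D N) / real N \<le> real (hits D (K (Suc (t N)))) / real (K (t N))"
        using bounds[OF N(2)] N by (intro frac_le) (auto intro: hits_mono)
    qed
  qed
qed

end

section \<open>Slopes of a lattice\<close>

definition slope_of :: "(real^2) set \<Rightarrow> real set" where "slope_of \<Lambda> = sl ` vpts \<Lambda>"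

lemma slopes_eq: "slopes \<Lambda> = slope_of \<Lambda> \<inter> {0<..}"
  by (auto simp: slopes_def slope_of_def strip_def vpts_def sl_def zero_less_divide_iff)

lemma vpts_nlat: "adet x > 0 \<Longrightarrow> vpts (nlat x) = nlat_pt x ` {z. in_strip x z}"
  by (rule set_eqI) (simp add: vpts_range image_iff conj_commute)

lemma slope_of_nlat: "adet x > 0 \<Longrightarrow> slope_of (nlat x) = slope_at x ` {z. in_strip x z}"
  by (simp add: slope_of_def vpts_nlat image_image sl_nlat_pt)

lemma finite_slopes:
  assumes "\<omega> \<in> AX2" shows "finite (slope_of \<omega> \<inter> {a..b})"
proof -
  obtain x where x: "adet x = 1" "\<omega> = nlat x" using AX2_nlat[OF assms] by blast
  define B where "B = max 1 (max \<bar>a\<bar> \<bar>b\<bar>)"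
  let ?Z = "{(m :: int, n :: int). \<bar>ca x * m + cb x * n + cp x\<bar> \<le> B \<and> \<bar>cc x * m + cd x * n + cq x\<bar> \<le> B}"
  have "slope_of \<omega> \<inter> {a..b} \<subseteq> slope_at x ` ?Z"
  proof
    fix s assume "s \<in> slope_of \<omega> \<inter> {a..b}"
    then obtain z where z: "s = slope_at x z" "in_strip x z" and s: "a \<le> s" "s \<le> b" using x by (auto simp: slope_of_nlat)
    have p: "0 < px x z" "px x z \<le> 1" using z x by (simp_all add: in_strip_def)
    have "py x z = s * px x z" using z p by (simp add: slope_at_def)
    then have "\<bar>py x z\<bar> = \<bar>s\<bar> * px x z" using p by (simp add: abs_mult)
    also have "\<dots> \<le> \<bar>s\<bar> * 1" using p by (intro mult_left_mono) auto
    also have "\<dots> \<le> B" using s by (auto simp: B_def)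
    finally have "\<bar>py x z\<bar> \<le> B" .
    moreover have "\<bar>px x z\<bar> \<le> B" using p by (simp add: B_def)
    ultimately have "z \<in> ?Z" by (simp add: px_eq py_eq case_prod_beta)
    then show "s \<in> slope_at x ` ?Z" using z by blast
  qed
  moreover have "finite ?Z" using x by (intro finite_lattice_points) simp
  ultimately show ?thesis by (blast intro: finite_subset)
qed

definition simple_slopes :: "(real^2) set \<Rightarrow> bool" where "simple_slopes \<Lambda> \<longleftrightarrow> inj_on sl (vpts \<Lambda>)"

lemma simple_slopes_nlat: "adet x > 0 \<Longrightarrow> simple_slopes (nlat x) \<longleftrightarrow> distinct_slopes x"
proof -
  assume x: "adet x > 0"
  have "simple_slopes (nlat x) \<longleftrightarrow> (\<forall>z z'. in_strip x z \<and> in_strip x z' \<and> slope_at x z = slope_at x z' \<longrightarrow> nlat_pt x z = nlat_pt x z')"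
    unfolding simple_slopes_def vpts_nlat[OF x] inj_on_def by (simp add: sl_nlat_pt[OF x]) blast
  also have "\<dots> \<longleftrightarrow> distinct_slopes x"
    unfolding distinct_slopes_def using inj_nlat_pt[OF x] by (simp add: inj_eq)
  finally show ?thesis .
qed

lemma AE_muI:
  assumes P: "{x. adet x > 0 \<and> \<not> P (nlat x)} \<in> sets borel" and AE: "AE x in lborel. adet x > 0 \<longrightarrow> P (nlat x)"
  shows "AE \<omega> in mu. P \<omega>"
proof -
  let ?S = "{\<omega>\<in>AX2. \<not> P \<omega>}"
  have "lift ?S = {x. adet x > 0 \<and> \<not> P (nlat x)}" by (auto simp: lift_def nlat_AX2)
  then have S: "?S \<in> sets borel_AX2" using P by (intro sets_AX2I) auto
  have "AE x in lborel. adet x > 0 \<longrightarrow> nlat x \<notin> ?S" using AE by eventually_elim simp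
  then have "emeasure mu ?S = 0" by (simp add: mu_null_iff[OF S])
  then have "?S \<in> null_sets mu" using S by (intro null_setsI) simp_all
  then show ?thesis by (rule AE_I') simp
qed

lemma AE_simple_slopes: "AE \<omega> in mu. simple_slopes \<omega>"
proof (rule AE_muI)
  have "{x. adet x > 0 \<and> \<not> simple_slopes (nlat x)} = {x. adet x > 0 \<and> \<not> distinct_slopes x}"
    using simple_slopes_nlat by blast
  also have "\<dots> \<in> sets borel" unfolding distinct_slopes_def by measurable
  finally show "{x. adet x > 0 \<and> \<not> simple_slopes (nlat x)} \<in> sets borel" .
  show "AE x in lborel. adet x > 0 \<longrightarrow> simple_slopes (nlat x)"
    using AE_distinct_slopes by eventually_elim (simp add: simple_slopes_nlat)
qed

lemma cnt_gap_pairs: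
  assumes "simple_slopes \<omega>"
  shows "cnt D \<omega> = emeasure (count_space UNIV) (gap_pairs (slope_of \<omega>) D 0 1)"
proof -
  let ?A = "{(P, Q) \<in> gpairs \<omega> D. 0 < sl Q \<and> sl Q \<le> 1}"
  have inj: "inj_on (map_prod sl sl) ?A"
    by (rule inj_on_subset[OF map_prod_inj_on[OF assms[unfolded simple_slopes_def] assms[unfolded simple_slopes_def]]])
       (auto simp: gpairs_def)
  have im: "gap_pairs (slope_of \<omega>) D 0 1 = map_prod sl sl ` ?A"
    by (auto simp: gap_pairs_def gpairs_def slope_of_def image_iff Bex_def)
  have "emeasure (count_space UNIV) (map_prod sl sl ` ?A) = emeasure (count_space UNIV) ?A"
    by (cases "finite ?A") (simp_all add: emeasure_count_space card_image[OF inj] finite_image_iff[OF inj])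
  then show ?thesis by (simp add: cnt_def im)
qed

lemma vpts_step: "vpts (step \<omega>) = (\<lambda>P. step_mat *v P) ` vpts \<omega>"
  by (auto simp: vpts_def step_def SL2_act_def step_mat_def matrix_vector_mult_def sum_2)

lemma sl_step: "P \<in> vpts \<omega> \<Longrightarrow> sl (step_mat *v P) = sl P - 1"
  by (auto simp: vpts_def sl_def step_mat_def matrix_vector_mult_def sum_2 field_simps)

lemma slope_of_step: "slope_of (step \<omega>) = (\<lambda>s. s - 1) ` slope_of \<omega>"
  unfolding slope_of_def vpts_step image_image by (intro image_cong refl) (simp add: sl_step)

lemma simple_slopes_step: "simple_slopes \<omega> \<Longrightarrow> simple_slopes (step \<omega>)"
  unfolding simple_slopes_def vpts_step inj_on_def by (auto simp: sl_step)

lemma slope_of_step_pow: "slope_of ((step ^^ k) \<omega>) = (\<lambda>s. s - real k) ` slope_of \<omega>"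
  by (induction k) (auto simp: slope_of_step image_image algebra_simps)

lemma simple_slopes_step_pow: "simple_slopes \<omega> \<Longrightarrow> simple_slopes ((step ^^ k) \<omega>)"
  by (induction k) (auto intro: simple_slopes_step)

lemma gap_pairs_shift:
  "gap_pairs ((\<lambda>s. s - c) ` V) D a b = map_prod (\<lambda>s. s - c) (\<lambda>s. s - c) ` gap_pairs V D (a + c) (b + c)"
proof
  show "gap_pairs ((\<lambda>s. s - c) ` V) D a b \<subseteq> map_prod (\<lambda>s. s - c) (\<lambda>s. s - c) ` gap_pairs V D (a + c) (b + c)"
  proof
    fix y assume "y \<in> gap_pairs ((\<lambda>s. s - c) ` V) D a b"
    then obtain r s where y: "y = (r - c, s - c)" "(r, s) \<in> gap_pairs V D (a + c) (b + c)"
      by (auto simp: gap_pairs_def)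
    then show "y \<in> map_prod (\<lambda>s. s - c) (\<lambda>s. s - c) ` gap_pairs V D (a + c) (b + c)"
      by (intro image_eqI[of _ _ "(r, s)"]) simp_all
  qed
qed (auto simp: gap_pairs_def)

lemma cnt_step_pow:
  assumes "simple_slopes \<omega>"
  shows "cnt D ((step ^^ k) \<omega>) = emeasure (count_space UNIV) (gap_pairs (slope_of \<omega>) D (real k) (real (Suc k)))"
proof -
  have inj: "inj_on (map_prod (\<lambda>s. s - real k) (\<lambda>s. s - real k)) A" for A by (rule inj_onI) (auto simp: map_prod_def)
  have "cnt D ((step ^^ k) \<omega>) = emeasure (count_space UNIV)
    (map_prod (\<lambda>s. s - real k) (\<lambda>s. s - real k) ` gap_pairs (slope_of \<omega>) D (real k) (real (Suc k)))"
    by (simp add: cnt_gap_pairs[OF simple_slopes_step_pow[OF assms]] slope_of_step_pow gap_pairs_shift add.commute)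
  then show ?thesis
    by (cases "finite (gap_pairs (slope_of \<omega>) D (real k) (real (Suc k)))")
       (simp_all add: emeasure_count_space card_image[OF inj] finite_image_iff[OF inj])
qed

text \<open>The \<open>k\<close>-th step of the shear brings the slopes in \<open>(k, k + 1]\<close> to \<open>(0, 1]\<close>.\<close>

lemma sum_cnt:
  assumes \<omega>: "\<omega> \<in> AX2" "simple_slopes \<omega>"
  shows "(\<Sum>k<n. enn2real (cnt D ((step ^^ k) \<omega>))) = real (card (gap_pairs (slope_of \<omega>) D 0 (real n)))"
proof (induction n)
  case 0
  have "gap_pairs (slope_of \<omega>) D 0 0 = {}" by (auto simp: gap_pairs_def)
  then show ?case by simp
next
  case (Suc n)
  note fin = gap_pairs_finite[OF finite_slopes[OF \<omega>(1)]]
  have "gap_pairs (slope_of \<omega>) D 0 (real (Suc n)) = gap_pairs (slope_of \<omega>) D 0 (real n) \<union> gap_pairs (slope_of \<omega>) D (real n) (real (Suc n))"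
    by (auto simp: gap_pairs_def)
  then have "card (gap_pairs (slope_of \<omega>) D 0 (real (Suc n))) = card (gap_pairs (slope_of \<omega>) D 0 (real n)) + card (gap_pairs (slope_of \<omega>) D (real n) (real (Suc n)))"
    by (simp only:) (intro card_Un_disjoint fin, auto simp: gap_pairs_def)
  moreover have "enn2real (cnt D ((step ^^ n) \<omega>)) = real (card (gap_pairs (slope_of \<omega>) D (real n) (real (Suc n))))"
    using fin[of D "real n" "real (Suc n)"] unfolding cnt_step_pow[OF \<omega>(2)]
    by (simp add: emeasure_count_space_finite)
  ultimately show ?case using Suc by simp
qed

section \<open>Equidistribution of gaps\<close>

interpretation step: ergodic_system mu step by (rule ergodic_step)

lemma vol_real_pos: "enn2real vol > 0"
  using vol_pos vol_finite by (simp add: enn2real_positive_iff zero_less_iff_neq_zero)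

lemma ennreal_vol: "ennreal (enn2real vol) = vol"
  by (rule ennreal_enn2real) (use vol_finite in simp)

definition dens :: "real set \<Rightarrow> real" where "dens D = measure gapm D / enn2real vol"

lemma integral_cnt_gapm: "D \<in> sets borel \<Longrightarrow> (\<integral>\<^sup>+\<omega>. cnt D \<omega> \<partial>mu) = emeasure gapm D / vol"
  by (simp add: integral_cnt emeasure_gapm)

lemma integrable_cnt:
  assumes D: "D \<in> sets borel"
  shows "integrable mu (\<lambda>\<omega>. enn2real (cnt D \<omega>))" "(\<integral>\<omega>. enn2real (cnt D \<omega>) \<partial>mu) = dens D"
proof -
  have [measurable]: "cnt D \<in> borel_measurable mu" using cnt_measurable[OF D] by simp
  have "emeasure gapm D / vol = ennreal (dens D)"
    using divide_ennreal[OF measure_nonneg vol_real_pos, of gapm D]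
    by (simp only: dens_def gapm.emeasure_eq_measure ennreal_vol)
  then have fin: "(\<integral>\<^sup>+\<omega>. cnt D \<omega> \<partial>mu) = ennreal (dens D)" by (simp add: integral_cnt_gapm[OF D])
  then have "AE \<omega> in mu. cnt D \<omega> \<noteq> \<infinity>" by (intro nn_integral_PInf_AE) simp_all
  then have "AE \<omega> in mu. ennreal (enn2real (cnt D \<omega>)) = cnt D \<omega>" by eventually_elim (simp add: less_top)
  then have eq: "(\<integral>\<^sup>+\<omega>. ennreal (enn2real (cnt D \<omega>)) \<partial>mu) = ennreal (dens D)"
    unfolding fin[symmetric] by (rule nn_integral_cong_AE)
  then show "integrable mu (\<lambda>\<omega>. enn2real (cnt D \<omega>))"
    by (intro integrableI_nonneg) simp_all
  have "0 \<le> dens D" by (simp add: dens_def)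
  then show "(\<integral>\<omega>. enn2real (cnt D \<omega>) \<partial>mu) = dens D"
    using eq by (subst integral_eq_nn_integral) simp_all
qed

lemma AE_gap_pairs_limit:
  assumes D: "D \<in> sets borel"
  shows "AE \<omega> in mu. (\<lambda>n. real (card (gap_pairs (slope_of \<omega>) D 0 (real n))) / real n) \<longlonglongrightarrow> dens D"
  using step.birkhoff[OF integrable_cnt(1)[OF D]] AE_simple_slopes AE_space[of mu]
  by eventually_elim (simp add: sum_cnt integrable_cnt(2)[OF D])

lemma consecutive_exists:
  assumes fin: "\<And>a b. finite (V \<inter> {a..b})" and rs: "r \<in> V" "s \<in> V" "r < s" "0 < s"
  shows "\<exists>k. gap_pairs V UNIV (real k) (real (Suc k)) \<noteq> {}"
proof -
  let ?F = "{t \<in> V \<inter> {r..s}. t < s}"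
  have F: "finite ?F" by (rule finite_subset[OF _ fin[of r s]]) auto
  have "r \<in> ?F" using rs by simp
  then have M: "Max ?F \<in> ?F" using F by (intro Max_in) auto
  have no: "\<not> (Max ?F < t \<and> t < s)" if "t \<in> V" for t
  proof
    assume t: "Max ?F < t \<and> t < s"
    then have "t \<in> ?F" using that M by auto
    then show False using Max_ge[OF F, of t] t by simp
  qed
  define k where "k = nat (\<lceil>s\<rceil> - 1)"
  have "0 < \<lceil>s\<rceil>" using rs by simp
  then have k: "real k = of_int \<lceil>s\<rceil> - 1" by (simp add: k_def)
  have "real k < s" "s \<le> real (Suc k)" using k ceiling_correct[of s] by simp_all
  then have "(Max ?F, s) \<in> gap_pairs V UNIV (real k) (real (Suc k))"
    using M no rs by (auto simp: gap_pairs_def)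
  then show ?thesis by blast
qed

text \<open>Otherwise almost no lattice would have two distinct positive slopes, but a
nonempty open set of lattices does.\<close>

lemma total_positive: "measure gapm UNIV > 0"
proof (rule ccontr)
  assume "\<not> ?thesis"
  then have "emeasure gapm UNIV = 0" using measure_nonneg[of gapm UNIV] by (simp add: gapm.emeasure_eq_measure)
  then have "(\<integral>\<^sup>+\<omega>. cnt UNIV \<omega> \<partial>mu) = 0" by (simp add: integral_cnt_gapm)
  then have "AE \<omega> in mu. cnt UNIV \<omega> = 0"
    using cnt_measurable[of UNIV] by (subst (asm) nn_integral_0_iff_AE) simp_all
  then have "AE \<omega> in mu. cnt UNIV ((step ^^ k) \<omega>) = 0" for k
  proof (induction k)
    case (Suc k)
    from step.T_AE[OF Suc(1)[OF Suc(2)]] show ?case by (simp only: funpow_Suc_right o_apply)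
  qed simp
  then have "AE \<omega> in mu. \<forall>k. cnt UNIV ((step ^^ k) \<omega>) = 0" by (simp add: AE_all_countable)
  define two where "two \<omega> \<longleftrightarrow> (\<exists>r\<in>slope_of \<omega>. \<exists>s\<in>slope_of \<omega>. 0 < r \<and> r < s)" for \<omega>
  have "AE \<omega> in mu. \<not> two \<omega>"
    using \<open>AE \<omega> in mu. \<forall>k. cnt UNIV ((step ^^ k) \<omega>) = 0\<close> AE_simple_slopes AE_space[of mu]
  proof eventually_elim
    fix \<omega> assume \<omega>: "\<forall>k. cnt UNIV ((step ^^ k) \<omega>) = 0" "simple_slopes \<omega>" "\<omega> \<in> space mu"
    show "\<not> two \<omega>"
    proof
      assume "two \<omega>"
      then obtain r s where "r \<in> slope_of \<omega>" "s \<in> slope_of \<omega>" "0 < r" "r < s" by (auto simp: two_def)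
      then obtain k where "gap_pairs (slope_of \<omega>) UNIV (real k) (real (Suc k)) \<noteq> {}"
        using consecutive_exists[OF finite_slopes, of \<omega> r s] \<omega>(3) by auto
      moreover have "emeasure (count_space UNIV) (gap_pairs (slope_of \<omega>) UNIV (real k) (real (Suc k))) = 0"
        using \<omega>(1) cnt_step_pow[OF \<omega>(2)] by metis
      ultimately show False by (simp add: emeasure_count_space_eq_0)
    qed
  qed
  moreover have S: "{\<omega>\<in>AX2. two \<omega>} \<in> sets borel_AX2"
  proof (rule sets_AX2I)
    have "lift {\<omega>\<in>AX2. two \<omega>} = {x. adet x > 0 \<and> (\<exists>z z'. in_strip x z \<and> in_strip x z' \<and> 0 < slope_at x z \<and> slope_at x z < slope_at x z')}"
    proof (rule set_eqI)
      fix x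
      show "x \<in> lift {\<omega>\<in>AX2. two \<omega>} \<longleftrightarrow> x \<in> {x. adet x > 0 \<and> (\<exists>z z'. in_strip x z \<and> in_strip x z' \<and> 0 < slope_at x z \<and> slope_at x z < slope_at x z')}"
        by (cases "adet x > 0") (simp_all add: lift_def two_def slope_of_nlat nlat_AX2, blast)
    qed
    also have "\<dots> \<in> sets borel" by measurable
    finally show "lift {\<omega>\<in>AX2. two \<omega>} \<in> sets borel" .
  qed auto
  ultimately have "emeasure mu {\<omega>\<in>AX2. two \<omega>} = 0"
    by (subst (asm) AE_iff_measurable[of "{\<omega>\<in>AX2. two \<omega>}"]) simp_all
  then have AE: "AE x in lborel. adet x > 0 \<longrightarrow> nlat x \<notin> {\<omega>\<in>AX2. two \<omega>}" by (simp only: mu_null_iff[OF S])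
  \<comment> \<open>Here the lattice points with coordinates \<open>(0, 0)\<close> and \<open>(1, 0)\<close> both lie in the strip, and the first has the larger slope.\<close>
  define W where "W = {x. 0 < adet x \<and> 0 < cp x \<and> cp x < sqrt (adet x) \<and> 0 < cp x + ca x \<and> cp x + ca x < sqrt (adet x) \<and>
    0 < cq x + cc x \<and> (cq x + cc x) * cp x < cq x * (cp x + ca x)}"
  have "open W" unfolding W_def adet_conv coord_defs
    by (intro open_Collect_conj open_Collect_less continuous_intros)
  moreover have "(((1/10, 0), 1/10), ((0, 1), 1/10)) \<in> W"
  proof -
    have "2/10 < sqrt (1/10 :: real)" by (rule real_less_rsqrt) (simp add: power2_eq_square)
    then show ?thesis by (simp add: W_def)
  qed
  ultimately have "emeasure lborel W \<noteq> 0" by (intro open_not_null) auto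
  moreover have "AE x in lborel. x \<notin> W"
    using AE
  proof eventually_elim
    fix x assume *: "adet x > 0 \<longrightarrow> nlat x \<notin> {\<omega>\<in>AX2. two \<omega>}"
    show "x \<notin> W"
    proof
      assume W: "x \<in> W"
      have p: "px x (0, 0) = cp x" "py x (0, 0) = cq x" "px x (1, 0) = cp x + ca x" "py x (1, 0) = cq x + cc x"
        by (simp_all add: px_eq py_eq)
      have det: "adet x > 0" and v: "in_strip x (0, 0)" "in_strip x (1, 0)" using W by (simp_all add: W_def in_strip_def p)
      have "0 < slope_at x (1, 0)" using W by (simp add: W_def slope_at_def p)
      moreover have "slope_at x (1, 0) < slope_at x (0, 0)" using W by (simp add: W_def slope_at_def p field_simps)
      ultimately have "two (nlat x)" unfolding two_def slope_of_nlat[OF det] using v by blast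
      then show False using * det nlat_AX2 by simp
    qed
  qed
  ultimately show False
    using \<open>open W\<close> by (subst (asm) AE_iff_measurable[of W]) auto
qed

lemma dens_UNIV: "dens UNIV > 0"
  using total_positive vol_real_pos by (simp add: dens_def)

definition gap_dist :: "real set \<Rightarrow> real" where "gap_dist D = measure gapm D / measure gapm UNIV"

lemma dens_ratio: "dens D / dens UNIV = gap_dist D"
proof -
  show ?thesis using vol_real_pos by (simp add: dens_def gap_dist_def)
qed

lemma gap_dist_Diff: "A \<in> sets borel \<Longrightarrow> B \<in> sets borel \<Longrightarrow> A \<subseteq> B \<Longrightarrow> gap_dist (B - A) = gap_dist B - gap_dist A"
  unfolding gap_dist_def by (subst gapm.finite_measure_Diff) (auto simp: diff_divide_distrib)

lemma gap_dist_singleton: "gap_dist {t} = 0"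
proof -
  have "{t} \<in> null_sets lborel" by (simp add: finite_imp_null_set_lborel)
  then have "{t} \<in> null_sets gapm" using gapm_absolutely_continuous unfolding absolutely_continuous_def by blast
  then show ?thesis by (simp add: gap_dist_def measure_eq_0_null_sets)
qed

lemma gap_dist_UNIV: "gap_dist UNIV = 1" using total_positive by (simp add: gap_dist_def)

text \<open>The gap distribution has no atoms, so its distribution function is continuous.\<close>

lemma gap_dist_approx:
  assumes e: "0 < e"
  shows "\<exists>p q :: rat. of_rat p < t \<and> t < of_rat q \<and> gap_dist {..of_rat q} < gap_dist {..t} + e \<and> gap_dist {..t} - e < gap_dist {..of_rat p}"
proof -
  have "(\<lambda>n. measure gapm {..t + 1 / real (Suc n)}) \<longlonglongrightarrow> measure gapm (\<Inter>n. {..t + 1 / real (Suc n)})"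
    by (rule gapm.finite_Lim_measure_decseq) (auto simp: decseq_def field_simps)
  also have "(\<Inter>n. {..t + 1 / real (Suc n)}) = {..t}"
  proof -
    have "x \<le> t" if "\<And>n. x \<le> t + 1 / real (Suc n)" for x
    proof (rule ccontr)
      assume "\<not> x \<le> t"
      then obtain n where "inverse (real (Suc n)) < x - t" using reals_Archimedean[of "x - t"] by auto
      then show False using that[of n] by (simp add: inverse_eq_divide)
    qed
    then show ?thesis by (auto intro: order_trans)
  qed
  finally have up: "(\<lambda>n. gap_dist {..t + 1 / real (Suc n)}) \<longlonglongrightarrow> gap_dist {..t}"
    unfolding gap_dist_def using total_positive by (intro tendsto_divide) auto
  have "(\<lambda>n. measure gapm {..t - 1 / real (Suc n)}) \<longlonglongrightarrow> measure gapm (\<Union>n. {..t - 1 / real (Suc n)})"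
    by (rule gapm.finite_Lim_measure_incseq) (auto simp: incseq_def field_simps)
  also have "(\<Union>n. {..t - 1 / real (Suc n)}) = {..<t}"
  proof -
    have "\<exists>n. x \<le> t - 1 / real (Suc n)" if lt: "x < t" for x
    proof -
      obtain n where "inverse (real (Suc n)) < t - x" using reals_Archimedean[of "t - x"] lt by auto
      then show ?thesis by (intro exI[of _ n]) (simp add: inverse_eq_divide)
    qed
    moreover have "t - 1 / real (Suc n) < t" for n by simp
    ultimately show ?thesis by (auto intro: le_less_trans)
  qed
  finally have "(\<lambda>n. gap_dist {..t - 1 / real (Suc n)}) \<longlonglongrightarrow> gap_dist {..<t}"
    unfolding gap_dist_def using total_positive by (intro tendsto_divide) auto
  moreover have "gap_dist {..<t} = gap_dist {..t}"
  proof -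
    have "{..<t} = {..t} - {t}" by auto
    then show ?thesis using gap_dist_Diff[of "{t}" "{..t}"] by (simp add: gap_dist_singleton)
  qed
  ultimately have lo: "(\<lambda>n. gap_dist {..t - 1 / real (Suc n)}) \<longlonglongrightarrow> gap_dist {..t}" by simp
  have mono: "gap_dist {..x} \<le> gap_dist {..y}" if "x \<le> y" for x y
    unfolding gap_dist_def using that by (intro divide_right_mono gapm.finite_measure_mono) auto
  have "\<forall>\<^sub>F n in sequentially. gap_dist {..t + 1 / real (Suc n)} < gap_dist {..t} + e"
    using order_tendstoD(2)[OF up, of "gap_dist {..t} + e"] e by simp
  then obtain n where n: "gap_dist {..t + 1 / real (Suc n)} < gap_dist {..t} + e" by (auto simp: eventually_sequentially)
  obtain q where q: "t < of_rat q" "of_rat q < t + 1 / real (Suc n)"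
    using of_rat_dense[of t "t + 1 / real (Suc n)"] by auto
  have "\<forall>\<^sub>F n in sequentially. gap_dist {..t} - e < gap_dist {..t - 1 / real (Suc n)}"
    using order_tendstoD(1)[OF lo, of "gap_dist {..t} - e"] e by simp
  then obtain m where m: "gap_dist {..t} - e < gap_dist {..t - 1 / real (Suc m)}" by (auto simp: eventually_sequentially)
  obtain p where p: "t - 1 / real (Suc m) < of_rat p" "of_rat p < t"
    using of_rat_dense[of "t - 1 / real (Suc m)" t] by auto
  show ?thesis
    using n m q p mono[of "of_rat q" "t + 1 / real (Suc n)"] mono[of "t - 1 / real (Suc m)" "of_rat p"]
    by (intro exI[of _ p] exI[of _ q]) auto
qed

lemma real_interval_cases:
  fixes I :: "real set"
  assumes "is_interval I"
  shows "\<exists>a b. I = {} \<or> I = UNIV \<or> I = {..<b} \<or> I = {..b} \<or> I = {a<..} \<or> I = {a..} \<or>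
    I = {a<..<b} \<or> I = {a<..b} \<or> I = {a..<b} \<or> I = {a..b}"
  by (rule interval_cases) (use assms in \<open>unfold is_interval_1, blast\<close>)

lemma interval_borel: "is_interval (I :: real set) \<Longrightarrow> I \<in> sets borel"
  by (drule real_interval_cases, elim exE disjE) simp_all

lemma (in slope_set) hits_Diff:
  assumes "A \<subseteq> B" shows "real (hits (B - A) N) = real (hits B N) - real (hits A N)"
proof -
  let ?X = "\<lambda>D. {i\<in>{1..N}. \<sigma> i - \<sigma> (i - 1) \<in> D}"
  have "?X (B - A) = ?X B - ?X A" by auto
  moreover have "?X A \<subseteq> ?X B" using assms by auto
  ultimately have "hits (B - A) N = hits B N - hits A N" "hits A N \<le> hits B N"
    unfolding hits_def by (simp_all add: card_Diff_subset card_mono)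
  then show ?thesis by simp
qed

text \<open>Half-lines are squeezed between half-lines with rational endpoints, and every interval is a
difference of two half-lines.\<close>

lemma (in slope_set) interval_limit:
  assumes rat: "\<And>q :: rat. (\<lambda>N. real (hits {..of_rat q} N) / real N) \<longlonglongrightarrow> gap_dist {..of_rat q}"
    and I: "is_interval I"
  shows "(\<lambda>N. real (hits I N) / real N) \<longlonglongrightarrow> gap_dist I"
proof -
  define R where "R A \<longleftrightarrow> (\<lambda>N. real (hits A N) / real N) \<longlonglongrightarrow> gap_dist A" for A
  have R_diff: "R (B - A)" if "R A" "R B" "A \<subseteq> B" "A \<in> sets borel" "B \<in> sets borel" for A B
    using tendsto_diff[OF that(2,1)[unfolded R_def]] unfolding R_def
    by (simp add: hits_Diff[OF that(3)] gap_dist_Diff[OF that(4,5,3)] diff_divide_distrib)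
  have R_UNIV: "R UNIV"
    unfolding R_def hits_UNIV gap_dist_UNIV
    by (rule tendsto_eventually, rule eventually_sequentiallyI[of 1]) simp
  have R_empty: "R {}" using R_diff[OF R_UNIV R_UNIV] by simp
  \<comment> \<open>Whether the endpoint belongs to the half-line makes no difference to the limit.\<close>
  have half: "R A" if A: "{..<t} \<subseteq> A" "A \<subseteq> {..t}" for A t
  proof -
    have "gap_dist {..<t} = gap_dist {..t}"
    proof -
      have "{..<t} = {..t} - {t}" by auto
      then show ?thesis using gap_dist_Diff[of "{t}" "{..t}"] by (simp add: gap_dist_singleton)
    qed
    moreover have "A = {..<t} \<or> A = {..t}"
    proof (cases "t \<in> A")
      case True
      have "s \<in> A" if "s \<le> t" for s using True A(1) that by (cases "s = t") auto
      then show ?thesis using A(2) by blast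
    next
      case False
      have "s < t" if "s \<in> A" for s
      proof -
        have "s \<le> t" "s \<noteq> t" using A(2) that False by auto
        then show ?thesis by simp
      qed
      then show ?thesis using A(1) by blast
    qed
    ultimately have gA: "gap_dist A = gap_dist {..t}" by auto
    show ?thesis unfolding R_def
    proof (rule LIMSEQ_I)
      fix e :: real assume e: "0 < e"
      obtain p q :: rat where pq: "of_rat p < t" "t < of_rat q"
        "gap_dist {..of_rat q} < gap_dist {..t} + e / 2" "gap_dist {..t} - e / 2 < gap_dist {..of_rat p}"
        using gap_dist_approx[of "e / 2" t] e by auto
      obtain N1 where N1: "\<And>N. N \<ge> N1 \<Longrightarrow> \<bar>real (hits {..of_rat q} N) / real N - gap_dist {..of_rat q}\<bar> < e / 2"
        using LIMSEQ_D[OF rat[of q], of "e/2"] e by auto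
      obtain N2 where N2: "\<And>N. N \<ge> N2 \<Longrightarrow> \<bar>real (hits {..of_rat p} N) / real N - gap_dist {..of_rat p}\<bar> < e / 2"
        using LIMSEQ_D[OF rat[of p], of "e/2"] e by auto
      show "\<exists>N0. \<forall>N\<ge>N0. norm (real (hits A N) / real N - gap_dist A) < e"
      proof (intro exI[of _ "max N1 N2"] allI impI)
        fix N assume N: "max N1 N2 \<le> N"
        have sub: "{..of_rat p} \<subseteq> A" "A \<subseteq> {..of_rat q}" using A pq by auto
        have "hits {..of_rat p} N \<le> hits A N" "hits A N \<le> hits {..of_rat q} N"
          unfolding hits_def using sub by (auto intro!: card_mono)
        then have sand: "real (hits {..of_rat p} N) / real N \<le> real (hits A N) / real N"
          "real (hits A N) / real N \<le> real (hits {..of_rat q} N) / real N"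
          by (simp_all add: divide_right_mono)
        have "\<bar>real (hits A N) / real N - gap_dist A\<bar> < e"
        proof -
          have "\<bar>real (hits {..of_rat q} N) / real N - gap_dist {..of_rat q}\<bar> < e / 2"
            "\<bar>real (hits {..of_rat p} N) / real N - gap_dist {..of_rat p}\<bar> < e / 2"
            using N N1 N2 by simp_all
          then show ?thesis using sand pq gA
            unfolding abs_less_iff by linarith
        qed
        then show "norm (real (hits A N) / real N - gap_dist A) < e" by simp
      qed
    qed
  qed
  have le: "R {..b}" and less: "R {..<b}" for b by (rule half[of b], auto)+
  have gt: "R {a<..}" and ge: "R {a..}" for a
    using R_diff[OF le[of a] R_UNIV] R_diff[OF less[of a] R_UNIV] by (simp_all add: Compl_eq_Diff_UNIV[symmetric])
  have minus: "{..<b} - {..a} = {a<..<b}" "{..b} - {..a} = {a<..b}" "{..<b} - {..<a} = {a..<b}"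
    "{..b} - {..<a} = {a..b}" for a b :: real by auto
  have bounded: "R {a<..<b}" "R {a<..b}" "R {a..<b}" "R {a..b}" if "a < b" for a b
  proof -
    have "{..a} \<subseteq> {..<b}" "{..a} \<subseteq> {..b}" "{..<a} \<subseteq> {..<b}" "{..<a} \<subseteq> {..b}" using that by auto
    then show "R {a<..<b}" "R {a<..b}" "R {a..<b}" "R {a..b}"
      using R_diff[OF le[of a] less[of b]] R_diff[OF le[of a] le[of b]]
        R_diff[OF less[of a] less[of b]] R_diff[OF less[of a] le[of b]] by (simp_all add: minus)
  qed
  have oo: "R {a<..<b}" and oc: "R {a<..b}" and co: "R {a..<b}" for a b
    by (cases "a < b"; simp add: bounded R_empty)+
  have cc: "R {a..b}" for a b
  proof (cases a b rule: linorder_cases)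
    case equal
    then show ?thesis using R_diff[OF less[of b] le[of b]] by (simp add: minus lessThan_subset_iff subset_iff)
  qed (simp_all add: bounded R_empty)
  from real_interval_cases[OF I] have "R I"
    using R_empty R_UNIV le less gt ge oo oc co cc by (elim exE disjE) simp_all
  then show ?thesis by (simp add: R_def)
qed

text \<open>The density is a Radon-Nikodym derivative; gaps are positive, so all its mass is on the half-line.\<close>

lemma gap_density_exists:
  "\<exists>g. prob_density_nonneg g \<and> (\<forall>I \<in> sets borel. (LINT x:I|lborel. g x) = gap_dist I)"
proof -
  obtain d where d: "d \<in> borel_measurable lborel" "AE x in lborel. RN_deriv lborel gapm x = ennreal (d x)" "\<And>x. 0 \<le> d x"
    by (rule sigma_finite_measure.real_RN_deriv[OF sigma_finite_lborel gapm.finite_measure_axioms gapm_absolutely_continuous]) simp_all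
  have [measurable]: "d \<in> borel_measurable borel" using d by simp
  define c where "c = measure gapm UNIV"
  have c: "c > 0" using total_positive by (simp add: c_def)
  have "gapm = density lborel (RN_deriv lborel gapm)"
    by (rule sigma_finite_measure.density_RN_deriv[OF sigma_finite_lborel, symmetric]) (simp_all add: gapm_absolutely_continuous)
  also have "\<dots> = density lborel (\<lambda>x. ennreal (d x))"
    by (rule density_cong) (use d in simp_all)
  finally have dens: "gapm = density lborel (\<lambda>x. ennreal (d x))" .
  define g where "g x = d x / c" for x
  have nn: "(\<integral>\<^sup>+x. ennreal (indicator A x * g x) \<partial>lborel) = ennreal (gap_dist A)" if [measurable]: "A \<in> sets borel" for A
  proof -
    have "emeasure gapm A = (\<integral>\<^sup>+x. ennreal (d x) * indicator A x \<partial>lborel)"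
      by (subst dens) (simp add: emeasure_density)
    then have "ennreal (1 / c) * emeasure gapm A = (\<integral>\<^sup>+x. ennreal (1 / c) * (ennreal (d x) * indicator A x) \<partial>lborel)"
      by (simp add: nn_integral_cmult)
    also have "\<dots> = (\<integral>\<^sup>+x. ennreal (indicator A x * g x) \<partial>lborel)"
      using c d(3) by (intro nn_integral_cong) (auto simp: g_def indicator_def ennreal_mult[symmetric])
    finally show ?thesis
      using c by (simp add: gapm.emeasure_eq_measure ennreal_mult[symmetric] gap_dist_def c_def)
  qed
  have gd: "0 \<le> gap_dist A" for A by (simp add: gap_dist_def)
  have g0: "0 \<le> g x" for x using c d(3) by (simp add: g_def)
  have [measurable]: "g \<in> borel_measurable borel" unfolding g_def by measurable
  have si: "set_integrable lborel A g" if [measurable]: "A \<in> sets borel" for A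
    unfolding set_integrable_def
    by (rule integrableI_nonneg) (use nn[OF that] g0 in \<open>auto simp: scaleR_conv_of_real\<close>)
  have li: "(LINT x:A|lborel. g x) = gap_dist A" if [measurable]: "A \<in> sets borel" for A
    unfolding set_lebesgue_integral_def
    using nn[OF that] g0 gd[of A] by (subst integral_eq_nn_integral) auto
  have "gap_dist {0..} = 1"
  proof -
    have "measure gapm {..<0} \<le> measure gapm {..0}" by (rule gapm.finite_measure_mono) auto
    also have "\<dots> = 0" using gapm_nonpositive by (simp add: measure_def)
    finally have "gap_dist {..<0} = 0" using measure_nonneg[of gapm "{..<0}"] by (simp add: gap_dist_def)
    moreover have "{0..} = UNIV - {..<0::real}" by auto
    ultimately show ?thesis using gap_dist_Diff[of "{..<0}" UNIV] by (simp add: gap_dist_UNIV)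
  qed
  then have "prob_density_nonneg g"
    unfolding prob_density_nonneg_def using g0 si[of "{0..}"] li[of "{0..}"] by simp
  then show ?thesis using li by blast
qed

lemma AE_gap_statistics:
  "AE \<omega> in mu. \<forall>I. is_interval I \<longrightarrow>
    (\<lambda>N. real (size (filter_mset (\<lambda>x. x \<in> I) (slope_gaps \<omega> N))) / real N) \<longlonglongrightarrow> gap_dist I"
proof -
  have "AE \<omega> in mu. \<forall>q :: rat. (\<lambda>n. real (card (gap_pairs (slope_of \<omega>) {..of_rat q} 0 (real n))) / real n) \<longlonglongrightarrow> dens {..of_rat q}"
    unfolding AE_all_countable by (intro allI AE_gap_pairs_limit) simp
  moreover have "AE \<omega> in mu. (\<lambda>n. real (card (gap_pairs (slope_of \<omega>) UNIV 0 (real n))) / real n) \<longlonglongrightarrow> dens UNIV"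
    by (rule AE_gap_pairs_limit) simp
  ultimately show ?thesis using AE_space[of mu]
  proof eventually_elim
    fix \<omega>
    assume rat: "\<forall>q :: rat. (\<lambda>n. real (card (gap_pairs (slope_of \<omega>) {..of_rat q} 0 (real n))) / real n) \<longlonglongrightarrow> dens {..of_rat q}"
      and tot: "(\<lambda>n. real (card (gap_pairs (slope_of \<omega>) UNIV 0 (real n))) / real n) \<longlonglongrightarrow> dens UNIV"
      and \<omega>: "\<omega> \<in> space mu"
    interpret slope_set "slope_of \<omega>" "slope_seq \<omega>" "dens UNIV"
      by unfold_locales (use finite_slopes \<omega> tot dens_UNIV in \<open>simp_all add: slopes_eq\<close>)
    have hits: "size (filter_mset (\<lambda>x. x \<in> I) (slope_gaps \<omega> N)) = hits I N" for I N
      unfolding slope_gaps_def hits_def by (simp add: filter_mset_image_mset filter_mset_mset_set)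
    have "(\<lambda>N. real (hits {..of_rat q} N) / real N) \<longlonglongrightarrow> gap_dist {..of_rat q}" for q :: rat
      using hits_limit[OF rat[rule_format, of q]] by (simp add: dens_ratio)
    then show "\<forall>I. is_interval I \<longrightarrow>
      (\<lambda>N. real (size (filter_mset (\<lambda>x. x \<in> I) (slope_gaps \<omega> N))) / real N) \<longlonglongrightarrow> gap_dist I"
      unfolding hits using interval_limit by blast
  qed
qed

text \<open>Membership in the Lebesgue class determines the null sets.\<close>

lemma AE_transfer:
  assumes \<mu>: "invariant_Lebesgue_class_prob \<mu>" and AE: "AE \<omega> in mu. P \<omega>"
  shows "AE \<omega> in \<mu>. P \<omega>"
proof -
  have sets: "sets \<mu> = sets borel_AX2" using \<mu> by (simp add: invariant_Lebesgue_class_prob_def)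
  then have space: "space \<mu> = AX2" using sets_eq_imp_space_eq[OF sets] by (simp add: space_borel_AX2)
  obtain N where N: "N \<in> null_sets mu" "{\<omega>\<in>space mu. \<not> P \<omega>} \<subseteq> N" using AE by (auto simp: eventually_ae_filter)
  then have Ns: "N \<in> sets borel_AX2" by auto
  have "period_cone N \<in> null_sets lborel"
    using N(1) by (simp add: null_period_cone_iff[OF Ns] mu_null_iff[OF Ns, symmetric] null_setsD1)
  then have "N \<in> null_sets \<mu>"
    using \<mu> Ns sets by (simp add: invariant_Lebesgue_class_prob_def in_Lebesgue_class_def)
  then show ?thesis using N(2) space by (intro AE_I') auto
qed

text \<open>The density is the normalised mean count of gaps, which is also the almost-sure limit for the constructed measure; every other
admissible measure has the same null sets.\<close>

theorem theorem2p2: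
  "\<exists>g :: real \<Rightarrow> real. prob_density_nonneg g \<and>
     (\<exists>\<mu>. invariant_Lebesgue_class_prob \<mu>) \<and>
     (\<forall>\<mu>. invariant_Lebesgue_class_prob \<mu> \<longrightarrow>
       (AE \<omega> in \<mu>. \<forall>I :: real set. is_interval I \<and> I \<subseteq> {0..} \<longrightarrow>
         (\<lambda>N. real (size (filter_mset (\<lambda>x. x \<in> I) (slope_gaps \<omega> N))) / real N)
           \<longlonglongrightarrow> (LINT x:I|lborel. g x)))"
proof -
  obtain g where g: "prob_density_nonneg g" "\<And>I. I \<in> sets borel \<Longrightarrow> (LINT x:I|lborel. g x) = gap_dist I"
    using gap_density_exists by blast
  have "AE \<omega> in \<mu>. \<forall>I :: real set. is_interval I \<and> I \<subseteq> {0..} \<longrightarrow>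
         (\<lambda>N. real (size (filter_mset (\<lambda>x. x \<in> I) (slope_gaps \<omega> N))) / real N)
           \<longlonglongrightarrow> (LINT x:I|lborel. g x)" if "invariant_Lebesgue_class_prob \<mu>" for \<mu>
    using AE_transfer[OF that AE_gap_statistics]
  proof eventually_elim
    fix \<omega>
    assume *: "\<forall>I. is_interval I \<longrightarrow>
      (\<lambda>N. real (size (filter_mset (\<lambda>x. x \<in> I) (slope_gaps \<omega> N))) / real N) \<longlonglongrightarrow> gap_dist I"
    have "(LINT x:I|lborel. g x) = gap_dist I" if "is_interval I" for I :: "real set"
      using that by (intro g(2) interval_borel)
    then show "\<forall>I :: real set. is_interval I \<and> I \<subseteq> {0..} \<longrightarrow>
         (\<lambda>N. real (size (filter_mset (\<lambda>x. x \<in> I) (slope_gaps \<omega> N))) / real N)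
           \<longlonglongrightarrow> (LINT x:I|lborel. g x)" using * by simp
  qed
  then show ?thesis using g(1) invariant_Lebesgue_class_prob_mu by blast
qed

end
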